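(* Let $b\ge2$ and $1\le s<b$ be integers with $\gcd(s,b)=1$. Let $\psi$ be the meander potential of the pair $(s,b)$ and put $\ell=\max_i\psi(i)-\min_i\psi(i)$. For the family $W(s+qb,b)$, $q\ge0$, the Ooms spectra are log-concave for all $q\ge 0$ if and only if the spectra for $$q=0,1,\ldots,2\ell+4$$ are log-concave. The same equivalence holds with "log-concave" replaced by "strictly internally log-concave". For $b=1$, the assertion holds with initial pair $(1,1)$ (i.e. for the family $W(1+q,1)$, $q\ge0$) and $\ell=1$.
   Context: For positive integers $a,b$, let $$W(a,b)=\left\{\begin{pmatrix}X&Z\\0&Y\end{pmatrix}: X\in\operatorname{Mat}_a(\mathbb C),\ Y\in\operatorname{Mat}_b(\mathbb C),\ Z\in\operatorname{Mat}_{a\times b}(\mathbb C),\ \operatorname{tr}X+\operatorname{tr}Y=0\right\},$$ a Lie algebra under the commutator. A finite-dimensional complex Lie algebra $\mathfrak g$ is Frobenius if there is $\varphi\in\mathfrak g^*$ such that the bilinear form $B_\varphi(x,y)=\varphi([x,y])$ is nondegenerate; such $\varphi$ is called a Frobenius functional and determines a unique principal element $h\in\mathfrak g$ by $\varphi([h,x])=\varphi(x)$ for all $x\in\mathfrak g$. It is known that $W(a,b)$ is Frobenius exactly when $\gcd(a,b)=1$, and that the multiset of eigenvalues of $\operatorname{ad}h$ (with algebraic multiplicities) does not depend on the choice of Frobenius functional; this multiset is the Ooms spectrum. The distinct eigenvalues are integers forming an unbroken interval. The multiplicity sequence is the sequence of multiplicities, listed in order of increasing distinct eigenvalue. A positive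 sequence $(c_0,\ldots,c_t)$ is log-concave if $c_j^2\ge c_{j-1}c_{j+1}$ for $1\le j<t$, and strictly internally log-concave if all these inequalities are strict (a two-term sequence has no internal inequality). An Ooms spectrum is called (strictly internally) log-concave if its multiplicity sequence is. Meander potential of a coprime pair $(a,b)$: put $v=a+b$ and take vertices $1,\ldots,v$. Top edges join opposite vertices within the intervals $[1,a]$ and $[a+1,v]$ (i.e. $i$ with $a+1-i$ in the first interval, and $i$ with $a+1+v-i$ in the second); bottom edges join opposite vertices within $[1,v]$ ($i$ with $v+1-i$). Fixed vertices of a reflection carry no edge. For coprime $a,b$ this graph is a single path. The potential $\psi:\{1,\ldots,v\}\to\mathbb Z$ is determined up to an additive constant by $\psi(y)=\psi(x)+1$ on each top edge $x<y$ and $\psi(x)=\psi(y)+1$ on each bottom edge $x<y$. *)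

theory Defs
  imports
    "Jordan_Normal_Form.VS_Connect"
    "Jordan_Normal_Form.Char_Poly"
begin

section \<open>The Lie algebras $W(a,b)$\<close>

definition mat_trace :: "'a::comm_monoid_add mat \<Rightarrow> 'a" where
  "mat_trace A = (\<Sum>i<dim_row A. A $$ (i, i))"

definition W :: "nat \<Rightarrow> nat \<Rightarrow> complex mat set" where
  "W a b = {four_block_mat X Z (0\<^sub>m b a) Y | X Y Z.
     X \<in> carrier_mat a a \<and> Y \<in> carrier_mat b b \<and> Z \<in> carrier_mat a b \<and>
     mat_trace X + mat_trace Y = 0}"

definition commutator :: "complex mat \<Rightarrow> complex mat \<Rightarrow> complex mat" where
  "commutator x y = x * y - y * x"


section \<open>Frobenius functionals and the Ooms spectrum\<close>

text \<open>
  Below, \<open>L\<close> is a Lie algebra of complex \<open>n \<times> n\<close> matrices under the commutator. A functional on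
  \<open>L\<close> is a HOL function on all matrices of which only the values on \<open>L\<close> matter.
\<close>

definition linear_functional :: "complex mat set \<Rightarrow> (complex mat \<Rightarrow> complex) \<Rightarrow> bool" where
  "linear_functional L \<phi> \<longleftrightarrow>
     (\<forall>x\<in>L. \<forall>y\<in>L. \<phi> (x + y) = \<phi> x + \<phi> y) \<and>
     (\<forall>c. \<forall>x\<in>L. \<phi> (c \<cdot>\<^sub>m x) = c * \<phi> x)"

text \<open>
  The form \<open>\<phi> [x, y]\<close> is alternating, so its left and right radicals coincide.
\<close>

definition frobenius_functional :: "nat \<Rightarrow> complex mat set \<Rightarrow> (complex mat \<Rightarrow> complex) \<Rightarrow> bool" where
  "frobenius_functional n L \<phi> \<longleftrightarrow>
     linear_functional L \<phi> \<and>
     (\<forall>x\<in>L. (\<forall>y\<in>L. \<phi> (commutator x y) = 0) \<longrightarrow> x = 0\<^sub>m n n)"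

definition principal_element ::
    "complex mat set \<Rightarrow> (complex mat \<Rightarrow> complex) \<Rightarrow> complex mat \<Rightarrow> bool" where
  "principal_element L \<phi> h \<longleftrightarrow> h \<in> L \<and> (\<forall>x\<in>L. \<phi> (commutator h x) = \<phi> x)"

definition mat_space :: "nat \<Rightarrow> complex mat set \<Rightarrow> (complex, complex mat) module" where
  "mat_space n L = (module_mat TYPE(complex) n n)\<lparr>carrier := L\<rparr>"

text \<open>\<open>A\<close> is the matrix of the endomorphism \<open>T\<close> of \<open>V\<close> with respect to the ordered basis \<open>bs\<close>.\<close>

definition represents ::
    "(complex, 'v) module \<Rightarrow> ('v \<Rightarrow> 'v) \<Rightarrow> 'v list \<Rightarrow> complex mat \<Rightarrow> bool" where
  "represents V T bs A \<longleftrightarrow>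
     distinct bs \<and> vectorspace.basis class_ring V (set bs) \<and>
     A \<in> carrier_mat (length bs) (length bs) \<and>
     (\<forall>j<length bs. T (bs ! j) =
        finsum V (\<lambda>i. A $$ (i, j) \<odot>\<^bsub>V\<^esub> (bs ! i)) {..<length bs})"

text \<open>
  The characteristic polynomial does not depend on the basis, and the Ooms spectrum does not
  depend on the Frobenius functional; hence the definite descriptions.
\<close>

definition endo_char_poly :: "(complex, 'v) module \<Rightarrow> ('v \<Rightarrow> 'v) \<Rightarrow> complex poly" where
  "endo_char_poly V T = (THE p. \<exists>bs A. represents V T bs A \<and> p = char_poly A)"

text \<open>
  \<^const>\<open>proots\<close> is the multiset of roots of a polynomial, with their multiplicities.
\<close>

definition ooms_spectrum :: "nat \<Rightarrow> complex mat set \<Rightarrow> complex multiset" where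
  "ooms_spectrum n L =
     (THE M. \<exists>\<phi> h. frobenius_functional n L \<phi> \<and> principal_element L \<phi> h \<and>
        M = proots (endo_char_poly (mat_space n L) (commutator h)))"

text \<open>
  The eigenvalues in question are integers, so they are listed in increasing order as elements
  of \<^typ>\<open>int\<close>.
\<close>

definition multiplicity_sequence :: "complex multiset \<Rightarrow> nat list" where
  "multiplicity_sequence M =
     map (\<lambda>k. count M (of_int k)) (sorted_list_of_set {k::int. of_int k \<in># M})"

definition log_concave :: "nat list \<Rightarrow> bool" where
  "log_concave c \<longleftrightarrow> (\<forall>x\<in>set c. 0 < x) \<and>
     (\<forall>j. 1 \<le> j \<and> j + 1 < length c \<longrightarrow> (c ! j)\<^sup>2 \<ge> c ! (j - 1) * c ! (j + 1))"

definition strictly_internally_log_concave :: "nat list \<Rightarrow> bool" where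
  "strictly_internally_log_concave c \<longleftrightarrow> (\<forall>x\<in>set c. 0 < x) \<and>
     (\<forall>j. 1 \<le> j \<and> j + 1 < length c \<longrightarrow> (c ! j)\<^sup>2 > c ! (j - 1) * c ! (j + 1))"

definition W_log_concave :: "nat \<Rightarrow> nat \<Rightarrow> bool" where
  "W_log_concave a b \<longleftrightarrow>
     log_concave (multiplicity_sequence (ooms_spectrum (a + b) (W a b)))"

definition W_strictly_internally_log_concave :: "nat \<Rightarrow> nat \<Rightarrow> bool" where
  "W_strictly_internally_log_concave a b \<longleftrightarrow>
     strictly_internally_log_concave (multiplicity_sequence (ooms_spectrum (a + b) (W a b)))"


section \<open>The meander potential\<close>

text \<open>An edge is represented by the pair \<open>(x, y)\<close> of its end points with \<open>x < y\<close>.\<close>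

definition top_edges :: "nat \<Rightarrow> nat \<Rightarrow> (nat \<times> nat) set" where
  "top_edges a b =
     {(x, y). 1 \<le> x \<and> x < y \<and> y \<le> a \<and> x + y = a + 1} \<union>
     {(x, y). a + 1 \<le> x \<and> x < y \<and> y \<le> a + b \<and> x + y = a + 1 + (a + b)}"

definition bottom_edges :: "nat \<Rightarrow> nat \<Rightarrow> (nat \<times> nat) set" where
  "bottom_edges a b = {(x, y). 1 \<le> x \<and> x < y \<and> y \<le> a + b \<and> x + y = a + b + 1}"

text \<open>For coprime \<open>a\<close>, \<open>b\<close> such a \<open>\<psi>\<close> exists and is unique on \<open>{1..a + b}\<close> up to an additive constant.\<close>

definition meander_potential :: "nat \<Rightarrow> nat \<Rightarrow> (nat \<Rightarrow> int) \<Rightarrow> bool" where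
  "meander_potential a b \<psi> \<longleftrightarrow>
     (\<forall>(x, y)\<in>top_edges a b. \<psi> y = \<psi> x + 1) \<and>
     (\<forall>(x, y)\<in>bottom_edges a b. \<psi> x = \<psi> y + 1)"

definition potential_range :: "nat \<Rightarrow> nat \<Rightarrow> (nat \<Rightarrow> int) \<Rightarrow> nat" where
  "potential_range a b \<psi> = nat (Max (\<psi> ` {1..a + b}) - Min (\<psi> ` {1..a + b}))"

end

(*
  A Frobenius functional phi has an open orbit under the coadjoint action: along the line phi_t from
  one Frobenius functional to another, the direction phi_1 - phi_0 equals phi_t([u, -]) for some u, and
  the principal elements h_t then satisfy the Lax equation h' = [h, u]. Hence the traces of the powers
  of ad h_t are constant on the complement of finitely many points of the complex line, and the
  spectrum does not depend on the functional. For W(a,b) the sum of the coordinates at the meander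
  edges is a Frobenius functional (Euclidean induction (a+b, b) -> (a, b)) with the diagonal principal
  element given by psi, so the spectrum consists of the differences psi(i) - psi(j).

  Write A and B for the generating functions of psi on the two blocks and B* for B(1/t). One Euclidean
  step replaces (A, B) by (A + B, B / t), so the multiplicities S_q of W(s + q b, b) are explicit in
  C = B B* and D = A B*, which are supported in [-l, l]. The symmetry S_q[1 - k] = S_q[k] gives
  S_q[k] - S_q[k + 1] = E_q[k] - E_q[-k] with E_q = A_q B_q*. Therefore S_{q+1}[k + 1] = S_q[k] for
  k > l, while for 1 <= k < q - l the second difference of S_q is -(C[k] + C[k - 1]), so that S_q is
  concave there and, by C[0] > 0, even strictly log-concave. For q >= 2 l + 2 these two ranges overlap
  and log-concavity passes from q to q + 1.
*)

theory Submission
  imports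
    Defs
    "Jordan_Normal_Form.Schur_Decomposition"
    "HOL-Analysis.Henstock_Kurzweil_Integration"
    "HOL-Analysis.Path_Connected"
begin

section \<open>Difference counts along a family of pairs\<close>

text \<open>\<open>diff_count \<alpha> \<beta> k\<close> is the coefficient of t^k in A B*. Both
  \<open>ooms_spectrum\<close> and \<open>endo_char_poly\<close> are definite descriptions, so no
  spectrum can be computed before uniqueness is proved: independence of the basis through similar
  matrices, independence of the functional through the Lax equation. The latter stands in for the
  coadjoint group action; it needs only linear algebra at a fixed t and one differentiation. Traces
  of powers are followed along the line because they are rational in t, which single eigenvalues
  need not be, and because they determine a multiset of complex numbers. The symmetry S_q[1 - k] =
  S_q[k] has a conceptual source: phi([h, z]) = phi(z) forces the weights of x and y to add up to 1
  whenever phi([x, y]) is nonzero, so the form pairs the eigenspace for k with that for 1 - k. Here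
  it is obtained from the Euclidean step instead, which adds to S a term invariant under k -> 1 - k.
  The concavity argument runs on bare multisets of integers and meets the Lie algebra only through
  \<open>ooms_spectrum_count\<close>.\<close>

definition diff_count :: "int multiset \<Rightarrow> int multiset \<Rightarrow> int \<Rightarrow> int" where
  "diff_count \<alpha> \<beta> k = (\<Sum>x\<in>#\<alpha>. \<Sum>y\<in>#\<beta>. of_bool (x - y = k))"

lemma diff_count_add_left: "diff_count (\<alpha> + \<gamma>) \<beta> k = diff_count \<alpha> \<beta> k + diff_count \<gamma> \<beta> k"
  by (simp add: diff_count_def)

lemma diff_count_add_right: "diff_count \<alpha> (\<beta> + \<gamma>) k = diff_count \<alpha> \<beta> k + diff_count \<alpha> \<gamma> k"
  by (simp add: diff_count_def sum_mset.distrib)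

lemma diff_count_shift_left:
  "diff_count (image_mset (\<lambda>x. x + c) \<alpha>) \<beta> k = diff_count \<alpha> \<beta> (k - c)"
  by (simp add: diff_count_def multiset.map_comp o_def algebra_simps)

lemma diff_count_shift_right:
  "diff_count \<alpha> (image_mset (\<lambda>x. x + c) \<beta>) k = diff_count \<alpha> \<beta> (k + c)"
  by (simp add: diff_count_def multiset.map_comp o_def algebra_simps)

lemma diff_count_neg:
  "diff_count (image_mset uminus \<alpha>) (image_mset uminus \<beta>) k = diff_count \<beta> \<alpha> k"
proof -
  have "diff_count (image_mset uminus \<alpha>) (image_mset uminus \<beta>) k =
      (\<Sum>x\<in>#\<alpha>. \<Sum>y\<in>#\<beta>. of_bool (y - x = k))"
    by (simp add: diff_count_def multiset.map_comp o_def algebra_simps)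
  also have "\<dots> = diff_count \<beta> \<alpha> k"
    unfolding diff_count_def by (rule sum_mset.swap)
  finally show ?thesis .
qed

lemma diff_count_commute: "diff_count \<beta> \<alpha> k = diff_count \<alpha> \<beta> (- k)"
proof -
  have "diff_count \<beta> \<alpha> k = (\<Sum>y\<in>#\<alpha>. \<Sum>x\<in>#\<beta>. of_bool (x - y = k))"
    unfolding diff_count_def by (rule sum_mset.swap)
  also have "\<dots> = diff_count \<alpha> \<beta> (- k)"
    unfolding diff_count_def by (intro arg_cong[of _ _ sum_mset] image_mset_cong) auto
  finally show ?thesis .
qed

lemma diff_count_nonneg: "0 \<le> diff_count \<alpha> \<beta> k"
proof -
  have "0 \<le> (\<Sum>y\<in>#\<beta>. of_bool (x - y = k) :: int)" for x by (induction \<beta>) auto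
  thus ?thesis unfolding diff_count_def by (induction \<alpha>) (auto intro: add_nonneg_nonneg)
qed

lemma diff_count_eq_0:
  assumes "\<And>x y. x \<in># \<alpha> \<Longrightarrow> y \<in># \<beta> \<Longrightarrow> x - y \<noteq> k"
  shows "diff_count \<alpha> \<beta> k = 0"
proof -
  have "diff_count \<alpha> \<beta> k = (\<Sum>x\<in>#\<alpha>. \<Sum>y\<in>#\<beta>. 0)"
    unfolding diff_count_def using assms by (intro arg_cong[of _ _ sum_mset] image_mset_cong) auto
  thus ?thesis by simp
qed

text \<open>An element paired with itself has difference 0. This is the source of strictness in
  \<open>S_decrement_pos\<close>.\<close>

lemma diff_count_self_pos:
  assumes "\<alpha> \<noteq> {#}"
  shows "0 < diff_count \<alpha> \<alpha> 0"
proof -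
  obtain x \<alpha>' where \<alpha>: "\<alpha> = \<alpha>' + {#x#}" using assms by (metis add_mset_add_single multiset_cases)
  have "diff_count {#x#} {#x#} 0 = 1" by (simp add: diff_count_def)
  moreover have "diff_count \<alpha> \<alpha> 0 = diff_count \<alpha>' \<alpha>' 0 + diff_count {#x#} \<alpha>' 0 +
      (diff_count \<alpha>' {#x#} 0 + diff_count {#x#} {#x#} 0)"
    unfolding \<alpha> diff_count_add_left diff_count_add_right ..
  ultimately show ?thesis
    using diff_count_nonneg[of \<alpha>' \<alpha>' 0] diff_count_nonneg[of \<alpha>' "{#x#}" 0]
      diff_count_nonneg[of "{#x#}" \<alpha>' 0] by simp
qed

text \<open>
  When \<open>\<alpha>\<close> and \<open>\<beta>\<close> list the values of \<open>\<psi>\<close> on the two blocks, this is the multiplicity of \<open>k\<close> in the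
  spectrum; the trace condition removes one zero.
\<close>

definition seaweed_count :: "int multiset \<Rightarrow> int multiset \<Rightarrow> int \<Rightarrow> int" where
  "seaweed_count \<alpha> \<beta> k =
     diff_count \<alpha> \<alpha> k + diff_count \<beta> \<beta> k + diff_count \<alpha> \<beta> k - of_bool (k = 0)"

abbreviation lower :: "int multiset \<Rightarrow> int multiset" where
  "lower \<beta> \<equiv> image_mset (\<lambda>x. x - 1) \<beta>"

text \<open>Bilinear expansion. Lowering both entries of a pair changes no difference, which gives a
  second copy of \<beta> against \<beta>; lowering only the second entry moves the difference up by
  one, whence the arguments k - 1.\<close>

lemma seaweed_count_step:
  "seaweed_count (\<alpha> + \<beta>) (lower \<beta>) k =
     seaweed_count \<alpha> \<beta> k + diff_count \<alpha> \<beta> (- k) + diff_count \<beta> \<beta> k + diff_count \<beta> \<beta> (k - 1)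
       + diff_count \<alpha> \<beta> (k - 1)"
  using diff_count_commute[of \<beta> \<alpha> k]
    diff_count_shift_left[of "-1"] diff_count_shift_right[of _ "-1"]
  by (simp add: seaweed_count_def diff_count_add_left diff_count_add_right)

lemma diff_count_step:
  "diff_count (\<alpha> + \<beta>) (lower \<beta>) k = diff_count \<alpha> \<beta> (k - 1) + diff_count \<beta> \<beta> (k - 1)"
  using diff_count_shift_right[of _ "-1"] by (simp add: diff_count_add_left)

lemma diff_count_lower: "diff_count (lower \<beta>) (lower \<beta>) k = diff_count \<beta> \<beta> k"
  using diff_count_shift_left[of "-1"] diff_count_shift_right[of _ "-1"] by simp

text \<open>The map k -> 1 - k exchanges the four added terms in pairs: the two values of
  \<open>diff_count \<alpha> \<beta>\<close> with each other, and those of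
  \<open>diff_count \<beta> \<beta>\<close> because that function is even.\<close>

lemma seaweed_count_step_symmetric:
  assumes "\<And>k. seaweed_count \<alpha> \<beta> (1 - k) = seaweed_count \<alpha> \<beta> k"
  shows "seaweed_count (\<alpha> + \<beta>) (lower \<beta>) (1 - k) = seaweed_count (\<alpha> + \<beta>) (lower \<beta>) k"
  using assms[of k] diff_count_commute[of \<beta> \<beta> k] diff_count_commute[of \<beta> \<beta> "k - 1"]
  by (simp add: seaweed_count_step)

lemma seaweed_count_nonneg:
  assumes "\<beta> \<noteq> {#}"
  shows "0 \<le> seaweed_count \<alpha> \<beta> k"
  using diff_count_self_pos[OF assms] diff_count_nonneg[of \<alpha> \<alpha> k] diff_count_nonneg[of \<beta> \<beta> k]
    diff_count_nonneg[of \<alpha> \<beta> k]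
  by (auto simp: seaweed_count_def)

text \<open>By the symmetry, the value at k + 1 is the value at -k. The differences within one block
  are even in k and cancel, so only the mixed term survives.\<close>

lemma seaweed_count_decrement:
  assumes "\<And>k. seaweed_count \<alpha> \<beta> (1 - k) = seaweed_count \<alpha> \<beta> k"
  shows "seaweed_count \<alpha> \<beta> k - seaweed_count \<alpha> \<beta> (k + 1) = diff_count \<alpha> \<beta> k - diff_count \<alpha> \<beta> (- k)"
  using assms[of "k + 1"] diff_count_commute[of \<alpha> \<alpha> k] diff_count_commute[of \<beta> \<beta> k]
  by (simp add: seaweed_count_def)

section \<open>Log-concavity of functions on the integers\<close>

definition log_concave_fun :: "(int \<Rightarrow> int) \<Rightarrow> bool" where
  "log_concave_fun f \<longleftrightarrow> (\<forall>k. f (k - 1) * f (k + 1) \<le> (f k)\<^sup>2)"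

text \<open>Multiplicities are extended by zero to all integers. The positivity premises confine the
  strict inequality to interior terms; off the support it would read 0 < 0.\<close>

definition strictly_log_concave_fun :: "(int \<Rightarrow> int) \<Rightarrow> bool" where
  "strictly_log_concave_fun f \<longleftrightarrow>
     (\<forall>k. 0 < f (k - 1) \<longrightarrow> 0 < f (k + 1) \<longrightarrow> f (k - 1) * f (k + 1) < (f k)\<^sup>2)"

text \<open>The cut at m splits the positive half-line: up to m the inequality for g is given, and
  for k > m the three values involved all lie in the range where g is a translate of f.\<close>

lemma log_concave_step_symmetric:
  fixes f g :: "int \<Rightarrow> int" and m :: int
  assumes sym: "\<And>k. g (1 - k) = g k"
    and mid: "\<And>k. 1 \<le> k \<Longrightarrow> k \<le> m \<Longrightarrow> g (k - 1) * g (k + 1) < (g k)\<^sup>2"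
    and shift: "\<And>k. m \<le> k \<Longrightarrow> g k = f (k - 1)"
  shows "log_concave_fun f \<Longrightarrow> log_concave_fun g"
    and "strictly_log_concave_fun f \<Longrightarrow> strictly_log_concave_fun g"
proof -
  \<comment> \<open>Reflection in 1/2 exchanges the two outer factors of the inequality, so it
    suffices to treat k >= 1.\<close>
  have right: "\<forall>k. P k" if "\<And>k. 1 \<le> k \<Longrightarrow> P k" "\<And>k. P (1 - k) \<longleftrightarrow> P k" for P :: "int \<Rightarrow> bool"
  proof
    show "P k" for k using that(1)[of k] that(1)[of "1 - k"] that(2)[of k] by (cases "1 \<le> k") auto
  qed
  have refl: "g (1 - k - 1) = g (k + 1)" "g (1 - k + 1) = g (k - 1)" for k
    using sym[of "k + 1"] sym[of "k - 1"] by (simp_all add: algebra_simps)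
  have tail: "g (k - 1) = f (k - 1 - 1)" "g k = f (k - 1)" "g (k + 1) = f (k - 1 + 1)" if "m < k" for k
    using that shift[of "k - 1"] shift[of k] shift[of "k + 1"] by simp_all
  show "log_concave_fun g" if "log_concave_fun f"
    unfolding log_concave_fun_def
  proof (rule right)
    fix k :: int assume "1 \<le> k"
    show "g (k - 1) * g (k + 1) \<le> (g k)\<^sup>2"
    proof (cases "k \<le> m")
      case True
      thus ?thesis using mid \<open>1 \<le> k\<close> by (simp add: less_imp_le)
    next
      case False
      thus ?thesis using that[unfolded log_concave_fun_def, rule_format, of "k - 1"] tail[of k] by simp
    qed
  qed (simp only: refl sym mult.commute)
  show "strictly_log_concave_fun g" if "strictly_log_concave_fun f"
    unfolding strictly_log_concave_fun_def
  proof (rule right)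
    fix k :: int assume "1 \<le> k"
    show "0 < g (k - 1) \<longrightarrow> 0 < g (k + 1) \<longrightarrow> g (k - 1) * g (k + 1) < (g k)\<^sup>2"
    proof (cases "k \<le> m")
      case True
      thus ?thesis using mid \<open>1 \<le> k\<close> by simp
    next
      case False
      thus ?thesis using that[unfolded strictly_log_concave_fun_def, rule_format, of "k - 1"] tail[of k] by simp
    qed
  qed (simp only: refl sym, auto simp: mult.commute)
qed

text \<open>All that the concavity argument takes from a meander: the values on the two blocks, the
  symmetry at the start of the family, and an interval of length l containing every value.\<close>

locale potential_family =
  fixes \<alpha> \<beta> :: "int multiset" and lo :: int and l :: nat
  assumes symmetric: "seaweed_count \<alpha> \<beta> (1 - k) = seaweed_count \<alpha> \<beta> k"
    and range: "x \<in># \<alpha> + \<beta> \<Longrightarrow> lo \<le> x \<and> x \<le> lo + int l"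
    and nonempty: "\<beta> \<noteq> {#}"
begin

primrec \<beta>s :: "nat \<Rightarrow> int multiset" where
  "\<beta>s 0 = \<beta>"
| "\<beta>s (Suc q) = lower (\<beta>s q)"

primrec \<alpha>s :: "nat \<Rightarrow> int multiset" where
  "\<alpha>s 0 = \<alpha>"
| "\<alpha>s (Suc q) = \<alpha>s q + \<beta>s q"

abbreviation C :: "int \<Rightarrow> int" where "C \<equiv> diff_count \<beta> \<beta>"
abbreviation D :: "int \<Rightarrow> int" where "D \<equiv> diff_count \<alpha> \<beta>"
abbreviation E :: "nat \<Rightarrow> int \<Rightarrow> int" where "E q \<equiv> diff_count (\<alpha>s q) (\<beta>s q)"
abbreviation S :: "nat \<Rightarrow> int \<Rightarrow> int" where "S q \<equiv> seaweed_count (\<alpha>s q) (\<beta>s q)"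

lemma diff_count_\<beta>s: "diff_count (\<beta>s q) (\<beta>s q) = C"
  by (induction q) (auto simp: diff_count_lower fun_eq_iff)

lemma \<beta>s_nonempty: "\<beta>s q \<noteq> {#}"
  using nonempty by (induction q) auto

lemma diff_count_out_of_range:
  assumes "\<gamma> \<subseteq># \<alpha> + \<beta>" "\<delta> \<subseteq># \<alpha> + \<beta>" "int l < \<bar>k\<bar>"
  shows "diff_count \<gamma> \<delta> k = 0"
proof (rule diff_count_eq_0)
  fix x y assume "x \<in># \<gamma>" "y \<in># \<delta>"
  hence "x \<in># \<alpha> + \<beta>" "y \<in># \<alpha> + \<beta>" using assms by (auto dest: mset_subset_eqD)
  thus "x - y \<noteq> k" using range[of x] range[of y] assms(3) by auto
qed

lemma C_0: "int l < \<bar>k\<bar> \<Longrightarrow> C k = 0"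
  and D_0: "int l < \<bar>k\<bar> \<Longrightarrow> D k = 0"
  by (auto intro: diff_count_out_of_range)

lemma S_0: "int l < \<bar>k\<bar> \<Longrightarrow> S 0 k = 0"
  using diff_count_out_of_range[of \<alpha> \<alpha> k] C_0[of k] D_0[of k] by (auto simp: seaweed_count_def)

lemma C_nonneg: "0 \<le> C k"
  by (rule diff_count_nonneg)

lemma E_Suc: "E (Suc q) k = E q (k - 1) + C (k - 1)"
  by (simp add: diff_count_step diff_count_\<beta>s)

text \<open>Each step moves E to the right by one and adds C moved by one. Hence E q consists of D
  moved by q and of copies of C moved by 1 up to q.\<close>

lemma E_closed: "E q k = D (k - int q) + (\<Sum>i=1..q. C (k - int i))"
proof (induction q arbitrary: k)
  case (Suc q)
  have "(\<Sum>i=1..Suc q. C (k - int i)) = C (k - 1) + (\<Sum>i=Suc 1..Suc q. C (k - int i))"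
    by (subst sum.atLeast_Suc_atMost) auto
  also have "(\<Sum>i=Suc 1..Suc q. C (k - int i)) = (\<Sum>i=1..q. C (k - 1 - int i))"
    unfolding sum.shift_bounds_cl_Suc_ivl by (simp add: algebra_simps)
  finally show ?case unfolding E_Suc Suc.IH by (simp add: algebra_simps)
qed simp

text \<open>All pieces of \<open>E_closed\<close> are moved to the right only, so nothing ever
  appears to the left of -l.\<close>

lemma E_left_0: "int l < k \<Longrightarrow> E q (- k) = 0"
  unfolding E_closed using D_0 C_0 by (auto intro!: sum.neutral)

lemma S_Suc: "S (Suc q) k = S q k + E q (- k) + C k + C (k - 1) + E q (k - 1)"
  by (simp add: seaweed_count_step diff_count_\<beta>s)

lemma S_symmetric: "S q (1 - k) = S q k"
proof (induction q arbitrary: k)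
  case 0
  show ?case using symmetric by simp
next
  case (Suc q)
  show ?case using seaweed_count_step_symmetric[OF Suc.IH] by simp
qed

lemma S_nonneg: "0 \<le> S q k"
  by (rule seaweed_count_nonneg[OF \<beta>s_nonempty])

lemma S_decrement: "S q k - S q (k + 1) = E q k - E q (- k)"
  by (rule seaweed_count_decrement[OF S_symmetric])

text \<open>For k > l the increment of S at k + 1 reduces to E (Suc q) k, which by
  \<open>E_Suc\<close> is the increment that S received at k one step earlier. Induction then
  compares equal increments.\<close>

lemma S_shift: "int l < k \<Longrightarrow> S (Suc q) (k + 1) = S q k"
proof (induction q)
  case 0
  have "E 0 (- (k + 1)) = 0" by (rule E_left_0) (use 0 in simp)
  thus ?case using 0 unfolding S_Suc[of 0]
    using S_0[of k] S_0[of "k + 1"] D_0[of k] C_0[of k] C_0[of "k + 1"] by simp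
next
  case (Suc q)
  have "E (Suc q) (- (k + 1)) = 0" "E q (- k) = 0" by (rule E_left_0, use Suc in simp)+
  moreover have "C k = 0" "C (k + 1) = 0" using C_0 Suc.prems by auto
  ultimately show ?case
    using Suc.IH[OF Suc.prems] E_Suc[of q k] by (simp only: S_Suc[of "Suc q"] S_Suc[of q]) simp
qed

lemma E_difference:
  "E q k - E q (k - 1) = D (k - int q) - D (k - 1 - int q) + C (k - 1) - C (k - 1 - int q)"
proof -
  have "(\<Sum>i=1..q. C (k - int i)) - (\<Sum>i=1..q. C (k - 1 - int i)) = C (k - 1) - C (k - 1 - int q)"
    by (induction q) (auto simp: algebra_simps)
  thus ?thesis unfolding E_closed by simp
qed

text \<open>Differencing the sum in \<open>E_closed\<close> leaves only its two ends. The bound on k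
  keeps D and the far end, both near q, out of reach; the near end contributes C (k - 1) around k
  and C (- k) = C k around -k.\<close>

lemma S_second_difference:
  assumes "1 \<le> k" "k < int q - int l"
  shows "(S q k - S q (k + 1)) - (S q (k - 1) - S q k) = C k + C (k - 1)"
proof -
  have z: "D (k - int q) = 0" "D (k - 1 - int q) = 0" "C (k - 1 - int q) = 0"
    "D (1 - k - int q) = 0" "D (- k - int q) = 0" "C (- k - int q) = 0"
    using assms by (auto intro!: D_0 C_0)
  have "(S q k - S q (k + 1)) - (S q (k - 1) - S q k) =
      (E q k - E q (k - 1)) + (E q (1 - k) - E q (- k))"
    using S_decrement[of q k] S_decrement[of q "k - 1"] by simp
  also have "\<dots> = C (k - 1) + C (- k)"
    using E_difference[of q k] E_difference[of q "1 - k"] z by simp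
  finally show ?thesis using diff_count_commute[of \<beta> \<beta> k] by simp
qed

text \<open>The symmetry gives S q 0 = S q 1, so the decrements start from 0. The first second
  difference C 1 + C 0 is positive, and later ones cannot decrease the decrement.\<close>

lemma S_decrement_pos:
  assumes "1 \<le> k" "k < int q - int l"
  shows "0 < S q k - S q (k + 1)"
  using assms
proof (induction k rule: int_ge_induct)
  case base
  thus ?case using S_second_difference[of 1 q] S_symmetric[of q 0] C_nonneg[of 1]
      diff_count_self_pos[OF nonempty] by simp
next
  case (step k)
  thus ?case using S_second_difference[of "k + 1" q] C_nonneg[of k] C_nonneg[of "k + 1"] by simp
qed

text \<open>Once q > 2 * l, every k >= 1 either lies in the concave range or exceeds l. In the
  latter case E q (- k) vanishes and the decrement is the count E q k.\<close>

lemma S_antimono: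
  assumes "2 * l < q" "1 \<le> k"
  shows "S q (k + 1) \<le> S q k"
proof (cases "k < int q - int l")
  case True
  thus ?thesis using S_decrement_pos[OF assms(2) True] by simp
next
  case False
  hence "E q (- k) = 0" using assms by (intro E_left_0) simp
  thus ?thesis using S_decrement[of q k] diff_count_nonneg[of "\<alpha>s q" "\<beta>s q" k] by simp
qed

text \<open>Concavity of a positive sequence gives log-concavity; strictness comes from the positive
  decrement d.\<close>

lemma S_middle:
  assumes "1 \<le> k" "k < int q - int l"
  shows "S q (k - 1) * S q (k + 1) < (S q k)\<^sup>2"
proof -
  define d d' y where "d = S q k - S q (k + 1)" and "d' = S q (k - 1) - S q k" and "y = S q k"
  have d: "0 < d" using S_decrement_pos[OF assms] by (simp add: d_def)
  have y: "0 < y" using d S_nonneg[of q "k + 1"] by (simp add: d_def y_def)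
  \<comment> \<open>The outer values are y + d' and y - d, so this is y^2 - (y + d') (y -
    d).\<close>
  have "(S q k)\<^sup>2 - S q (k - 1) * S q (k + 1) = y * (d - d') + d * d'"
    by (simp add: d_def d'_def y_def power2_eq_square algebra_simps)
  moreover have "0 < y * (d - d') + d * d'"
  \<comment> \<open>At k = 1 the symmetry makes d' zero, and y * d alone is positive.\<close>
  proof (cases "k = 1")
    case True
    thus ?thesis using S_symmetric[of q 0] d y by (simp add: d'_def)
  next
    case False
    hence "0 < d'" using S_decrement_pos[of "k - 1" q] assms by (simp add: d'_def)
    moreover have "0 \<le> d - d'" using S_second_difference[OF assms] C_nonneg[of k] C_nonneg[of "k - 1"]
      by (simp add: d_def d'_def)
    ultimately show ?thesis using d y by (simp add: add_nonneg_pos)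
  qed
  ultimately show ?thesis by simp
qed

text \<open>The cut is at l + 2: \<open>S_shift\<close> applies to k - 1 > l, and
  \<open>S_middle\<close> for Suc q must reach k = l + 2, that is, l + 2 < q + 1 - l. This is where
  2 * l + 2 comes from.\<close>

lemma log_concave_S_Suc:
  assumes "2 * l + 2 \<le> q"
  shows "log_concave_fun (S q) \<Longrightarrow> log_concave_fun (S (Suc q))"
    and "strictly_log_concave_fun (S q) \<Longrightarrow> strictly_log_concave_fun (S (Suc q))"
proof -
  have sym: "S (Suc q) (1 - k) = S (Suc q) k" for k by (rule S_symmetric)
  have mid: "S (Suc q) (k - 1) * S (Suc q) (k + 1) < (S (Suc q) k)\<^sup>2"
    if "1 \<le> k" "k \<le> int l + 2" for k
    using that assms by (intro S_middle) auto
  have shift: "S (Suc q) k = S q (k - 1)" if "int l + 2 \<le> k" for k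
    using S_shift[of "k - 1" q] that by simp
  note * = log_concave_step_symmetric[where f = "S q" and g = "S (Suc q)", OF sym mid shift]
  show "log_concave_fun (S q) \<Longrightarrow> log_concave_fun (S (Suc q))"
    and "strictly_log_concave_fun (S q) \<Longrightarrow> strictly_log_concave_fun (S (Suc q))"
    using *(1) *(2) by blast+
qed

end

section \<open>Meander potentials\<close>

lemma sorted_list_of_set_atLeastAtMost_int: "sorted_list_of_set {i..j::int} = [i..j]"
  by (metis distinct_upto set_upto sorted_list_of_set.idem_if_sorted_distinct sorted_upto)

text \<open>Monotonicity to the right of 1 excludes gaps there, and the symmetry carries this over
  to the left half. This is the unbroken interval of eigenvalues.\<close>

lemma symmetric_antimono_support:
  fixes f :: "int \<Rightarrow> int"
  assumes fin: "finite {k. 0 < f k}" and pos: "0 < f 1"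
    and sym: "\<And>k. f (1 - k) = f k" and anti: "\<And>k. 1 \<le> k \<Longrightarrow> f (k + 1) \<le> f k"
  obtains m where "1 \<le> m" "{k. 0 < f k} = {1 - m..m}"
proof -
  define m where "m = Max {k. 0 < f k}"
  have le_m: "k \<le> m" if "0 < f k" for k unfolding m_def using fin that by simp
  have m_pos: "0 < f m" using Max_in[OF fin] pos unfolding m_def by auto
  have mono: "f k' \<le> f k" if "1 \<le> k" "k \<le> k'" for k k'
    using that(2,1) by (induction k' rule: int_ge_induct) (auto intro: order_trans anti)
  have "0 < f k" if "1 \<le> k" "k \<le> m" for k using mono[OF that] m_pos by simp
  moreover have "0 < f k" if "k < 1" "1 - m \<le> k" for k
    using calculation[of "1 - k"] that sym[of k] by simp
  ultimately have "{1 - m..m} \<subseteq> {k. 0 < f k}" by (metis atLeastAtMost_iff mem_Collect_eq not_less subsetI)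
  moreover have "1 - m \<le> k" if "0 < f k" for k using le_m[of "1 - k"] that sym[of k] by simp
  ultimately show ?thesis using that[of m] le_m[OF pos] le_m by fastforce
qed

text \<open>As the support is an interval 1 - m..m, position j of the list carries the eigenvalue 1
  - m + j, and neighbours in the list are neighbouring integers.\<close>

lemma multiplicity_sequence_log_concave:
  fixes f :: "int \<Rightarrow> int"
  assumes cnt: "\<And>k. int (count M (of_int k)) = f k" and pos: "0 < f 1"
    and sym: "\<And>k. f (1 - k) = f k" and anti: "\<And>k. 1 \<le> k \<Longrightarrow> f (k + 1) \<le> f k"
  shows "log_concave (multiplicity_sequence M) \<longleftrightarrow> log_concave_fun f"
    and "strictly_internally_log_concave (multiplicity_sequence M) \<longleftrightarrow> strictly_log_concave_fun f"
proof -
  have supp: "{k::int. of_int k \<in># M} = {k. 0 < f k}"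
    by (simp flip: cnt)
  have "inj_on (of_int :: int \<Rightarrow> complex) X" for X by (auto simp: inj_on_def)
  hence "finite {k::int. of_int k \<in># M}"
    by (rule inj_on_finite[of of_int _ "set_mset M"]) auto
  with supp obtain m where m: "1 \<le> m" "{k. 0 < f k} = {1 - m..m}"
    using symmetric_antimono_support[OF _ pos sym anti] by metis
  define c where "c = multiplicity_sequence M"
  have c: "c = map (\<lambda>k. count M (of_int k)) [1 - m..m]"
    by (simp add: c_def multiplicity_sequence_def supp m(2) sorted_list_of_set_atLeastAtMost_int)
  have len: "length c = nat (2 * m)" by (simp add: c)
  have nth: "int (c ! j) = f (1 - m + int j)" if "j < length c" for j
    using that m(1) cnt[of "1 - m + int j"] by (simp add: c nth_upto)
  have "0 < count M (of_int k)" if "k \<in> {1 - m..m}" for k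
    using that cnt[of k] unfolding m(2)[symmetric] by (simp del: count_greater_zero_iff)
  hence c_pos: "\<forall>x\<in>set c. 0 < x" by (auto simp: c)
  have f_nonneg: "0 \<le> f k" for k using cnt[of k] by simp
  have f_0: "f k = 0" if "k < 1 - m \<or> m < k" for k
    using that m(2) f_nonneg[of k] by (smt (verit) atLeastAtMost_iff mem_Collect_eq)
  \<comment> \<open>Interior positions are exactly the k with both neighbours in the support. Q and
    R are left abstract so that the weak and the strict inequality share this translation.\<close>
  have inner: "(\<forall>j. 1 \<le> j \<and> j + 1 < length c \<longrightarrow> Q j) \<longleftrightarrow>
      (\<forall>k. 0 < f (k - 1) \<longrightarrow> 0 < f (k + 1) \<longrightarrow> R k)"
    if QR: "\<And>j. 1 \<le> j \<Longrightarrow> j + 1 < length c \<Longrightarrow> Q j \<longleftrightarrow> R (1 - m + int j)" for Q R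
  proof safe
    fix k assume *: "\<forall>j. 1 \<le> j \<and> j + 1 < length c \<longrightarrow> Q j" "0 < f (k - 1)" "0 < f (k + 1)"
    hence "k - 1 \<in> {k. 0 < f k}" "k + 1 \<in> {k. 0 < f k}" by simp_all
    moreover define j where "j = nat (k - 1 + m)"
    ultimately have "1 \<le> j" "j + 1 < length c" "1 - m + int j = k"
      unfolding m(2) len by auto
    thus "R k" using *(1) QR[of j] by simp
  next
    fix j assume *: "\<forall>k. 0 < f (k - 1) \<longrightarrow> 0 < f (k + 1) \<longrightarrow> R k" "1 \<le> j" "j + 1 < length c"
    hence "1 - m + int j - 1 \<in> {k. 0 < f k}" "1 - m + int j + 1 \<in> {k. 0 < f k}"
      unfolding m(2) using len by auto
    thus "Q j" using * QR[of j] by simp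
  qed
  have tri: "int (c ! (j - 1)) = f (1 - m + int j - 1)" "int (c ! j) = f (1 - m + int j)"
    "int (c ! (j + 1)) = f (1 - m + int j + 1)" if "1 \<le> j" "j + 1 < length c" for j
    using that nth[of "j - 1"] nth[of j] nth[of "j + 1"] by (auto simp: of_nat_diff algebra_simps)
  have lc: "(c ! j)\<^sup>2 \<ge> c ! (j - 1) * c ! (j + 1) \<longleftrightarrow>
      f (1 - m + int j - 1) * f (1 - m + int j + 1) \<le> (f (1 - m + int j))\<^sup>2"
    and slc: "(c ! j)\<^sup>2 > c ! (j - 1) * c ! (j + 1) \<longleftrightarrow>
      f (1 - m + int j - 1) * f (1 - m + int j + 1) < (f (1 - m + int j))\<^sup>2"
    if "1 \<le> j" "j + 1 < length c" for j
    unfolding tri[OF that, symmetric] by (simp_all flip: of_nat_mult of_nat_power)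
  have "log_concave c \<longleftrightarrow> (\<forall>k. 0 < f (k - 1) \<longrightarrow> 0 < f (k + 1) \<longrightarrow> f (k - 1) * f (k + 1) \<le> (f k)\<^sup>2)"
    unfolding log_concave_def using c_pos
      inner[of "\<lambda>j. (c ! j)\<^sup>2 \<ge> c ! (j - 1) * c ! (j + 1)" "\<lambda>k. f (k - 1) * f (k + 1) \<le> (f k)\<^sup>2", OF lc]
    by blast
  also have "\<dots> \<longleftrightarrow> log_concave_fun f"
    unfolding log_concave_fun_def using f_nonneg
    by (metis less_eq_int_code(1) mult_eq_0_iff order_le_less zero_le_power2)
  finally show "log_concave (multiplicity_sequence M) \<longleftrightarrow> log_concave_fun f"
    unfolding c_def .
  show "strictly_internally_log_concave (multiplicity_sequence M) \<longleftrightarrow> strictly_log_concave_fun f"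
    unfolding strictly_internally_log_concave_def strictly_log_concave_fun_def c_def[symmetric]
    using c_pos inner[of "\<lambda>j. (c ! j)\<^sup>2 > c ! (j - 1) * c ! (j + 1)"
        "\<lambda>k. f (k - 1) * f (k + 1) < (f k)\<^sup>2", OF slc]
    by blast
qed

section \<open>Meander potentials under the Euclidean step\<close>

lemma meander_potential_iff:
  "meander_potential a b \<psi> \<longleftrightarrow>
     (\<forall>x y. 1 \<le> x \<longrightarrow> x < y \<longrightarrow> x + y = a + 1 \<longrightarrow> \<psi> y = \<psi> x + 1) \<and>
     (\<forall>x y. a + 1 \<le> x \<longrightarrow> x < y \<longrightarrow> x + y = 2 * a + b + 1 \<longrightarrow> \<psi> y = \<psi> x + 1) \<and>
     (\<forall>x y. 1 \<le> x \<longrightarrow> x < y \<longrightarrow> x + y = a + b + 1 \<longrightarrow> \<psi> x = \<psi> y + 1)"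
proof -
  have "top_edges a b = {(x, y). 1 \<le> x \<and> x < y \<and> x + y = a + 1} \<union>
     {(x, y). a + 1 \<le> x \<and> x < y \<and> x + y = 2 * a + b + 1}"
    "bottom_edges a b = {(x, y). 1 \<le> x \<and> x < y \<and> x + y = a + b + 1}"
    by (auto simp: top_edges_def bottom_edges_def)
  thus ?thesis by (simp add: meander_potential_def ball_Un Ball_def all_conj_distrib imp_conjL conj_assoc)
qed

text \<open>Reversing the vertices exchanges the blocks but turns every edge around; the sign
  restores the orientation.\<close>

lemma meander_potential_swap:
  assumes "meander_potential a b \<psi>"
  shows "meander_potential b a (\<lambda>i. - \<psi> (a + b + 1 - i))"
proof -
  note m = assms[unfolded meander_potential_iff]
  show ?thesis unfolding meander_potential_iff
  proof (intro conjI allI impI)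
    fix x y :: nat
    show "- \<psi> (a + b + 1 - y) = - \<psi> (a + b + 1 - x) + 1" if "1 \<le> x" "x < y" "x + y = b + 1"
      using that m[THEN conjunct2, THEN conjunct1, rule_format, of "a + b + 1 - y" "a + b + 1 - x"] by simp
    show "- \<psi> (a + b + 1 - y) = - \<psi> (a + b + 1 - x) + 1" if "b + 1 \<le> x" "x < y" "x + y = 2 * b + a + 1"
      using that m[THEN conjunct1, rule_format, of "a + b + 1 - y" "a + b + 1 - x"] by simp
    show "- \<psi> (a + b + 1 - x) = - \<psi> (a + b + 1 - y) + 1" if "1 \<le> x" "x < y" "x + y = b + a + 1"
    proof -
      have "a + b + 1 - x = y" "a + b + 1 - y = x" using that by auto
      thus ?thesis using that m[THEN conjunct2, THEN conjunct2, rule_format, of x y] by simp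
    qed
  qed
qed

text \<open>For i <= b a bottom edge joins i to a + 2 * b + 1 - i in the last block. Contracting
  these b edges moves the top edges of the last block to [1, b]; the other bottom edges live on
  [b + 1, a + b]. What remains is the meander of (a, b) with top and bottom exchanged, and reversal
  of the vertices puts it upright.\<close>

lemma meander_potential_reduce:
  "meander_potential (a + b) b \<psi> \<longleftrightarrow>
     meander_potential a b (\<lambda>i. \<psi> (a + b + 1 - i)) \<and>
     (\<forall>i. 1 \<le> i \<longrightarrow> i \<le> b \<longrightarrow> \<psi> (a + 2 * b + 1 - i) = \<psi> i - 1)" (is "?L \<longleftrightarrow> ?R1 \<and> ?R2")
proof (intro iffI conjI)
  assume ?L
  note m = this[unfolded meander_potential_iff]
  note m1 = m[THEN conjunct1, rule_format] and m2 = m[THEN conjunct2, THEN conjunct1, rule_format]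
    and m3 = m[THEN conjunct2, THEN conjunct2, rule_format]
  show R2: ?R2
  proof (intro allI impI)
    fix i assume "1 \<le> i" "i \<le> b"
    thus "\<psi> (a + 2 * b + 1 - i) = \<psi> i - 1" using m3[of i "a + 2 * b + 1 - i"] by simp
  qed
  show ?R1 unfolding meander_potential_iff
  proof (intro conjI allI impI)
    fix x y :: nat
    show "\<psi> (a + b + 1 - y) = \<psi> (a + b + 1 - x) + 1" if "1 \<le> x" "x < y" "x + y = a + 1"
      using that m3[of "a + b + 1 - y" "a + b + 1 - x"] by simp
    show "\<psi> (a + b + 1 - y) = \<psi> (a + b + 1 - x) + 1" if "a + 1 \<le> x" "x < y" "x + y = 2 * a + b + 1"
    proof -
      define X Y where "X = a + b + 1 - x" and "Y = a + b + 1 - y"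
      have XY: "1 \<le> X" "X \<le> b" "1 \<le> Y" "Y \<le> b" "a + 2 * b + 1 - X = b + x" "a + 2 * b + 1 - Y = b + y"
        using that by (auto simp: X_def Y_def)
      have "\<psi> (b + y) = \<psi> (b + x) + 1" by (rule m2) (use that in auto)
      thus ?thesis using R2[rule_format, OF XY(1,2)] R2[rule_format, OF XY(3,4)]
        unfolding XY(5,6) X_def[symmetric] Y_def[symmetric] by simp
    qed
    show "\<psi> (a + b + 1 - x) = \<psi> (a + b + 1 - y) + 1" if "1 \<le> x" "x < y" "x + y = a + b + 1"
      using that m1[of "a + b + 1 - y" "a + b + 1 - x"] by simp
  qed
next
  assume R: "?R1 \<and> ?R2"
  note m = R[THEN conjunct1, unfolded meander_potential_iff]
  note m1 = m[THEN conjunct1, rule_format] and m2 = m[THEN conjunct2, THEN conjunct1, rule_format]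
    and m3 = m[THEN conjunct2, THEN conjunct2, rule_format] and R2 = R[THEN conjunct2, rule_format]
  show ?L unfolding meander_potential_iff
  proof (intro conjI allI impI)
    fix x y :: nat
    show "\<psi> y = \<psi> x + 1" if "1 \<le> x" "x < y" "x + y = a + b + 1"
    proof -
      have "a + b + 1 - x = y" "a + b + 1 - y = x" using that by auto
      thus ?thesis using that m3[of x y] by simp
    qed
    show "\<psi> y = \<psi> x + 1" if "a + b + 1 \<le> x" "x < y" "x + y = 2 * (a + b) + b + 1"
    proof -
      define X Y where "X = a + 2 * b + 1 - x" and "Y = a + 2 * b + 1 - y"
      have XY: "1 \<le> X" "X \<le> b" "1 \<le> Y" "Y \<le> b" "a + 2 * b + 1 - X = x" "a + 2 * b + 1 - Y = y"
        "a + b + 1 - (x - b) = X" "a + b + 1 - (y - b) = Y"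
        using that by (auto simp: X_def Y_def)
      have "\<psi> Y = \<psi> X + 1"
        unfolding XY(7,8)[symmetric] by (rule m2) (use that in auto)
      thus ?thesis using R2[OF XY(1,2)] R2[OF XY(3,4)] unfolding XY(5,6) by simp
    qed
    show "\<psi> x = \<psi> y + 1" if "1 \<le> x" "x < y" "x + y = a + b + b + 1"
    proof (cases "x \<le> b")
      case True
      have "a + 2 * b + 1 - x = y" using that(3) by linarith
      thus ?thesis using R2[of x] True that by simp
    next
      case False
      define X Y where "X = a + b + 1 - x" and "Y = a + b + 1 - y"
      have XY: "1 \<le> Y" "Y < X" "Y + X = a + 1" "a + b + 1 - X = x" "a + b + 1 - Y = y"
        using that False by (auto simp: X_def Y_def)
      show ?thesis using m1[OF XY(1-3)] unfolding XY(4,5) .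
    qed
  qed
qed

definition potential_values :: "(nat \<Rightarrow> int) \<Rightarrow> nat set \<Rightarrow> int multiset" where
  "potential_values \<psi> X = image_mset \<psi> (mset_set X)"

lemma potential_values_reindex:
  assumes "inj_on f X"
  shows "potential_values (\<lambda>i. g (\<psi> (f i))) X = image_mset g (potential_values \<psi> (f ` X))"
  using assms by (simp add: potential_values_def image_mset_mset_set[symmetric] multiset.map_comp o_def)

lemma potential_values_cong:
  assumes "\<And>i. i \<in> X \<Longrightarrow> \<psi> i = \<psi>' i"
  shows "potential_values \<psi> X = potential_values \<psi>' X"
  unfolding potential_values_def
  using assms by (cases "finite X") (auto intro!: image_mset_cong)

lemma reflect_atLeastAtMost:
  fixes c l u :: nat
  assumes "u \<le> c" "l \<le> c"
  shows "(\<lambda>i. c - i) ` {l..u} = {c - u..c - l}"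
proof safe
  fix i assume "i \<in> {c - u..c - l}"
  hence "i = c - (c - i)" "c - i \<in> {l..u}" using assms by auto
  thus "i \<in> (\<lambda>i. c - i) ` {l..u}" by blast
qed (use assms in auto)

lemma inj_on_reflect: "u \<le> c \<Longrightarrow> inj_on (\<lambda>i. c - i) {l..u::nat}"
  by (auto simp: inj_on_def)

lemma potential_values_reflect:
  fixes c l u :: nat
  assumes "u \<le> c" "l \<le> c"
  shows "potential_values (\<lambda>i. g (\<psi> (c - i))) {l..u} = image_mset g (potential_values \<psi> {c - u..c - l})"
  using potential_values_reindex[OF inj_on_reflect[OF assms(1)], of g \<psi> l] reflect_atLeastAtMost[OF assms]
  by simp

text \<open>The graph reduction in terms of values: the long block collects both old blocks, and the
  last block is the contracted copy of the old second block, one unit lower.\<close>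

lemma potential_values_reduce:
  assumes "meander_potential (a + b) b \<psi>"
  defines "\<psi>' \<equiv> \<lambda>i. \<psi> (a + b + 1 - i)"
  shows "potential_values \<psi> {1..a + b} = potential_values \<psi>' {1..a} + potential_values \<psi>' {a + 1..a + b}"
    and "potential_values \<psi> {a + b + 1..a + b + b} = lower (potential_values \<psi>' {a + 1..a + b})"
proof -
  have "potential_values \<psi>' {1..a} + potential_values \<psi>' {a + 1..a + b} = potential_values \<psi>' {1..a + b}"
  proof -
    have "{1..a + b} = {1..a} \<union> {a + 1..a + b}" by auto
    thus ?thesis unfolding potential_values_def by (simp add: mset_set_Union)
  qed
  also have "\<dots> = potential_values \<psi> {1..a + b}"
    using potential_values_reflect[of "a + b" "a + b + 1" 1 "\<lambda>x. x" \<psi>] by (simp add: \<psi>'_def)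
  finally show "potential_values \<psi> {1..a + b} = potential_values \<psi>' {1..a} + potential_values \<psi>' {a + 1..a + b}" ..
  have "potential_values \<psi> {a + b + 1..a + b + b} = potential_values (\<lambda>i. \<psi> (a + 2 * b + 1 - i)) {1..b}"
    using potential_values_reflect[of b "a + 2 * b + 1" 1 "\<lambda>x. x" \<psi>] by (simp add: mult_2 add.assoc)
  also have "\<dots> = potential_values (\<lambda>i. \<psi> i - 1) {1..b}"
    using assms(1) unfolding meander_potential_reduce by (intro potential_values_cong) auto
  also have "\<dots> = lower (potential_values \<psi> {1..b})"
    by (simp add: potential_values_def multiset.map_comp o_def)
  also have "potential_values \<psi> {1..b} = potential_values \<psi>' {a + 1..a + b}"
    using potential_values_reflect[of "a + b" "a + b + 1" "a + 1" "\<lambda>x. x" \<psi>] by (simp add: \<psi>'_def)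
  finally show "potential_values \<psi> {a + b + 1..a + b + b} = lower (potential_values \<psi>' {a + 1..a + b})" .
qed

abbreviation potential_count :: "nat \<Rightarrow> nat \<Rightarrow> (nat \<Rightarrow> int) \<Rightarrow> int \<Rightarrow> int" where
  "potential_count a b \<psi> \<equiv>
     seaweed_count (potential_values \<psi> {1..a}) (potential_values \<psi> {a + 1..a + b})"

text \<open>Negating the values and exchanging the blocks reverses each mixed difference
  twice.\<close>

lemma potential_count_swap:
  "potential_count b a (\<lambda>i. - \<psi> (a + b + 1 - i)) = potential_count a b \<psi>"
proof
  fix k
  have "potential_values (\<lambda>i. - \<psi> (a + b + 1 - i)) {1..b} =
      image_mset uminus (potential_values \<psi> {a + 1..a + b})"
    "potential_values (\<lambda>i. - \<psi> (a + b + 1 - i)) {b + 1..b + a} =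
      image_mset uminus (potential_values \<psi> {1..a})"
    using potential_values_reflect[of b "a + b + 1" 1 uminus \<psi>]
      potential_values_reflect[of "b + a" "a + b + 1" "b + 1" uminus \<psi>] by (simp_all add: algebra_simps)
  thus "potential_count b a (\<lambda>i. - \<psi> (a + b + 1 - i)) k = potential_count a b \<psi> k"
    unfolding seaweed_count_def by (simp add: diff_count_neg)
qed

text \<open>Euclidean induction: subtraction of the smaller entry is handled by
  \<open>seaweed_count_step_symmetric\<close>, and the order of the entries by the swap.\<close>

lemma potential_count_symmetric:
  assumes "coprime a b" "0 < a" "0 < b" "meander_potential a b \<psi>"
  shows "potential_count a b \<psi> (1 - k) = potential_count a b \<psi> k"
  using assms
proof (induction "a + b" arbitrary: a b \<psi> k rule: less_induct)
  case less
  \<comment> \<open>Stated for any pair of the same sum, so that it serves (a, b) as well as the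
    swapped pair (b, a).\<close>
  have descend: "potential_count a' b' \<psi>' (1 - k) = potential_count a' b' \<psi>' k"
    if "a' + b' = a + b" "b' < a'" "coprime a' b'" "0 < b'" "meander_potential a' b' \<psi>'" for a' b' \<psi>' k
  proof -
    define d where "d = a' - b'"
    have a': "a' = d + b'" and d: "0 < d" using that by (auto simp: d_def)
    have mp: "meander_potential (d + b') b' \<psi>'" using that a' by simp
    have "potential_count d b' (\<lambda>i. \<psi>' (d + b' + 1 - i)) (1 - k) = potential_count d b' (\<lambda>i. \<psi>' (d + b' + 1 - i)) k" for k
    proof (rule less(1))
      show "coprime d b'" using that(3) unfolding a' by (simp add: coprime_iff_gcd_eq_1)
    qed (use that a' d mp meander_potential_reduce in auto)
    from seaweed_count_step_symmetric[OF this] show ?thesis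
      unfolding a' potential_values_reduce[OF mp] .
  qed
  consider "b < a" | "a < b" | "a = b" by linarith
  thus ?case
  proof cases
    case 1
    thus ?thesis using descend less.prems by blast
  next
    case 2
    have "potential_count b a (\<lambda>i. - \<psi> (a + b + 1 - i)) (1 - k) =
        potential_count b a (\<lambda>i. - \<psi> (a + b + 1 - i)) k"
      by (rule descend) (use 2 less.prems meander_potential_swap in \<open>auto simp: coprime_commute\<close>)
    thus ?thesis unfolding potential_count_swap .
  next
    case 3
    \<comment> \<open>Coprimality leaves only (1, 1). Its spectrum is 0 and 1, once each, and k -> 1
      - k exchanges them.\<close>
    hence ab: "a = 1" "b = 1" using less.prems by auto
    have "\<psi> 1 = \<psi> 2 + 1"
      using less.prems(4)[unfolded ab meander_potential_iff, THEN conjunct2, THEN conjunct2, rule_format, of 1 2] by simp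
    thus ?thesis by (auto simp: ab potential_values_def seaweed_count_def diff_count_def numeral_2_eq_2)
  qed
qed

section \<open>Power sums of eigenvalues\<close>

lemma mat_trace_mult_commute:
  fixes A B :: "'a::comm_semiring_0 mat"
  assumes "A \<in> carrier_mat n m" "B \<in> carrier_mat m n"
  shows "mat_trace (A * B) = mat_trace (B * A)"
proof -
  have "mat_trace (A * B) = (\<Sum>i<n. \<Sum>k<m. A $$ (i, k) * B $$ (k, i))"
    using assms by (simp add: mat_trace_def scalar_prod_def atLeast0LessThan)
  also have "\<dots> = (\<Sum>k<m. \<Sum>i<n. A $$ (i, k) * B $$ (k, i))" by (rule sum.swap)
  also have "\<dots> = mat_trace (B * A)"
    using assms by (simp add: mat_trace_def scalar_prod_def atLeast0LessThan mult.commute)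
  finally show ?thesis .
qed

lemma mat_trace_similar:
  fixes A B :: "'a::comm_ring_1 mat"
  assumes "similar_mat_wit A B P Q"
  shows "mat_trace A = mat_trace B"
proof -
  define n where "n = dim_row A"
  note w = similar_mat_witD[OF n_def assms]
  have "mat_trace A = mat_trace (Q * (P * B))"
    unfolding w(3) by (rule mat_trace_mult_commute[OF mult_carrier_mat[OF w(6,5)] w(7)])
  also have "Q * (P * B) = Q * P * B" by (rule assoc_mult_mat[OF w(7,6,5), symmetric])
  also have "\<dots> = B" unfolding w(2) by (rule left_mult_one_mat[OF w(5)])
  finally show ?thesis .
qed

lemma upper_triangular_mult:
  fixes A B :: "'a::comm_ring_1 mat"
  assumes "A \<in> carrier_mat n n" "B \<in> carrier_mat n n" "upper_triangular A" "upper_triangular B"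
  shows "upper_triangular (A * B)"
    and "i < n \<Longrightarrow> (A * B) $$ (i, i) = A $$ (i, i) * B $$ (i, i)"
proof -
  have entry: "(A * B) $$ (i, j) = (\<Sum>k<n. A $$ (i, k) * B $$ (k, j))" if "i < n" "j < n" for i j
    using that assms by (simp add: scalar_prod_def atLeast0LessThan)
  have A0: "A $$ (i, k) = 0" if "k < i" "i < n" for i k
    using assms(1,3) that by (auto simp: upper_triangular_def)
  have B0: "B $$ (i, k) = 0" if "k < i" "i < n" for i k
    using assms(2,4) that by (auto simp: upper_triangular_def)
  show "upper_triangular (A * B)"
  proof (rule upper_triangularI)
    fix i j assume ij: "j < i" "i < dim_row (A * B)"
    hence "A $$ (i, k) * B $$ (k, j) = 0" if "k < n" for k
      using A0[of k i] B0[of j k] that assms(1) by (cases "k < i") auto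
    thus "(A * B) $$ (i, j) = 0" using ij assms(1) entry[of i j] by (simp add: sum.neutral)
  qed
  show "(A * B) $$ (i, i) = A $$ (i, i) * B $$ (i, i)" if "i < n"
  proof -
    have "(\<Sum>k<n. A $$ (i, k) * B $$ (k, i)) = (\<Sum>k<n. if k = i then A $$ (i, k) * B $$ (k, i) else 0)"
    proof (rule sum.cong)
      fix k assume "k \<in> {..<n}"
      thus "A $$ (i, k) * B $$ (k, i) = (if k = i then A $$ (i, k) * B $$ (k, i) else 0)"
        using A0[of k i] B0[of i k] that by (cases "k < i") auto
    qed simp
    thus ?thesis using entry[OF that that] that by simp
  qed
qed

lemma upper_triangular_pow:
  fixes A :: "'a::comm_ring_1 mat"
  assumes "A \<in> carrier_mat n n" "upper_triangular A"
  shows "upper_triangular (A ^\<^sub>m k) \<and> (\<forall>i<n. (A ^\<^sub>m k) $$ (i, i) = A $$ (i, i) ^ k)"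
proof (induction k)
  case 0
  show ?case using assms by (auto simp: upper_triangular_def)
next
  case (Suc k)
  have "A ^\<^sub>m k \<in> carrier_mat n n" using assms by simp
  from upper_triangular_mult[OF this assms(1)] Suc assms(2) show ?case by (auto simp: mult.commute)
qed

lemma proots_linear_factors: "proots (\<Prod>a\<leftarrow>as. [:- a, 1:]) = mset (as :: 'a::idom list)"
proof -
  have "0 \<notin> set (map (\<lambda>a::'a. [:- a, 1:]) as)" by auto
  from proots_prod_list[OF this] show ?thesis by (induction as) (auto simp: o_def)
qed

text \<open>By Schur, the matrix is similar to a triangular one. Powers of the latter have the
  powers of its diagonal entries on the diagonal, and those entries are the roots of the
  characteristic polynomial.\<close>

lemma mat_trace_pow_eq_power_sum:
  fixes A :: "complex mat"
  assumes A: "A \<in> carrier_mat n n"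
  shows "mat_trace (A ^\<^sub>m k) = (\<Sum>z\<in>#proots (char_poly A). z ^ k)"
proof -
  obtain as where "char_poly A = (\<Prod>a\<leftarrow>as. [:- a, 1:])"
    using char_poly_factorized[OF A] by blast
  then obtain B where B: "B \<in> carrier_mat n n" "upper_triangular B" "similar_mat A B"
    using schur_decomposition_exists[OF A] by blast
  obtain P Q where "similar_mat_wit A B P Q" using B(3) by (auto simp: similar_mat_def)
  hence "mat_trace (A ^\<^sub>m k) = mat_trace (B ^\<^sub>m k)"
    using mat_trace_similar[OF similar_mat_wit_pow] by blast
  also have "\<dots> = (\<Sum>i<n. (B $$ (i, i)) ^ k)"
    using upper_triangular_pow[OF B(1,2), of k] B(1) by (simp add: mat_trace_def)
  also have "\<dots> = (\<Sum>z\<in>#mset (diag_mat B). z ^ k)"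
  proof -
    have "mset (diag_mat B) = image_mset (\<lambda>i. B $$ (i, i)) (mset_set {..<n})"
      using B(1) by (simp add: diag_mat_def mset_upt atLeast0LessThan)
    thus ?thesis by (simp add: multiset.map_comp o_def sum_unfold_sum_mset)
  qed
  also have "mset (diag_mat B) = proots (char_poly A)"
    unfolding char_poly_similar[OF B(3)] char_poly_upper_triangular[OF B(1,2)] proots_linear_factors ..
  finally show ?thesis .
qed

text \<open>Equal power sums give equal sums of every polynomial; a polynomial that vanishes at all
  elements except a isolates the multiplicity of a. Characteristic zero makes this multiplicity
  readable.\<close>

lemma power_sums_determine_multiset:
  fixes M N :: "'a::field_char_0 multiset"
  assumes "\<And>k. (\<Sum>z\<in>#M. z ^ k) = (\<Sum>z\<in>#N. z ^ k)"
  shows "M = N"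
proof (rule multiset_eqI)
  fix a
  define p where "p = (\<Prod>b\<in>set_mset (M + N) - {a}. [:- b, 1:])"
  have p_sum: "(\<Sum>z\<in>#X. poly p z) = (\<Sum>i\<le>degree p. coeff p i * (\<Sum>z\<in>#X. z ^ i))" for X
  proof (induction X)
    case (add x X)
    thus ?case by (simp add: poly_altdef distrib_left sum.distrib)
  qed simp
  have a: "poly p a \<noteq> 0" unfolding p_def by (simp add: poly_prod)
  have zero: "poly p x = 0" if "x \<in># M + N" "x \<noteq> a" for x
    unfolding p_def poly_prod by (rule prod_zero) (use that in auto)
  have count: "(\<Sum>z\<in>#X. poly p z) = of_nat (count X a) * poly p a" if "set_mset X \<subseteq> set_mset (M + N)" for X
    using that
  proof (induction X)
    case (add x X)
    hence "x \<in># M + N" "set_mset X \<subseteq> set_mset (M + N)" by simp_all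
    thus ?case using add.IH zero[of x] by (cases "x = a") (simp_all add: distrib_right)
  qed simp
  have "of_nat (count M a) * poly p a = of_nat (count N a) * poly p a"
    using count[of M] count[of N] unfolding p_sum by (simp add: assms)
  thus "count M a = count N a" using a by simp
qed

lemma proots_char_poly_eq_if_traces_eq:
  fixes A B :: "complex mat"
  assumes "A \<in> carrier_mat n n" "B \<in> carrier_mat m m"
    and "\<And>k. mat_trace (A ^\<^sub>m k) = mat_trace (B ^\<^sub>m k)"
  shows "proots (char_poly A) = proots (char_poly B)"
  by (rule power_sums_determine_multiset) (use assms mat_trace_pow_eq_power_sum in metis)

section \<open>The adjoint representation in coordinates\<close>

lemma commutator_closed_mat:
  "x \<in> carrier_mat n n \<Longrightarrow> y \<in> carrier_mat n n \<Longrightarrow> commutator x y \<in> carrier_mat n n"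
  unfolding commutator_def by (intro minus_carrier_mat mult_carrier_mat)

lemma commutator_add_right:
  assumes "h \<in> carrier_mat n n" "x \<in> carrier_mat n n" "y \<in> carrier_mat n n"
  shows "commutator h (x + y) = commutator h x + commutator h y"
  unfolding commutator_def mult_add_distrib_mat[OF assms] add_mult_distrib_mat[OF assms(2,3,1)]
  by (rule eq_matI) (use assms in auto)

lemma commutator_smult_right:
  assumes "h \<in> carrier_mat n n" "x \<in> carrier_mat n n"
  shows "commutator h (c \<cdot>\<^sub>m x) = c \<cdot>\<^sub>m commutator h x"
  unfolding commutator_def mult_smult_distrib[OF assms] mult_smult_assoc_mat[OF assms(2,1)]
  by (rule eq_matI) (use assms in \<open>auto simp: algebra_simps\<close>)

lemma commutator_add_left:
  assumes "h \<in> carrier_mat n n" "x \<in> carrier_mat n n" "y \<in> carrier_mat n n"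
  shows "commutator (x + y) h = commutator x h + commutator y h"
  unfolding commutator_def mult_add_distrib_mat[OF assms] add_mult_distrib_mat[OF assms(2,3,1)]
  by (rule eq_matI) (use assms in auto)

lemma commutator_smult_left:
  assumes "h \<in> carrier_mat n n" "x \<in> carrier_mat n n"
  shows "commutator (c \<cdot>\<^sub>m x) h = c \<cdot>\<^sub>m commutator x h"
  unfolding commutator_def mult_smult_distrib[OF assms] mult_smult_assoc_mat[OF assms(2,1)]
  by (rule eq_matI) (use assms in \<open>auto simp: algebra_simps\<close>)

lemma commutator_jacobi:
  assumes "h \<in> carrier_mat n n" "u \<in> carrier_mat n n" "x \<in> carrier_mat n n"
  shows "commutator (commutator h u) x = commutator h (commutator u x) - commutator u (commutator h x)"
proof -
  have c: "h * u \<in> carrier_mat n n" "u * h \<in> carrier_mat n n" "u * x \<in> carrier_mat n n"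
    "x * u \<in> carrier_mat n n" "h * x \<in> carrier_mat n n" "x * h \<in> carrier_mat n n"
    using assms by auto
  show ?thesis
    unfolding commutator_def
      minus_mult_distrib_mat[OF c(1,2) assms(3)] mult_minus_distrib_mat[OF assms(3) c(1,2)]
      minus_mult_distrib_mat[OF c(3,4) assms(1)] mult_minus_distrib_mat[OF assms(1) c(3,4)]
      minus_mult_distrib_mat[OF c(5,6) assms(2)] mult_minus_distrib_mat[OF assms(2) c(5,6)]
      assoc_mult_mat[OF assms(1,2,3)] assoc_mult_mat[OF assms(2,1,3)] assoc_mult_mat[OF assms(3,1,2)]
      assoc_mult_mat[OF assms(3,2,1)] assoc_mult_mat[OF assms(2,3,1)] assoc_mult_mat[OF assms(1,3,2)]
    by (rule eq_matI) (use assms in auto)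
qed

text \<open>A basis together with its dual coordinates. Independence of the vectors is encoded in
  \<open>co_e\<close> and spanning in \<open>co_inj\<close>, so that the adjoint action becomes a
  concrete matrix of size n.\<close>

locale matrix_lie_algebra =
  fixes N n :: nat and L :: "complex mat set" and e :: "nat \<Rightarrow> complex mat"
    and co :: "nat \<Rightarrow> complex mat \<Rightarrow> complex"
  assumes carrier: "x \<in> L \<Longrightarrow> x \<in> carrier_mat N N"
    and zero_mem: "0\<^sub>m N N \<in> L"
    and add_mem: "x \<in> L \<Longrightarrow> y \<in> L \<Longrightarrow> x + y \<in> L"
    and smult_mem: "x \<in> L \<Longrightarrow> c \<cdot>\<^sub>m x \<in> L"
    and commutator_mem: "x \<in> L \<Longrightarrow> y \<in> L \<Longrightarrow> commutator x y \<in> L"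
    and e_mem: "i < n \<Longrightarrow> e i \<in> L"
    and co_linear: "linear_functional L (co i)"
    and co_e: "i < n \<Longrightarrow> j < n \<Longrightarrow> co i (e j) = of_bool (i = j)"
    and co_inj: "x \<in> L \<Longrightarrow> y \<in> L \<Longrightarrow> (\<And>i. i < n \<Longrightarrow> co i x = co i y) \<Longrightarrow> x = y"
begin

lemma functional_add: "linear_functional L \<phi> \<Longrightarrow> x \<in> L \<Longrightarrow> y \<in> L \<Longrightarrow> \<phi> (x + y) = \<phi> x + \<phi> y"
  and functional_smult: "linear_functional L \<phi> \<Longrightarrow> x \<in> L \<Longrightarrow> \<phi> (c \<cdot>\<^sub>m x) = c * \<phi> x"
  by (auto simp: linear_functional_def)

lemma minus_eq: "x \<in> L \<Longrightarrow> y \<in> L \<Longrightarrow> x - y = x + (- 1) \<cdot>\<^sub>m y"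
  by (rule eq_matI) (auto dest!: carrier)

lemma functional_minus: "linear_functional L \<phi> \<Longrightarrow> x \<in> L \<Longrightarrow> y \<in> L \<Longrightarrow> \<phi> (x - y) = \<phi> x - \<phi> y"
  by (simp add: minus_eq functional_add functional_smult smult_mem)

lemma functional_zero:
  assumes "linear_functional L \<phi>"
  shows "\<phi> (0\<^sub>m N N) = 0"
proof -
  have "\<phi> (0 \<cdot>\<^sub>m 0\<^sub>m N N) = 0" using functional_smult[OF assms zero_mem, of 0] by simp
  thus ?thesis by simp
qed

lemma functional_commutator_right:
  "linear_functional L \<phi> \<Longrightarrow> h \<in> L \<Longrightarrow> linear_functional L (\<lambda>x. \<phi> (commutator h x))"
  unfolding linear_functional_def
  by (auto simp: commutator_add_right[of _ N] commutator_smult_right[of _ N] carrier commutator_mem)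

lemma functional_commutator_left:
  "linear_functional L \<phi> \<Longrightarrow> x \<in> L \<Longrightarrow> linear_functional L (\<lambda>h. \<phi> (commutator h x))"
  unfolding linear_functional_def
  by (auto simp: commutator_add_left[of _ N] commutator_smult_left[of _ N] carrier commutator_mem)

lemma functional_jacobi:
  assumes "linear_functional L \<phi>" "h \<in> L" "u \<in> L" "x \<in> L"
  shows "\<phi> (commutator (commutator h u) x) =
    \<phi> (commutator h (commutator u x)) - \<phi> (commutator u (commutator h x))"
  using assms by (simp add: commutator_jacobi[of h N] carrier functional_minus commutator_mem)

text \<open>Matrices of all sizes share one type, so the sum is built by recursion from the zero
  matrix of the right size.\<close>

primrec comb :: "(nat \<Rightarrow> complex) \<Rightarrow> nat \<Rightarrow> complex mat" where
  "comb c 0 = 0\<^sub>m N N"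
| "comb c (Suc m) = comb c m + c m \<cdot>\<^sub>m e m"

lemma comb_mem: "m \<le> n \<Longrightarrow> comb c m \<in> L"
  by (induction m) (auto simp: zero_mem add_mem smult_mem e_mem)

lemma functional_comb:
  assumes "linear_functional L \<phi>"
  shows "m \<le> n \<Longrightarrow> \<phi> (comb c m) = (\<Sum>i<m. c i * \<phi> (e i))"
proof (induction m)
  case (Suc m)
  thus ?case by (simp add: functional_add[OF assms] functional_smult[OF assms] comb_mem smult_mem e_mem)
qed (simp add: functional_zero[OF assms])

lemma co_comb: "i < n \<Longrightarrow> co i (comb c n) = c i"
  by (simp add: functional_comb[OF co_linear] co_e of_bool_def if_distrib cong: if_cong)

lemma comb_co: "x \<in> L \<Longrightarrow> comb (\<lambda>i. co i x) n = x"
  by (rule co_inj) (auto simp: comb_mem co_comb)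

lemma functional_expand:
  assumes "linear_functional L \<phi>" "x \<in> L"
  shows "\<phi> x = (\<Sum>i<n. co i x * \<phi> (e i))"
  using functional_comb[OF assms(1), of n "\<lambda>i. co i x"] by (simp add: comb_co[OF assms(2)])

definition ad :: "complex mat \<Rightarrow> complex mat" where
  "ad h = Matrix.mat n n (\<lambda>(i, j). co i (commutator h (e j)))"

lemma ad_carrier: "ad h \<in> carrier_mat n n"
  by (simp add: ad_def)

lemma ad_index: "i < n \<Longrightarrow> j < n \<Longrightarrow> ad h $$ (i, j) = co i (commutator h (e j))"
  by (simp add: ad_def)

lemma ad_dim [simp]: "dim_row (ad h) = n" "dim_col (ad h) = n"
  by (simp_all add: ad_def)

lemma co_commutator:
  assumes "i < n" "h \<in> L" "x \<in> L"
  shows "co i (commutator h x) = (\<Sum>k<n. ad h $$ (i, k) * co k x)"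
  using functional_expand[OF functional_commutator_right[OF co_linear assms(2)] assms(3)] assms(1)
  by (simp add: ad_index mult.commute)

lemma ad_mult_index:
  assumes "i < n" "j < n" "h \<in> L" "u \<in> L"
  shows "(ad h * ad u) $$ (i, j) = co i (commutator h (commutator u (e j)))"
proof -
  have "(ad h * ad u) $$ (i, j) = (\<Sum>k<n. ad h $$ (i, k) * ad u $$ (k, j))"
    using assms(1,2) by (simp add: scalar_prod_def atLeast0LessThan)
  also have "\<dots> = (\<Sum>k<n. ad h $$ (i, k) * co k (commutator u (e j)))"
    using assms(2) by (intro sum.cong) (auto simp: ad_index)
  also have "\<dots> = co i (commutator h (commutator u (e j)))"
    by (rule co_commutator[OF assms(1,3) commutator_mem[OF assms(4) e_mem[OF assms(2)]], symmetric])
  finally show ?thesis .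
qed

text \<open>The Jacobi identity in coordinates. It turns the Lax equation for principal elements
  into one for their adjoint matrices.\<close>

lemma ad_commutator:
  assumes "h \<in> L" "u \<in> L"
  shows "ad (commutator h u) = ad h * ad u - ad u * ad h"
proof (rule eq_matI)
  fix i j assume "i < dim_row (ad h * ad u - ad u * ad h)" "j < dim_col (ad h * ad u - ad u * ad h)"
  hence ij: "i < n" "j < n" by simp_all
  have "(ad h * ad u - ad u * ad h) $$ (i, j) = (ad h * ad u) $$ (i, j) - (ad u * ad h) $$ (i, j)"
    using ij by simp
  thus "ad (commutator h u) $$ (i, j) = (ad h * ad u - ad u * ad h) $$ (i, j)"
    unfolding ad_mult_index[OF ij assms] ad_mult_index[OF ij assms(2,1)]
    by (simp add: ad_index ij functional_jacobi[OF co_linear assms e_mem[OF ij(2)]])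
qed simp_all

abbreviation V :: "(complex, complex mat) module" where
  "V \<equiv> mat_space N L"

lemma V_simps [simp]:
  "carrier V = L" "add V = (+)" "zero V = 0\<^sub>m N N" "module.smult V = (\<cdot>\<^sub>m)"
  by (simp_all add: mat_space_def module_mat_simps)

sublocale V: vectorspace class_ring V
proof -
  interpret M: vectorspace "class_ring :: complex ring" "module_mat TYPE(complex) N N"
    by (rule matrix_vs)
  have "submodule class_ring L (module_mat TYPE(complex) N N)"
    by (rule submodule.intro)
       (auto simp: module_mat_simps carrier zero_mem add_mem smult_mem M.module_axioms class_ring_simps)
  hence "VectorSpace.subspace class_ring L (module_mat TYPE(complex) N N)"
    unfolding VectorSpace.subspace_def using M.vectorspace_axioms by blast
  from M.subspace_is_vs[OF this] show "vectorspace class_ring V" unfolding mat_space_def .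
qed

lemma functional_finsum:
  assumes "linear_functional L \<phi>" "finite A" "\<And>i. i \<in> A \<Longrightarrow> f i \<in> L"
  shows "\<phi> (finsum V f A) = (\<Sum>i\<in>A. \<phi> (f i)) \<and> finsum V f A \<in> L"
  using assms(2,3)
proof (induction A)
  case empty
  show ?case by (simp add: functional_zero[OF assms(1)] zero_mem)
next
  case (insert a A)
  hence "f \<in> A \<rightarrow> carrier V" "f a \<in> carrier V" by auto
  from V.finsum_insert[OF insert.hyps this] insert show ?case
    by (simp add: functional_add[OF assms(1)] add_mem)
qed

lemma co_lincomb:
  assumes "finite A" "A \<subseteq> L"
  shows "co i (V.lincomb a A) = (\<Sum>v\<in>A. a v * co i v)" and "V.lincomb a A \<in> L"
proof -
  have "a v \<odot>\<^bsub>V\<^esub> v \<in> L" if "v \<in> A" for v using that assms smult_mem by auto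
  from functional_finsum[OF co_linear assms(1) this]
  show "co i (V.lincomb a A) = (\<Sum>v\<in>A. a v * co i v)" and "V.lincomb a A \<in> L"
    using assms by (auto simp: V.lincomb_def functional_smult[OF co_linear] subset_iff intro!: sum.cong)
qed

lemma e_inj: "inj_on e {..<n}"
proof (rule inj_onI)
  fix i j assume "i \<in> {..<n}" "j \<in> {..<n}" "e i = e j"
  thus "i = j" using co_e[of i j] co_e[of i i] by (cases "i = j") auto
qed

text \<open>Applying the coordinates to a vanishing combination gives independence; the combination
  with the coordinates of x as coefficients equals x by \<open>co_inj\<close>.\<close>

lemma basis_e: "V.basis (e ` {..<n})"
  unfolding V.basis_def
proof (intro conjI)
  have sub: "e ` {..<n} \<subseteq> L" using e_mem by auto
  have co_lin: "co i (V.lincomb a (e ` {..<n})) = a (e i)" if "i < n" for a i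
    unfolding co_lincomb(1)[OF finite_imageI[OF finite_lessThan] sub]
    by (subst sum.reindex[OF e_inj]) (use that in \<open>simp add: co_e of_bool_def if_distrib cong: if_cong\<close>)
  show "e ` {..<n} \<subseteq> carrier V" using sub by simp
  show "V.lin_indpt (e ` {..<n})"
  proof (rule V.finite_lin_indpt2)
    fix a assume "V.lincomb a (e ` {..<n}) = \<zero>\<^bsub>V\<^esub>"
    thus "\<forall>v\<in>e ` {..<n}. a v = \<zero>\<^bsub>class_ring\<^esub>"
      using co_lin[of _ a] functional_zero[OF co_linear] by (auto simp: class_ring_simps)
  qed (use sub in auto)
  show "V.gen_set (e ` {..<n})"
  proof (rule equalityI; rule subsetI)
    fix x assume "x \<in> V.span (e ` {..<n})"
    thus "x \<in> carrier V" using V.span_is_subset2[of "e ` {..<n}"] sub by auto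
  next
    fix x assume x: "x \<in> carrier V"
    define a where "a v = co (inv_into {..<n} e v) x" for v
    have "V.lincomb a (e ` {..<n}) = x"
    proof (rule co_inj)
      fix i assume "i < n"
      thus "co i (V.lincomb a (e ` {..<n})) = co i x"
        unfolding co_lin[OF \<open>i < n\<close>] a_def by (simp add: inv_into_f_f[OF e_inj])
    qed (use x sub co_lincomb(2) in auto)
    thus "x \<in> V.span (e ` {..<n})"
      unfolding V.span_def by (intro CollectI exI[of _ a] exI[of _ "e ` {..<n}"]) auto
  qed
qed

lemma represents_ad:
  assumes "h \<in> L"
  shows "represents V (commutator h) (map e [0..<n]) (ad h)"
  unfolding represents_def
proof (intro conjI allI impI)
  show "distinct (map e [0..<n])" using e_inj by (simp add: distinct_map atLeast0LessThan)
  show "vectorspace.basis class_ring V (set (map e [0..<n]))"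
    using basis_e by (simp add: atLeast0LessThan)
  show "ad h \<in> carrier_mat (length (map e [0..<n])) (length (map e [0..<n]))" by (simp add: ad_carrier)
  fix j assume "j < length (map e [0..<n])"
  hence j: "j < n" by simp
  define f where "f = (\<lambda>i. ad h $$ (i, j) \<odot>\<^bsub>V\<^esub> (map e [0..<n] ! i))"
  have f: "f i \<in> L" if "i \<in> {..<n}" for i using that by (simp add: f_def smult_mem e_mem)
  have "co k (finsum V f {..<n}) = ad h $$ (k, j)" if "k < n" for k
    using functional_finsum[where f = f, OF co_linear[of k] finite_lessThan[of n] f] that
    by (simp add: f_def functional_smult[OF co_linear] e_mem co_e of_bool_def if_distrib cong: if_cong)
  hence "commutator h (e j) = finsum V f {..<n}"
    using functional_finsum[where f = f, OF co_linear finite_lessThan[of n] f] j assms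
    by (intro co_inj) (auto simp: commutator_mem e_mem ad_index)
  thus "commutator h (map e [0..<n] ! j) = finsum V (\<lambda>i. ad h $$ (i, j) \<odot>\<^bsub>V\<^esub> (map e [0..<n] ! i))
      {..<length (map e [0..<n])}"
    using j by (simp add: f_def)
qed

text \<open>Change of basis: any representing matrix is similar to \<open>ad h\<close>, so the
  definite description in \<open>endo_char_poly\<close> is well posed.\<close>

lemma char_poly_represents:
  assumes h: "h \<in> L" and rep: "represents V (commutator h) bs A"
  shows "char_poly A = char_poly (ad h)"
proof -
  have dist: "distinct bs" and basis: "V.basis (set bs)"
    using rep by (simp_all add: represents_def)
  have "card (set bs) = card (e ` {..<n})"
    using V.dim_basis[OF _ basis] V.dim_basis[OF _ basis_e] by simp
  hence len: "length bs = n" using distinct_card[OF dist] card_image[OF e_inj] by simp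
  have A: "A \<in> carrier_mat n n" and TA: "\<And>j. j < n \<Longrightarrow> commutator h (bs ! j) =
      finsum V (\<lambda>i. A $$ (i, j) \<odot>\<^bsub>V\<^esub> (bs ! i)) {..<n}"
    using rep by (simp_all add: represents_def len)
  have sub: "set bs \<subseteq> L" using basis by (simp add: V.basis_def)
  hence bs: "bs ! i \<in> L" if "i < n" for i using that len by auto
  have "e j \<in> V.span (set bs)" if "j < n" for j using basis e_mem[OF that] by (simp add: V.basis_def)
  hence "\<forall>j. \<exists>a. j < n \<longrightarrow> e j = V.lincomb a (set bs)"
    using V.finite_span[of "set bs"] sub by auto
  then obtain a where a: "\<And>j. j < n \<Longrightarrow> e j = V.lincomb (a j) (set bs)" by metis
  \<comment> \<open>P expresses the basis bs in the coordinates of e, and Q expresses e in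
    bs.\<close>
  define P where "P = Matrix.mat n n (\<lambda>(i, j). co i (bs ! j))"
  define Q where "Q = Matrix.mat n n (\<lambda>(i, j). a j (bs ! i))"
  have PQ_carrier: "P \<in> carrier_mat n n" "Q \<in> carrier_mat n n" by (simp_all add: P_def Q_def)
  have PQ: "P * Q = 1\<^sub>m n"
  proof (rule eq_matI)
    fix i j assume "i < dim_row (1\<^sub>m n)" "j < dim_col (1\<^sub>m n)"
    hence ij: "i < n" "j < n" by simp_all
    have bij: "bij_betw (\<lambda>i. bs ! i) {..<n} (set bs)" using bij_betw_nth[OF dist] len by simp
    have "of_bool (i = j) = co i (V.lincomb (a j) (set bs))" using a[OF ij(2)] co_e[OF ij] by simp
    also have "\<dots> = (\<Sum>k<n. a j (bs ! k) * co i (bs ! k))"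
      unfolding co_lincomb(1)[OF finite_set sub]
      by (rule sum.reindex_bij_betw[OF bij, symmetric])
    also have "\<dots> = (P * Q) $$ (i, j)"
      using ij by (simp add: P_def Q_def scalar_prod_def atLeast0LessThan mult.commute)
    finally show "(P * Q) $$ (i, j) = 1\<^sub>m n $$ (i, j)" using ij by (cases "i = j") auto
  qed (simp_all add: P_def Q_def)
  hence QP: "Q * P = 1\<^sub>m n" using mat_mult_left_right_inverse[OF PQ_carrier] by simp
  \<comment> \<open>Both sides hold the coordinates of [h, bs ! j], computed once through e and once
    through bs.\<close>
  have "ad h * P = P * A"
  proof (rule eq_matI)
    fix i j assume "i < dim_row (P * A)" "j < dim_col (P * A)"
    hence ij: "i < n" "j < n" using A by (simp_all add: P_def)
    have "(ad h * P) $$ (i, j) = co i (commutator h (bs ! j))"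
      using ij by (simp add: P_def co_commutator h bs scalar_prod_def atLeast0LessThan)
    also have "\<dots> = (\<Sum>k<n. A $$ (k, j) * co i (bs ! k))"
      using functional_finsum[OF co_linear[of i] finite_lessThan[of n], of "\<lambda>k. A $$ (k, j) \<odot>\<^bsub>V\<^esub> (bs ! k)"]
      by (simp add: TA[OF ij(2)] bs smult_mem functional_smult[OF co_linear])
    also have "\<dots> = (P * A) $$ (i, j)"
      using ij A by (simp add: P_def scalar_prod_def atLeast0LessThan mult.commute)
    finally show "(ad h * P) $$ (i, j) = (P * A) $$ (i, j)" .
  qed (use A in \<open>simp_all add: P_def\<close>)
  hence "P * A * Q = ad h * (P * Q)"
    using assoc_mult_mat[OF ad_carrier PQ_carrier, of h] by simp
  hence "ad h = P * A * Q" using ad_carrier[of h] by (simp add: PQ)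
  hence "similar_mat_wit (ad h) A P Q"
    using PQ QP A PQ_carrier ad_carrier by (intro similar_mat_witI)
  hence "similar_mat (ad h) A" by (auto simp: similar_mat_def)
  from char_poly_similar[OF this] show ?thesis ..
qed

lemma endo_char_poly_eq:
  assumes "h \<in> L"
  shows "endo_char_poly V (commutator h) = char_poly (ad h)"
  unfolding endo_char_poly_def
proof (rule the_equality)
  show "\<exists>bs A. represents V (commutator h) bs A \<and> char_poly (ad h) = char_poly A"
    using represents_ad[OF assms] by blast
qed (use char_poly_represents[OF assms] in auto)

end

section \<open>Independence of the Frobenius functional\<close>

text \<open>A notion closed under ring operations that yields both facts needed along the pencil:
  differentiability everywhere and finitely many zeros.\<close>

definition polynomial_fun :: "(complex \<Rightarrow> complex) \<Rightarrow> bool" where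
  "polynomial_fun f \<longleftrightarrow> (\<exists>p. \<forall>t. f t = poly p t)"

lemma polynomial_fun_const: "polynomial_fun (\<lambda>t. c)"
  unfolding polynomial_fun_def by (rule exI[of _ "[:c:]"]) simp

lemma polynomial_fun_ident: "polynomial_fun (\<lambda>t. t)"
  unfolding polynomial_fun_def by (rule exI[of _ "[:0, 1:]"]) simp

lemma polynomial_fun_add: "polynomial_fun f \<Longrightarrow> polynomial_fun g \<Longrightarrow> polynomial_fun (\<lambda>t. f t + g t)"
  unfolding polynomial_fun_def by (metis poly_add)

lemma polynomial_fun_diff: "polynomial_fun f \<Longrightarrow> polynomial_fun g \<Longrightarrow> polynomial_fun (\<lambda>t. f t - g t)"
  unfolding polynomial_fun_def by (metis poly_diff)

lemma polynomial_fun_mult: "polynomial_fun f \<Longrightarrow> polynomial_fun g \<Longrightarrow> polynomial_fun (\<lambda>t. f t * g t)"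
  unfolding polynomial_fun_def by (metis poly_mult)

lemma polynomial_fun_sum:
  "(\<And>i. i \<in> A \<Longrightarrow> polynomial_fun (f i)) \<Longrightarrow> polynomial_fun (\<lambda>t. \<Sum>i\<in>A. f i t)"
  by (induction A rule: infinite_finite_induct) (auto intro: polynomial_fun_const polynomial_fun_add)

lemma polynomial_fun_prod:
  "(\<And>i. i \<in> A \<Longrightarrow> polynomial_fun (f i)) \<Longrightarrow> polynomial_fun (\<lambda>t. \<Prod>i\<in>A. f i t)"
  by (induction A rule: infinite_finite_induct) (auto intro: polynomial_fun_const polynomial_fun_mult)

lemmas polynomial_fun_intros = polynomial_fun_const polynomial_fun_ident polynomial_fun_add
  polynomial_fun_diff polynomial_fun_mult polynomial_fun_sum polynomial_fun_prod

lemma polynomial_fun_differentiable: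
  assumes "polynomial_fun f"
  obtains D where "(f has_field_derivative D) (at t)"
proof -
  obtain p where "f = poly p" using assms by (auto simp: polynomial_fun_def)
  thus thesis using that poly_DERIV by blast
qed

lemma polynomial_fun_finite_roots:
  assumes "polynomial_fun f" "f a \<noteq> 0"
  shows "finite {t. f t = 0}"
proof -
  obtain p where p: "f = poly p" using assms by (auto simp: polynomial_fun_def)
  hence "p \<noteq> 0" using assms(2) by auto
  thus ?thesis unfolding p by (rule poly_roots_finite)
qed

lemma polynomial_fun_det:
  assumes "\<And>t. F t \<in> carrier_mat n n"
    and "\<And>i j. i < n \<Longrightarrow> j < n \<Longrightarrow> polynomial_fun (\<lambda>t. F t $$ (i, j))"
  shows "polynomial_fun (\<lambda>t. det (F t))"
  unfolding det_def'[OF assms(1)]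
  by (intro polynomial_fun_intros assms(2)) (auto simp: permutes_in_image)

lemma polynomial_fun_adj_mat:
  assumes F: "\<And>t. F t \<in> carrier_mat n n"
    and poly: "\<And>i j. i < n \<Longrightarrow> j < n \<Longrightarrow> polynomial_fun (\<lambda>t. F t $$ (i, j))"
    and ij: "i < n" "j < n"
  shows "polynomial_fun (\<lambda>t. adj_mat (F t) $$ (i, j))"
proof -
  have "adj_mat (F t) $$ (i, j) = (-1) ^ (j + i) * det (mat_delete (F t) j i)" for t
    using F[of t] ij by (simp add: adj_mat_def cofactor_def)
  moreover have "polynomial_fun (\<lambda>t. det (mat_delete (F t) j i))"
  proof (rule polynomial_fun_det)
    fix t show "mat_delete (F t) j i \<in> carrier_mat (n - 1) (n - 1)"
      using mat_delete_carrier[OF F[of t]] .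
  next
    fix k l assume kl: "k < n - 1" "l < n - 1"
    hence "(\<lambda>t. mat_delete (F t) j i $$ (k, l)) =
        (\<lambda>t. F t $$ (if k < j then k else Suc k, if l < i then l else Suc l))"
      using carrier_matD[OF F] by (auto simp: mat_delete_def fun_eq_iff)
    thus "polynomial_fun (\<lambda>t. mat_delete (F t) j i $$ (k, l))" using poly kl by auto
  qed
  ultimately show ?thesis by (simp add: polynomial_fun_intros)
qed

text \<open>The map X -> X U - U X is a derivation, just like d/dt. If both agree on H, they agree
  on all powers of H.\<close>

lemma lax_derivative_pow:
  fixes H :: "complex \<Rightarrow> complex mat"
  assumes H: "\<And>s. H s \<in> carrier_mat n n" and U: "U \<in> carrier_mat n n"
    and deriv: "\<And>i j. i < n \<Longrightarrow> j < n \<Longrightarrow>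
      ((\<lambda>s. H s $$ (i, j)) has_field_derivative (H t * U - U * H t) $$ (i, j)) (at t)"
    and ij: "i < n" "j < n"
  shows "((\<lambda>s. (H s ^\<^sub>m k) $$ (i, j)) has_field_derivative
    (H t ^\<^sub>m k * U - U * H t ^\<^sub>m k) $$ (i, j)) (at t)"
  using ij
proof (induction k arbitrary: i j)
  case 0
  have "dim_row (H s) = n" for s using H[of s] by auto
  hence "(\<lambda>s. (H s ^\<^sub>m 0) $$ (i, j)) = (\<lambda>s. 1\<^sub>m n $$ (i, j))" by simp
  moreover have "(H t ^\<^sub>m 0 * U - U * H t ^\<^sub>m 0) $$ (i, j) = 0" using H[of t] U 0 by simp
  ultimately show ?case by simp
next
  case (Suc k)
  have P: "H s ^\<^sub>m k \<in> carrier_mat n n" for s using H[of s] by simp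
  let ?P = "H t ^\<^sub>m k" and ?H = "H t"
  have c: "?P * U \<in> carrier_mat n n" "U * ?P \<in> carrier_mat n n" "?H * U \<in> carrier_mat n n"
    "U * ?H \<in> carrier_mat n n" using P[of t] H[of t] U by auto
  have prod: "(H s ^\<^sub>m Suc k) $$ (i, j) = (\<Sum>l<n. (H s ^\<^sub>m k) $$ (i, l) * H s $$ (l, j))" for s
    using Suc.prems P[of s] H[of s] by (simp add: scalar_prod_def atLeast0LessThan)
  \<comment> \<open>The Leibniz rule for the commutator with U; the inner terms P U H
    cancel.\<close>
  have "?P * ?H * U - U * (?P * ?H) = (?P * U - U * ?P) * ?H + ?P * (?H * U - U * ?H)"
    unfolding minus_mult_distrib_mat[OF c(1,2) H] mult_minus_distrib_mat[OF P c(3,4)]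
      assoc_mult_mat[OF P U H] assoc_mult_mat[OF U P H] assoc_mult_mat[OF P H U]
    by (rule eq_matI) (use P[of t] H[of t] U in auto)
  hence "(?P * ?H * U - U * (?P * ?H)) $$ (i, j) =
      ((?P * U - U * ?P) * ?H + ?P * (?H * U - U * ?H)) $$ (i, j)" by (rule arg_cong)
  also have "\<dots> = ((?P * U - U * ?P) * ?H) $$ (i, j) + (?P * (?H * U - U * ?H)) $$ (i, j)"
    by (rule index_add_mat(1)) (use Suc.prems P[of t] H[of t] U in auto)
  finally have "(?P * ?H * U - U * (?P * ?H)) $$ (i, j) =
      ((?P * U - U * ?P) * ?H) $$ (i, j) + (?P * (?H * U - U * ?H)) $$ (i, j)" .
  moreover have "(M * M') $$ (i, j) = (\<Sum>l<n. M $$ (i, l) * M' $$ (l, j))"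
    if "M \<in> carrier_mat n n" "M' \<in> carrier_mat n n" for M M' :: "complex mat"
    using Suc.prems that by (simp add: scalar_prod_def atLeast0LessThan)
  from this[OF minus_carrier_mat[OF c(2)] H] this[OF P minus_carrier_mat[OF c(4)]]
  have "((?P * U - U * ?P) * ?H) $$ (i, j) = (\<Sum>l<n. (?P * U - U * ?P) $$ (i, l) * ?H $$ (l, j))"
    "(?P * (?H * U - U * ?H)) $$ (i, j) = (\<Sum>l<n. ?P $$ (i, l) * (?H * U - U * ?H) $$ (l, j))" .
  moreover have "((\<lambda>s. \<Sum>l<n. (H s ^\<^sub>m k) $$ (i, l) * H s $$ (l, j)) has_field_derivative
      (\<Sum>l<n. (?P * U - U * ?P) $$ (i, l) * ?H $$ (l, j) + (?H * U - U * ?H) $$ (l, j) * ?P $$ (i, l))) (at t)"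
    using Suc.prems by (intro DERIV_sum DERIV_mult Suc.IH deriv) auto
  ultimately show ?case unfolding prod by (simp add: sum.distrib mult.commute)
qed

text \<open>The derivative is the trace of a commutator.\<close>

lemma lax_derivative_trace_pow:
  fixes H :: "complex \<Rightarrow> complex mat"
  assumes H: "\<And>s. H s \<in> carrier_mat n n" and U: "U \<in> carrier_mat n n"
    and deriv: "\<And>i j. i < n \<Longrightarrow> j < n \<Longrightarrow>
      ((\<lambda>s. H s $$ (i, j)) has_field_derivative (H t * U - U * H t) $$ (i, j)) (at t)"
  shows "((\<lambda>s. mat_trace (H s ^\<^sub>m k)) has_field_derivative 0) (at t)"
proof -
  have P: "H s ^\<^sub>m k \<in> carrier_mat n n" for s using H[of s] by simp
  have "mat_trace (H t ^\<^sub>m k * U) = mat_trace (U * H t ^\<^sub>m k)"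
    by (rule mat_trace_mult_commute[OF P U])
  hence "(\<Sum>i<n. (H t ^\<^sub>m k * U - U * H t ^\<^sub>m k) $$ (i, i)) = 0"
    using P[of t] U carrier_matD[OF H[of t]] by (simp add: mat_trace_def sum_subtractf del: index_mult_mat(1))
  moreover have "((\<lambda>s. \<Sum>i<n. (H s ^\<^sub>m k) $$ (i, i)) has_field_derivative
      (\<Sum>i<n. (H t ^\<^sub>m k * U - U * H t ^\<^sub>m k) $$ (i, i))) (at t)"
    by (intro DERIV_sum lax_derivative_pow[OF H U deriv]) auto
  moreover have "(\<lambda>s. mat_trace (H s ^\<^sub>m k)) = (\<lambda>s. \<Sum>i<n. (H s ^\<^sub>m k) $$ (i, i))"
    using carrier_matD[OF H] by (simp add: mat_trace_def)
  ultimately show ?thesis by simp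
qed

section \<open>Principal elements along a pencil of functionals\<close>

context matrix_lie_algebra
begin

text \<open>The index order is such that \<open>gram \<phi>\<close> applied to the coordinates of x
  lists the values of \<phi> on the commutators of x with the basis.\<close>

definition gram :: "(complex mat \<Rightarrow> complex) \<Rightarrow> complex mat" where
  "gram \<phi> = Matrix.mat n n (\<lambda>(j, i). \<phi> (commutator (e i) (e j)))"

lemma gram_carrier: "gram \<phi> \<in> carrier_mat n n"
  by (simp add: gram_def)

lemma gram_index: "j < n \<Longrightarrow> i < n \<Longrightarrow> gram \<phi> $$ (j, i) = \<phi> (commutator (e i) (e j))"
  by (simp add: gram_def)

lemma gram_comb:
  assumes "linear_functional L \<phi>" "j < n"
  shows "(\<Sum>i<n. gram \<phi> $$ (j, i) * c i) = \<phi> (commutator (comb c n) (e j))"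
  using functional_comb[OF functional_commutator_left[OF assms(1) e_mem[OF assms(2)]], of n c] assms(2)
  by (simp add: gram_index mult.commute)

text \<open>Cramer's rule for the x with \<phi>([x, -]) = \<delta>. The adjugate makes numerator and
  denominator polynomial in the pencil parameter.\<close>

definition solution :: "(complex mat \<Rightarrow> complex) \<Rightarrow> (complex mat \<Rightarrow> complex) \<Rightarrow> nat \<Rightarrow> complex" where
  "solution \<phi> \<delta> i = (\<Sum>j<n. adj_mat (gram \<phi>) $$ (i, j) * \<delta> (e j)) / det (gram \<phi>)"

lemma functional_eqI:
  assumes "linear_functional L \<phi>" "linear_functional L \<psi>" "\<And>j. j < n \<Longrightarrow> \<phi> (e j) = \<psi> (e j)" "x \<in> L"
  shows "\<phi> x = \<psi> x"
  using functional_expand[OF assms(1,4)] functional_expand[OF assms(2,4)] assms(3) by simp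

lemma solution_solves:
  assumes "linear_functional L \<phi>" "linear_functional L \<delta>" "det (gram \<phi>) \<noteq> 0" "x \<in> L"
  shows "\<phi> (commutator (comb (solution \<phi> \<delta>) n) x) = \<delta> x"
proof -
  have "\<phi> (commutator (comb (solution \<phi> \<delta>) n) (e k)) = \<delta> (e k)" if k: "k < n" for k
  proof -
    have "\<phi> (commutator (comb (solution \<phi> \<delta>) n) (e k)) =
        (\<Sum>i<n. gram \<phi> $$ (k, i) * (\<Sum>j<n. adj_mat (gram \<phi>) $$ (i, j) * \<delta> (e j))) / det (gram \<phi>)"
      unfolding gram_comb[OF assms(1) k, symmetric] by (simp add: solution_def flip: sum_divide_distrib)
    also have "(\<Sum>i<n. gram \<phi> $$ (k, i) * (\<Sum>j<n. adj_mat (gram \<phi>) $$ (i, j) * \<delta> (e j))) =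
        (\<Sum>j<n. (\<Sum>i<n. gram \<phi> $$ (k, i) * adj_mat (gram \<phi>) $$ (i, j)) * \<delta> (e j))"
      unfolding sum_distrib_left sum_distrib_right by (subst sum.swap) (simp add: mult.assoc)
    also have "\<dots> = (\<Sum>j<n. (gram \<phi> * adj_mat (gram \<phi>)) $$ (k, j) * \<delta> (e j))"
      using k gram_carrier[of \<phi>] adj_mat(1)[OF gram_carrier[of \<phi>]]
      by (intro sum.cong) (auto simp: scalar_prod_def atLeast0LessThan)
    also have "\<dots> = det (gram \<phi>) * \<delta> (e k)"
      unfolding adj_mat(2)[OF gram_carrier] using k by (simp add: if_distrib if_distribR cong: if_cong)
    finally show ?thesis using assms(3) by simp
  qed
  from functional_eqI[OF functional_commutator_right[OF assms(1) comb_mem] assms(2) this assms(4)]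
  show ?thesis by simp
qed

lemma solution_unique:
  assumes "linear_functional L \<phi>" "det (gram \<phi>) \<noteq> 0" "h \<in> L"
    and "\<And>j. j < n \<Longrightarrow> \<phi> (commutator h (e j)) = \<delta> (e j)" and k: "k < n"
  shows "co k h = solution \<phi> \<delta> k"
proof -
  have "(\<Sum>j<n. adj_mat (gram \<phi>) $$ (k, j) * \<delta> (e j)) =
      (\<Sum>j<n. adj_mat (gram \<phi>) $$ (k, j) * (\<Sum>i<n. gram \<phi> $$ (j, i) * co i h))"
    using assms(4) by (simp add: gram_comb[OF assms(1)] comb_co[OF assms(3)])
  also have "\<dots> = (\<Sum>i<n. (\<Sum>j<n. adj_mat (gram \<phi>) $$ (k, j) * gram \<phi> $$ (j, i)) * co i h)"
    unfolding sum_distrib_left sum_distrib_right by (subst sum.swap) (simp add: mult.assoc)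
  also have "\<dots> = (\<Sum>i<n. (adj_mat (gram \<phi>) * gram \<phi>) $$ (k, i) * co i h)"
    using k gram_carrier[of \<phi>] adj_mat(1)[OF gram_carrier[of \<phi>]]
    by (intro sum.cong) (auto simp: scalar_prod_def atLeast0LessThan)
  also have "\<dots> = det (gram \<phi>) * co k h"
    unfolding adj_mat(3)[OF gram_carrier] using k by (simp add: if_distrib if_distribR cong: if_cong)
  finally show ?thesis using assms(2) by (simp add: solution_def)
qed

text \<open>A kernel vector of the Gram matrix consists of the coordinates of an element of the
  radical.\<close>

lemma det_gram_frobenius:
  assumes "frobenius_functional N L \<phi>"
  shows "det (gram \<phi>) \<noteq> 0"
proof
  have lin: "linear_functional L \<phi>" using assms by (simp add: frobenius_functional_def)
  assume "det (gram \<phi>) = 0"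
  then obtain v where v: "v \<in> carrier_vec n" "v \<noteq> 0\<^sub>v n" "gram \<phi> *\<^sub>v v = 0\<^sub>v n"
    using det_0_iff_vec_prod_zero_field[OF gram_carrier[of \<phi>]] by auto
  define x where "x = comb (vec_index v) n"
  have x: "x \<in> L" by (simp add: x_def comb_mem)
  have "\<phi> (commutator x (e j)) = 0" if "j < n" for j
  proof -
    have "(\<Sum>i<n. gram \<phi> $$ (j, i) * vec_index v i) = vec_index (gram \<phi> *\<^sub>v v) j"
      using that v(1) gram_carrier[of \<phi>] by (auto simp: scalar_prod_def atLeast0LessThan)
    thus ?thesis using that by (simp add: v(3) gram_comb[OF lin] x_def)
  qed
  hence "\<phi> (commutator x y) = 0" if "y \<in> L" for y
    using functional_expand[OF functional_commutator_right[OF lin x] that] by simp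
  hence "x = 0\<^sub>m N N" using assms x by (simp add: frobenius_functional_def)
  hence "vec_index v i = 0" if "i < n" for i
    using co_comb[OF that, of "vec_index v"] functional_zero[OF co_linear] by (simp add: x_def)
  hence "v = 0\<^sub>v n" using v(1) by (intro eq_vecI) auto
  thus False using v(2) by simp
qed

definition pencil :: "(complex mat \<Rightarrow> complex) \<Rightarrow> (complex mat \<Rightarrow> complex) \<Rightarrow> complex \<Rightarrow> complex mat \<Rightarrow> complex" where
  "pencil \<phi> \<psi> t = (\<lambda>x. (1 - t) * \<phi> x + t * \<psi> x)"

context
  fixes \<phi> \<psi> :: "complex mat \<Rightarrow> complex"
  assumes lin: "linear_functional L \<phi>" "linear_functional L \<psi>"
begin

lemma pencil_linear: "linear_functional L (pencil \<phi> \<psi> t)"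
  using lin unfolding linear_functional_def pencil_def by (simp add: algebra_simps)

lemma pencil_polynomial: "polynomial_fun (\<lambda>t. pencil \<phi> \<psi> t x)"
  unfolding pencil_def by (intro polynomial_fun_intros)

lemma pencil_gram_polynomial:
  "i < n \<Longrightarrow> j < n \<Longrightarrow> polynomial_fun (\<lambda>t. gram (pencil \<phi> \<psi> t) $$ (i, j))"
  by (simp add: gram_index pencil_polynomial)

lemma pencil_det_polynomial: "polynomial_fun (\<lambda>t. det (gram (pencil \<phi> \<psi> t)))"
  by (rule polynomial_fun_det[OF gram_carrier pencil_gram_polynomial])

definition principal_coord :: "complex \<Rightarrow> nat \<Rightarrow> complex" where
  "principal_coord t = solution (pencil \<phi> \<psi> t) (pencil \<phi> \<psi> t)"

lemma principal_coord_differentiable: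
  assumes "det (gram (pencil \<phi> \<psi> t)) \<noteq> 0" "k < n"
  obtains D where "((\<lambda>s. principal_coord s k) has_field_derivative D) (at t)"
proof -
  let ?num = "\<lambda>s. \<Sum>j<n. adj_mat (gram (pencil \<phi> \<psi> s)) $$ (k, j) * pencil \<phi> \<psi> s (e j)"
  have "polynomial_fun ?num"
    using assms(2) by (intro polynomial_fun_intros pencil_polynomial
        polynomial_fun_adj_mat[OF gram_carrier pencil_gram_polynomial]) auto
  then obtain D where "(?num has_field_derivative D) (at t)" by (rule polynomial_fun_differentiable)
  moreover obtain D' where "((\<lambda>s. det (gram (pencil \<phi> \<psi> s))) has_field_derivative D') (at t)"
    using pencil_det_polynomial by (rule polynomial_fun_differentiable)
  ultimately show thesis
    using that DERIV_divide assms(1) unfolding principal_coord_def solution_def by blast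
qed

lemma open_pencil_nondegenerate: "open {t. det (gram (pencil \<phi> \<psi> t)) \<noteq> 0}"
proof -
  obtain p where "\<And>t. det (gram (pencil \<phi> \<psi> t)) = poly p t"
    using pencil_det_polynomial by (auto simp: polynomial_fun_def)
  hence "{t. det (gram (pencil \<phi> \<psi> t)) \<noteq> 0} = {t. poly p t \<noteq> 0}" by simp
  thus ?thesis by (simp add: open_Collect_neq continuous_on_poly)
qed

text \<open>Differentiating phi_t([h, x]) = phi_t(x) gives phi_t([h', x]) + delta([h, x]) = delta(x)
  with delta = psi - phi. By Jacobi and phi_t([u, -]) = delta, the element [h, u] solves the same
  equation as h', and nondegeneracy identifies the two.\<close>

lemma principal_coord_derivative:
  assumes t: "det (gram (pencil \<phi> \<psi> t)) \<noteq> 0"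
  defines "h \<equiv> comb (principal_coord t) n"
    and "u \<equiv> comb (solution (pencil \<phi> \<psi> t) (\<lambda>x. \<psi> x - \<phi> x)) n"
  assumes k: "k < n"
  shows "((\<lambda>s. principal_coord s k) has_field_derivative co k (commutator h u)) (at t)"
proof -
  define \<delta> where "\<delta> = (\<lambda>x. \<psi> x - \<phi> x)"
  define \<phi>\<^sub>t where "\<phi>\<^sub>t = pencil \<phi> \<psi> t"
  have \<phi>\<^sub>t: "linear_functional L \<phi>\<^sub>t" unfolding \<phi>\<^sub>t_def by (rule pencil_linear)
  have \<delta>: "linear_functional L \<delta>" using lin unfolding linear_functional_def \<delta>_def by (simp add: algebra_simps)
  have det: "det (gram \<phi>\<^sub>t) \<noteq> 0" using t by (simp add: \<phi>\<^sub>t_def)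
  have mem: "h \<in> L" "u \<in> L" by (simp_all add: h_def u_def comb_mem)
  have h: "\<phi>\<^sub>t (commutator h x) = \<phi>\<^sub>t x" if "x \<in> L" for x
    using solution_solves[OF \<phi>\<^sub>t \<phi>\<^sub>t det that] by (simp add: h_def principal_coord_def \<phi>\<^sub>t_def)
  have u: "\<phi>\<^sub>t (commutator u x) = \<delta> x" if "x \<in> L" for x
    using solution_solves[OF \<phi>\<^sub>t \<delta> det that] by (simp add: u_def \<delta>_def \<phi>\<^sub>t_def)
  have "\<forall>i. \<exists>D. i < n \<longrightarrow> ((\<lambda>s. principal_coord s i) has_field_derivative D) (at t)"
    using principal_coord_differentiable[OF t] by metis
  then obtain D where D: "\<And>i. i < n \<Longrightarrow> ((\<lambda>s. principal_coord s i) has_field_derivative D i) (at t)"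
    by metis
  define y where "y = comb D n"
  have y: "y \<in> L" by (simp add: y_def comb_mem)
  have pencil_deriv: "((\<lambda>s. pencil \<phi> \<psi> s x) has_field_derivative \<delta> x) (at t)" for x
    unfolding pencil_def \<delta>_def by (auto intro!: derivative_eq_intros)
  \<comment> \<open>The differentiated principal equation; y has the derivatives of the coordinates
    of h as its coordinates.\<close>
  have eq: "\<phi>\<^sub>t (commutator y (e j)) + \<delta> (commutator h (e j)) = \<delta> (e j)" if j: "j < n" for j
  proof -
    let ?F = "\<lambda>s. \<Sum>i<n. principal_coord s i * pencil \<phi> \<psi> s (commutator (e i) (e j))"
    have "(?F has_field_derivative
        (\<Sum>i<n. D i * pencil \<phi> \<psi> t (commutator (e i) (e j)) +
           \<delta> (commutator (e i) (e j)) * principal_coord t i)) (at t)"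
      by (intro DERIV_sum DERIV_mult D pencil_deriv) auto
    also have "(\<Sum>i<n. D i * pencil \<phi> \<psi> t (commutator (e i) (e j)) +
           \<delta> (commutator (e i) (e j)) * principal_coord t i) =
        \<phi>\<^sub>t (commutator y (e j)) + \<delta> (commutator h (e j))"
      using functional_comb[OF functional_commutator_left[OF \<phi>\<^sub>t e_mem[OF j]], of n D]
        functional_comb[OF functional_commutator_left[OF \<delta> e_mem[OF j]], of n "principal_coord t"]
      by (simp add: y_def h_def \<phi>\<^sub>t_def sum.distrib mult.commute)
    finally have "(?F has_field_derivative \<phi>\<^sub>t (commutator y (e j)) + \<delta> (commutator h (e j))) (at t)" .
    \<comment> \<open>The Cramer solution satisfies the principal equation where the determinant is
      nonzero. That set is open, so the equation can be differentiated at t.\<close>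
    moreover have "(?F has_field_derivative \<delta> (e j)) (at t)"
    proof (rule has_field_derivative_transform_within_open[OF pencil_deriv open_pencil_nondegenerate])
      fix s assume "s \<in> {s. det (gram (pencil \<phi> \<psi> s)) \<noteq> 0}"
      thus "pencil \<phi> \<psi> s (e j) = ?F s"
        using solution_solves[OF pencil_linear pencil_linear _ e_mem[OF j], of s s]
          functional_comb[OF functional_commutator_left[OF pencil_linear e_mem[OF j]], of n s "principal_coord s"]
        by (simp add: principal_coord_def)
    qed (use t in simp)
    ultimately show ?thesis by (rule DERIV_unique)
  qed
  have hu: "commutator h u \<in> L" using mem by (simp add: commutator_mem)
  have "y = commutator h u"
  proof (rule co_inj[OF y hu])
    fix i assume i: "i < n"
    have same: "\<phi>\<^sub>t (commutator (commutator h u) (e j)) = \<phi>\<^sub>t (commutator y (e j))" if j: "j < n" for j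
    proof -
      have "\<phi>\<^sub>t (commutator (commutator h u) (e j)) = \<delta> (e j) - \<delta> (commutator h (e j))"
        using functional_jacobi[OF \<phi>\<^sub>t mem e_mem[OF j]] mem j by (simp add: h u e_mem commutator_mem)
      thus ?thesis using eq[OF j] by (metis add_diff_cancel_right')
    qed
    note unique = solution_unique[where \<delta> = "\<lambda>x. \<phi>\<^sub>t (commutator y x)", OF \<phi>\<^sub>t det]
    from unique[OF hu same i] unique[OF y refl i]
    show "co i y = co i (commutator h u)" by simp
  qed
  hence "co k (commutator h u) = D k" using co_comb[OF k, of D] by (simp add: y_def)
  thus ?thesis using D[OF k] by simp
qed

text \<open>\<open>ad\<close> is linear in its argument, so its entries inherit the derivative
  [h, u] of h, and \<open>ad_commutator\<close> splits it.\<close>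

lemma ad_principal_lax:
  assumes t: "det (gram (pencil \<phi> \<psi> t)) \<noteq> 0"
  defines "H \<equiv> \<lambda>s. ad (comb (principal_coord s) n)"
    and "U \<equiv> ad (comb (solution (pencil \<phi> \<psi> t) (\<lambda>x. \<psi> x - \<phi> x)) n)"
  assumes ij: "i < n" "j < n"
  shows "((\<lambda>s. H s $$ (i, j)) has_field_derivative (H t * U - U * H t) $$ (i, j)) (at t)"
proof -
  let ?h = "comb (principal_coord t) n"
  let ?u = "comb (solution (pencil \<phi> \<psi> t) (\<lambda>x. \<psi> x - \<phi> x)) n"
  have hu: "?h \<in> L" "?u \<in> L" by (simp_all add: comb_mem)
  have lin_co: "linear_functional L (\<lambda>x. co i (commutator x (e j)))"
    by (rule functional_commutator_left[OF co_linear e_mem[OF ij(2)]])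
  have "(\<lambda>s. H s $$ (i, j)) = (\<lambda>s. \<Sum>k<n. principal_coord s k * co i (commutator (e k) (e j)))"
    using functional_comb[OF lin_co order_refl] ij by (simp add: H_def ad_index)
  moreover have "((\<lambda>s. \<Sum>k<n. principal_coord s k * co i (commutator (e k) (e j))) has_field_derivative
      (\<Sum>k<n. co k (commutator ?h ?u) * co i (commutator (e k) (e j)))) (at t)"
    by (intro DERIV_sum DERIV_cmult_right principal_coord_derivative[OF t]) auto
  moreover have "(\<Sum>k<n. co k (commutator ?h ?u) * co i (commutator (e k) (e j))) =
      ad (commutator ?h ?u) $$ (i, j)"
    using functional_expand[OF lin_co commutator_mem[OF hu]] ij by (simp add: ad_index)
  ultimately show ?thesis unfolding ad_commutator[OF hu] by (simp add: H_def U_def)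
qed

end

lemma principal_element_spectrum_unique:
  assumes frob: "frobenius_functional N L \<phi>" "frobenius_functional N L \<psi>"
    and princ: "principal_element L \<phi> h" "principal_element L \<psi> h'"
  shows "proots (char_poly (ad h)) = proots (char_poly (ad h'))"
proof -
  have lin: "linear_functional L \<phi>" "linear_functional L \<psi>"
    using frob by (simp_all add: frobenius_functional_def)
  define d where "d t = det (gram (pencil \<phi> \<psi> t))" for t
  define H where "H t = ad (comb (principal_coord \<phi> \<psi> t) n)" for t
  have ends: "pencil \<phi> \<psi> 0 = \<phi>" "pencil \<phi> \<psi> 1 = \<psi>" by (simp_all add: pencil_def)
  have d: "d 0 \<noteq> 0" "d 1 \<noteq> 0"
    using det_gram_frobenius frob by (simp_all add: d_def ends)
  \<comment> \<open>Nondegeneracy makes the principal element unique, so the given h and h' are the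
    end points of the Cramer curve.\<close>
  have principal: "g = comb (solution \<omega> \<omega>) n"
    if \<omega>: "frobenius_functional N L \<omega>" and g: "principal_element L \<omega> g" for \<omega> g
  proof (rule co_inj)
    show "g \<in> L" using g by (simp add: principal_element_def)
    fix k assume k: "k < n"
    have "co k g = solution \<omega> \<omega> k"
      by (rule solution_unique[OF _ det_gram_frobenius[OF \<omega>] \<open>g \<in> L\<close> _ k])
         (use \<omega> g e_mem in \<open>auto simp: frobenius_functional_def principal_element_def\<close>)
    thus "co k g = co k (comb (solution \<omega> \<omega>) n)" using k by (simp add: co_comb)
  qed (simp add: comb_mem)
  have H: "H 0 = ad h" "H 1 = ad h'"
    using principal[OF frob(1) princ(1)] principal[OF frob(2) princ(2)]
    by (simp_all add: H_def principal_coord_def[OF lin] ends)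
  have "finite {t. d t = 0}"
    unfolding d_def by (rule polynomial_fun_finite_roots[OF pencil_det_polynomial[OF lin], of 0])
      (use d in \<open>simp add: d_def\<close>)
  \<comment> \<open>The complex parameter matters here: deleting finitely many points leaves the
    plane connected, whereas degenerate parameters on the real segment could separate 0 from
    1.\<close>
  hence "connected (UNIV - {t. d t = 0})"
    by (intro connected_open_delete_finite) auto
  moreover have S: "UNIV - {t. d t = 0} = {t. d t \<noteq> 0}" by auto
  ultimately have conn: "connected {t. d t \<noteq> 0}" by simp
  have "mat_trace (H 0 ^\<^sub>m k) = mat_trace (H 1 ^\<^sub>m k)" for k
  proof -
    have "((\<lambda>s. mat_trace (H s ^\<^sub>m k)) has_field_derivative 0) (at t)" if "t \<in> {t. d t \<noteq> 0}" for t
    proof -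
      have "det (gram (pencil \<phi> \<psi> t)) \<noteq> 0" using that by (simp add: d_def)
      from lax_derivative_trace_pow[OF ad_carrier ad_carrier ad_principal_lax[OF lin this]]
      show ?thesis unfolding H_def .
    qed
    hence "(\<lambda>s. mat_trace (H s ^\<^sub>m k)) constant_on {t. d t \<noteq> 0}"
      using conn open_pencil_nondegenerate[OF lin]
      by (intro has_field_derivative_0_imp_constant_on) (auto simp: d_def)
    thus ?thesis using d unfolding constant_on_def by (metis mem_Collect_eq)
  qed
  thus ?thesis unfolding H by (intro proots_char_poly_eq_if_traces_eq[OF ad_carrier ad_carrier])
qed

theorem ooms_spectrum_eq:
  assumes "frobenius_functional N L \<phi>" "principal_element L \<phi> h"
  shows "ooms_spectrum N L = proots (char_poly (ad h))"
  unfolding ooms_spectrum_def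
proof (rule the_equality)
  have h: "g \<in> L" if "principal_element L \<omega> g" for \<omega> g using that by (simp add: principal_element_def)
  show "\<exists>\<phi> g. frobenius_functional N L \<phi> \<and> principal_element L \<phi> g \<and>
      proots (char_poly (ad h)) = proots (endo_char_poly V (commutator g))"
    using assms endo_char_poly_eq[OF h[OF assms(2)]] by metis
  fix M assume "\<exists>\<omega> g. frobenius_functional N L \<omega> \<and> principal_element L \<omega> g \<and>
      M = proots (endo_char_poly V (commutator g))"
  then obtain \<omega> g where g: "frobenius_functional N L \<omega>" "principal_element L \<omega> g"
    "M = proots (endo_char_poly V (commutator g))" by blast
  thus "M = proots (char_poly (ad h))"
    using principal_element_spectrum_unique[OF g(1) assms(1) g(2) assms(2)] endo_char_poly_eq[OF h[OF g(2)]]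
    by simp
qed

end

section \<open>The commutant of the meander matrix\<close>

definition top_reflect :: "nat \<Rightarrow> nat \<Rightarrow> nat \<Rightarrow> nat" where
  "top_reflect a b i = (if i \<le> a then a + 1 - i else 2 * a + b + 1 - i)"

definition bottom_reflect :: "nat \<Rightarrow> nat \<Rightarrow> nat \<Rightarrow> nat" where
  "bottom_reflect a b i = a + b + 1 - i"

text \<open>The entries of F X = X F for the meander matrix F, at the positions (i, j) for which (j,
  i) may be nonzero in a block upper triangular matrix. Indices start at 1 as for vertices, and the
  strict comparisons drop fixed vertices, which carry no edge.\<close>

definition meander_commutes :: "nat \<Rightarrow> nat \<Rightarrow> (nat \<Rightarrow> nat \<Rightarrow> 'a::comm_ring_1) \<Rightarrow> bool" where
  "meander_commutes a b X \<longleftrightarrow>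
     (\<forall>i\<in>{a + 1..a + b}. \<forall>j\<in>{1..a}. X i j = 0) \<and>
     (\<forall>i\<in>{1..a + b}. \<forall>j\<in>{1..a + b}. (i \<le> a \<longrightarrow> j \<le> a) \<longrightarrow>
        (if i < top_reflect a b i then X (top_reflect a b i) j else 0) +
        (if bottom_reflect a b i < i then X (bottom_reflect a b i) j else 0) =
        (if top_reflect a b j < j then X i (top_reflect a b j) else 0) +
        (if j < bottom_reflect a b j then X i (bottom_reflect a b j) else 0))"

lemma meander_commutes_zero:
  "meander_commutes a b X \<Longrightarrow> a < i \<Longrightarrow> i \<le> a + b \<Longrightarrow> 1 \<le> j \<Longrightarrow> j \<le> a \<Longrightarrow> X i j = 0"
  unfolding meander_commutes_def by auto

lemma meander_commutes_eq:
  assumes "meander_commutes a b X"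
    and "1 \<le> i" "i \<le> a + b" "1 \<le> j" "j \<le> a + b" "i \<le> a \<Longrightarrow> j \<le> a"
    and "top_reflect a b i = ti" "bottom_reflect a b i = bi" "top_reflect a b j = tj" "bottom_reflect a b j = bj"
  shows "(if i < ti then X ti j else 0) + (if bi < i then X bi j else 0) =
    (if tj < j then X i tj else 0) + (if j < bj then X i bj else 0)"
proof -
  have "i \<in> {1..a + b}" "j \<in> {1..a + b}" "i \<le> a \<longrightarrow> j \<le> a" using assms by auto
  thus ?thesis using assms(1) unfolding meander_commutes_def assms(7-10)[symmetric] by blast
qed

text \<open>Transposition in the antidiagonal exchanges the diagonal blocks and keeps the matrix
  block upper triangular.\<close>

lemma meander_commutes_swap:
  assumes "meander_commutes a b X"
  shows "meander_commutes b a (\<lambda>i j. X (bottom_reflect a b j) (bottom_reflect a b i))"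
  unfolding meander_commutes_def
proof (intro conjI ballI impI)
  fix i j assume "i \<in> {b + 1..b + a}" "j \<in> {1..b}"
  thus "X (bottom_reflect a b j) (bottom_reflect a b i) = 0"
    by (intro meander_commutes_zero[OF assms]) (auto simp: bottom_reflect_def)
next
  fix i j assume ij: "i \<in> {1..b + a}" "j \<in> {1..b + a}" "i \<le> b \<longrightarrow> j \<le> b"
  define I J where "I = bottom_reflect a b j" and "J = bottom_reflect a b i"
  have IJ: "1 \<le> I" "I \<le> a + b" "1 \<le> J" "J \<le> a + b" "I \<le> a \<Longrightarrow> J \<le> a"
    "bottom_reflect a b I = j" "bottom_reflect a b J = i"
    using ij by (auto simp: I_def J_def bottom_reflect_def)
  have reflect: "bottom_reflect b a i = J" "bottom_reflect b a j = I"
    "bottom_reflect a b (top_reflect b a i) = top_reflect a b J"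
    "bottom_reflect a b (top_reflect b a j) = top_reflect a b I"
    using ij by (auto simp: I_def J_def bottom_reflect_def top_reflect_def)
  have lt: "i < top_reflect b a i \<longleftrightarrow> top_reflect a b J < J" "top_reflect b a j < j \<longleftrightarrow> I < top_reflect a b I"
    using ij by (auto simp: I_def J_def bottom_reflect_def top_reflect_def)
  show "(if i < top_reflect b a i then X (bottom_reflect a b j) (bottom_reflect a b (top_reflect b a i)) else 0) +
      (if bottom_reflect b a i < i then X (bottom_reflect a b j) (bottom_reflect a b (bottom_reflect b a i)) else 0) =
      (if top_reflect b a j < j then X (bottom_reflect a b (top_reflect b a j)) (bottom_reflect a b i) else 0) +
      (if j < bottom_reflect b a j then X (bottom_reflect a b (bottom_reflect b a j)) (bottom_reflect a b i) else 0)"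
    using meander_commutes_eq[OF assms IJ(1-5) refl IJ(6) refl IJ(7)]
    unfolding I_def[symmetric] J_def[symmetric] reflect lt IJ(6,7) by (rule sym)
qed

context
  fixes a b :: nat and X :: "nat \<Rightarrow> nat \<Rightarrow> 'a::comm_ring_1"
  assumes comm: "meander_commutes (a + b) b X"
begin

text \<open>The reflections of [1, a + b], [1, a + 2 * b] and [1, b], in this order.\<close>

abbreviation (input) \<tau> :: "nat \<Rightarrow> nat" where "\<tau> i \<equiv> bottom_reflect a b i"
abbreviation (input) \<beta> :: "nat \<Rightarrow> nat" where "\<beta> i \<equiv> bottom_reflect (a + b) b i"
abbreviation (input) \<gamma> :: "nat \<Rightarrow> nat" where "\<gamma> i \<equiv> bottom_reflect 0 b i"

text \<open>In row \<beta> p of the last block the zero lower left block removes all terms except X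
  p j and possibly X (\<beta> p) (\<beta> j). So the first b rows repeat the last diagonal block and
  then vanish up to column a + b.\<close>

lemma meander_commutes_lower_left:
  assumes "1 \<le> p" "p \<le> b" "1 \<le> j" "j \<le> a + b"
  shows "X p j = (if j \<le> b then X (\<beta> p) (\<beta> j) else 0)"
proof -
  have "(if \<beta> p < a + b + p then X (a + b + p) j else 0) + (if p < \<beta> p then X p j else 0) =
      (if \<tau> j < j then X (\<beta> p) (\<tau> j) else 0) + (if j < \<beta> j then X (\<beta> p) (\<beta> j) else 0)"
    by (rule meander_commutes_eq[OF comm])
       (use assms in \<open>auto simp: top_reflect_def bottom_reflect_def\<close>)
  moreover have "X (a + b + p) j = 0"
    by (rule meander_commutes_zero[OF comm]) (use assms in auto)
  moreover have "X (\<beta> p) (\<tau> j) = 0"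
    by (rule meander_commutes_zero[OF comm]) (use assms in \<open>auto simp: bottom_reflect_def\<close>)
  moreover have "X (\<beta> p) (\<beta> j) = 0" if "\<not> j \<le> b"
    by (rule meander_commutes_zero[OF comm]) (use assms that in \<open>auto simp: bottom_reflect_def\<close>)
  moreover have "p < \<beta> p" "j \<le> b \<Longrightarrow> j < \<beta> j" using assms by (auto simp: bottom_reflect_def)
  ultimately show ?thesis by (cases "j \<le> b") (simp_all cong: if_cong)
qed

text \<open>The equation at (\<beta> p, \<beta> q) in the last diagonal block, carried back to
  [1, b] by \<open>meander_commutes_lower_left\<close>.\<close>

lemma meander_commutes_lower_right:
  assumes "1 \<le> p" "p \<le> b" "1 \<le> q" "q \<le> b"
  shows "(if \<gamma> p < p then X (\<gamma> p) q else 0) + X p (\<beta> q) = (if q < \<gamma> q then X p (\<gamma> q) else 0)"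
proof -
  have \<gamma>: "1 \<le> \<gamma> p" "\<gamma> p \<le> b" "1 \<le> \<gamma> q" "\<gamma> q \<le> b" using assms by (auto simp: bottom_reflect_def)
  have "(if \<beta> p < \<beta> (\<gamma> p) then X (\<beta> (\<gamma> p)) (\<beta> q) else 0) + (if p < \<beta> p then X p (\<beta> q) else 0) =
      (if \<beta> (\<gamma> q) < \<beta> q then X (\<beta> p) (\<beta> (\<gamma> q)) else 0) + (if \<beta> q < q then X (\<beta> p) q else 0)"
    by (rule meander_commutes_eq[OF comm])
       (use assms in \<open>auto simp: top_reflect_def bottom_reflect_def\<close>)
  moreover have "X (\<gamma> p) q = X (\<beta> (\<gamma> p)) (\<beta> q)" "X p (\<gamma> q) = X (\<beta> p) (\<beta> (\<gamma> q))"
    using meander_commutes_lower_left[of "\<gamma> p" q] meander_commutes_lower_left[of p "\<gamma> q"] assms \<gamma> by simp_all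
  moreover have "\<beta> p < \<beta> (\<gamma> p) \<longleftrightarrow> \<gamma> p < p" "p < \<beta> p" "\<beta> (\<gamma> q) < \<beta> q \<longleftrightarrow> q < \<gamma> q" "\<not> \<beta> q < q"
    using assms by (auto simp: bottom_reflect_def)
  ultimately show ?thesis by (simp cong: if_cong)
qed

lemma meander_commutes_upper_left:
  assumes "1 \<le> i" "i \<le> a + b" "1 \<le> j" "j \<le> a + b"
  shows "(if i < \<tau> i then X (\<tau> i) j else 0) + (if \<beta> i < i then X (\<beta> i) j else 0) =
    (if \<tau> j < j then X i (\<tau> j) else 0) + (if j < \<beta> j then X i (\<beta> j) else 0)"
  by (rule meander_commutes_eq[OF comm])
     (use assms in \<open>auto simp: top_reflect_def bottom_reflect_def\<close>)

text \<open>The matrix counterpart of contracting b edges: the first diagonal block, with its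
  indices reversed, satisfies the equations of the smaller pair.\<close>

lemma meander_commutes_reduce: "meander_commutes a b (\<lambda>i j. X (\<tau> i) (\<tau> j))"
  unfolding meander_commutes_def
proof (intro conjI ballI impI)
  fix i j assume ij: "i \<in> {a + 1..a + b}" "j \<in> {1..a}"
  hence "1 \<le> \<tau> i" "\<tau> i \<le> b" "1 \<le> \<tau> j" "\<tau> j \<le> a + b" "\<not> \<tau> j \<le> b" by (auto simp: bottom_reflect_def)
  thus "X (\<tau> i) (\<tau> j) = 0" using meander_commutes_lower_left[of "\<tau> i" "\<tau> j"] by simp
next
  fix i' j' assume ij': "i' \<in> {1..a + b}" "j' \<in> {1..a + b}" "i' \<le> a \<longrightarrow> j' \<le> a"
  define i j where "i = \<tau> i'" and "j = \<tau> j'"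
  have ij: "1 \<le> i" "i \<le> a + b" "1 \<le> j" "j \<le> a + b" "j \<le> b \<Longrightarrow> i \<le> b"
    using ij' by (auto simp: i_def j_def bottom_reflect_def)
  \<comment> \<open>The top reflection of (a, b) seen after reversal: it reflects [1, b] and
    [b + 1, a + b] separately.\<close>
  define \<gamma>' where "\<gamma>' k = (if k \<le> b then \<gamma> k else \<beta> k)" for k
  have reflect: "\<tau> (top_reflect a b i') = \<gamma>' i" "\<tau> (top_reflect a b j') = \<gamma>' j"
    using ij' by (auto simp: i_def j_def \<gamma>'_def top_reflect_def bottom_reflect_def)
  have lt: "i' < top_reflect a b i' \<longleftrightarrow> \<gamma>' i < i" "i < i' \<longleftrightarrow> i < \<tau> i"
    "top_reflect a b j' < j' \<longleftrightarrow> j < \<gamma>' j" "j' < j \<longleftrightarrow> \<tau> j < j"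
    using ij' by (auto simp: i_def j_def \<gamma>'_def top_reflect_def bottom_reflect_def)
  note up = meander_commutes_upper_left[OF ij(1-4)]
  have "(if \<gamma>' i < i then X (\<gamma>' i) j else 0) + (if i < \<tau> i then X (\<tau> i) j else 0) =
      (if j < \<gamma>' j then X i (\<gamma>' j) else 0) + (if \<tau> j < j then X i (\<tau> j) else 0)"
  proof -
    consider "b < i" "b < j" | "i \<le> b" "b < j" | "i \<le> b" "j \<le> b" using ij(5) by linarith
    thus ?thesis
    proof cases
      case 1
      hence "\<gamma>' i = \<beta> i" "\<gamma>' j = \<beta> j" by (simp_all add: \<gamma>'_def)
      thus ?thesis using up by (simp only: add.commute)
    next
      case 2
      hence \<gamma>': "\<gamma>' i = \<gamma> i" "\<gamma>' j = \<beta> j" by (simp_all add: \<gamma>'_def)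
      have "1 \<le> \<gamma> i" "\<gamma> i \<le> b" using 2 ij by (auto simp: bottom_reflect_def)
      hence "X (\<gamma> i) j = 0" using meander_commutes_lower_left[of "\<gamma> i" j] ij 2 by simp
      moreover have "\<not> \<beta> i < i" using 2 by (auto simp: bottom_reflect_def)
      ultimately show ?thesis using up unfolding \<gamma>' by (simp add: add.commute)
    next
      \<comment> \<open>The entry X i (\<beta> j), which lies outside the smaller matrix, occurs in
        both available equations and cancels.\<close>
      case 3
      hence \<gamma>': "\<gamma>' i = \<gamma> i" "\<gamma>' j = \<gamma> j" by (simp_all add: \<gamma>'_def)
      have "\<not> \<beta> i < i" "j < \<beta> j" using 3 by (auto simp: bottom_reflect_def)
      thus ?thesis using up meander_commutes_lower_right[OF ij(1) 3(1) ij(3) 3(2)]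
        unfolding \<gamma>' by (simp add: algebra_simps)
    qed
  qed
  thus "(if i' < top_reflect a b i' then X (\<tau> (top_reflect a b i')) (\<tau> j') else 0) +
      (if \<tau> i' < i' then X (\<tau> (\<tau> i')) (\<tau> j') else 0) =
      (if top_reflect a b j' < j' then X (\<tau> i') (\<tau> (top_reflect a b j')) else 0) +
      (if j' < \<tau> j' then X (\<tau> i') (\<tau> (\<tau> j')) else 0)"
    unfolding i_def[symmetric] j_def[symmetric] reflect lt .
qed

text \<open>A scalar first diagonal block determines the rest: the last diagonal block is a copy of
  part of it, and the off-diagonal block is forced to vanish.\<close>

lemma meander_commutes_scalar_extend:
  assumes scalar: "\<And>i j. 1 \<le> i \<Longrightarrow> i \<le> a + b \<Longrightarrow> 1 \<le> j \<Longrightarrow> j \<le> a + b \<Longrightarrow> X i j = (if i = j then c else 0)"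
    and ij: "1 \<le> i" "i \<le> a + b + b" "1 \<le> j" "j \<le> a + b + b"
  shows "X i j = (if i = j then c else 0)"
proof -
  \<comment> \<open>Rows up to b use the last-block equation, rows beyond b the first-block one; in
    each, the remaining scalar entries cancel against each other.\<close>
  have right: "X i (\<beta> q) = 0" if "1 \<le> q" "q \<le> b" "1 \<le> i" "i \<le> a + b" for i q
  proof (cases "i \<le> b")
    case True
    have "X (\<gamma> i) q = (if \<gamma> i = q then c else 0)"
      by (rule scalar) (use that True in \<open>auto simp: bottom_reflect_def\<close>)
    moreover have "X i (\<gamma> q) = (if i = \<gamma> q then c else 0)"
      by (rule scalar) (use that True in \<open>auto simp: bottom_reflect_def\<close>)
    moreover have "\<gamma> i < i \<and> \<gamma> i = q \<longleftrightarrow> q < \<gamma> q \<and> i = \<gamma> q"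
      using that True by (auto simp: bottom_reflect_def)
    ultimately show ?thesis using meander_commutes_lower_right[OF that(3) True that(1,2)]
      by (auto split: if_splits)
  next
    case False
    have "X (\<tau> i) q = (if \<tau> i = q then c else 0)"
      by (rule scalar) (use that False in \<open>auto simp: bottom_reflect_def\<close>)
    moreover have "X i (\<tau> q) = (if i = \<tau> q then c else 0)"
      by (rule scalar) (use that False in \<open>auto simp: bottom_reflect_def\<close>)
    moreover have "X (\<beta> i) q = 0" if "\<beta> i < i"
    proof -
      have "X (\<beta> i) q = (if \<beta> i = q then c else 0)"
        by (rule scalar) (use that \<open>1 \<le> q\<close> \<open>q \<le> b\<close> \<open>i \<le> a + b\<close> False in \<open>auto simp: bottom_reflect_def\<close>)
      moreover have "\<beta> i \<noteq> q" using \<open>q \<le> b\<close> \<open>i \<le> a + b\<close> by (auto simp: bottom_reflect_def)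
      ultimately show ?thesis by simp
    qed
    moreover have "i < \<tau> i \<and> \<tau> i = q \<longleftrightarrow> \<tau> q < q \<and> i = \<tau> q" "q < \<beta> q" "q \<le> a + b"
      using that False by (auto simp: bottom_reflect_def)
    ultimately show ?thesis using meander_commutes_upper_left[OF that(3,4,1)]
      by (auto split: if_splits)
  qed
  consider "i \<le> a + b" "j \<le> a + b" | "i \<le> a + b" "a + b < j" | "a + b < i" "j \<le> a + b" | "a + b < i" "a + b < j"
    by linarith
  thus ?thesis
  proof cases
    case 1
    thus ?thesis using scalar ij by simp
  next
    case 2
    define q where "q = \<beta> j"
    have "1 \<le> q" "q \<le> b" "\<beta> q = j" using 2 ij by (auto simp: q_def bottom_reflect_def)
    thus ?thesis using right[of q i] 2 ij by simp
  next
    case 3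
    thus ?thesis using meander_commutes_zero[OF comm, of i j] ij by simp
  next
    case 4
    define p q where "p = \<beta> i" and "q = \<beta> j"
    have pq: "1 \<le> p" "p \<le> b" "1 \<le> q" "q \<le> b" "\<beta> p = i" "\<beta> q = j" "p = q \<longleftrightarrow> i = j"
      using 4 ij by (auto simp: p_def q_def bottom_reflect_def)
    have "X p q = X i j" using meander_commutes_lower_left[of p q] pq by simp
    thus ?thesis using scalar[of p q] pq by simp
  qed
qed

end

text \<open>Euclidean induction again: reduce, apply the hypothesis to the smaller pair, and extend
  the scalar back.\<close>

lemma meander_commutes_scalar:
  fixes X :: "nat \<Rightarrow> nat \<Rightarrow> 'a::comm_ring_1"
  assumes "coprime a b" "0 < a" "0 < b" "meander_commutes a b X"
  shows "\<exists>c. \<forall>i\<in>{1..a + b}. \<forall>j\<in>{1..a + b}. X i j = (if i = j then c else 0)"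
  using assms
proof (induction "a + b" arbitrary: a b X rule: less_induct)
  case less
  have descend: "\<exists>c. \<forall>i\<in>{1..a' + b'}. \<forall>j\<in>{1..a' + b'}. X' i j = (if i = j then c else 0)"
    if "a' + b' = a + b" "b' < a'" "coprime a' b'" "0 < b'" "meander_commutes a' b' X'"
    for a' b' and X' :: "nat \<Rightarrow> nat \<Rightarrow> 'a"
  proof -
    define d where "d = a' - b'"
    have a': "a' = d + b'" and d: "0 < d" using that by (auto simp: d_def)
    have comm: "meander_commutes (d + b') b' X'" using that(5) unfolding a' .
    have b': "0 < b'" by (rule that(4))
    have "coprime d b'" using that(3) unfolding a' by (simp add: coprime_iff_gcd_eq_1)
    moreover have "d + b' < a + b" using that a' by simp
    ultimately have "\<exists>c. \<forall>i\<in>{1..d + b'}. \<forall>j\<in>{1..d + b'}.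
        X' (bottom_reflect d b' i) (bottom_reflect d b' j) = (if i = j then c else 0)"
      using less(1)[OF _ _ d b' meander_commutes_reduce[OF comm]] by blast
    then obtain c where c: "\<forall>i\<in>{1..d + b'}. \<forall>j\<in>{1..d + b'}.
        X' (bottom_reflect d b' i) (bottom_reflect d b' j) = (if i = j then c else 0)" by blast
    have "X' i j = (if i = j then c else 0)" if "1 \<le> i" "i \<le> d + b'" "1 \<le> j" "j \<le> d + b'" for i j
    proof -
      have "bottom_reflect d b' i \<in> {1..d + b'}" "bottom_reflect d b' j \<in> {1..d + b'}"
        "bottom_reflect d b' (bottom_reflect d b' i) = i" "bottom_reflect d b' (bottom_reflect d b' j) = j"
        "bottom_reflect d b' i = bottom_reflect d b' j \<longleftrightarrow> i = j"
        using that by (auto simp: bottom_reflect_def)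
      thus ?thesis using c by metis
    qed
    from meander_commutes_scalar_extend[OF comm this] show ?thesis unfolding a' by auto
  qed
  consider "b < a" | "a < b" | "a = b" by linarith
  thus ?case
  proof cases
    case 1
    thus ?thesis using descend less.prems by blast
  next
    case 2
    have "coprime b a" "b + a = a + b" using less.prems by (simp_all add: coprime_commute)
    hence "\<exists>c. \<forall>i\<in>{1..b + a}. \<forall>j\<in>{1..b + a}.
        X (bottom_reflect a b j) (bottom_reflect a b i) = (if i = j then c else 0)"
      using descend[OF _ 2 _ less.prems(2) meander_commutes_swap[OF less.prems(4)]] by blast
    then obtain c where c: "\<forall>i\<in>{1..a + b}. \<forall>j\<in>{1..a + b}.
        X (bottom_reflect a b j) (bottom_reflect a b i) = (if i = j then c else 0)"
      unfolding add.commute[of b a] by blast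
    have "X i j = (if i = j then c else 0)" if "i \<in> {1..a + b}" "j \<in> {1..a + b}" for i j
    proof -
      have "bottom_reflect a b i \<in> {1..a + b}" "bottom_reflect a b j \<in> {1..a + b}"
        "bottom_reflect a b (bottom_reflect a b i) = i" "bottom_reflect a b (bottom_reflect a b j) = j"
        "bottom_reflect a b j = bottom_reflect a b i \<longleftrightarrow> i = j"
        using that by (auto simp: bottom_reflect_def)
      thus ?thesis using c by metis
    qed
    thus ?thesis by blast
  next
    case 3
    \<comment> \<open>For (1, 1) the equation at (2, 1) equates the diagonal entries, and the one at
      (1, 1) kills the off-diagonal entry.\<close>
    hence ab: "a = 1" "b = 1" using less.prems by auto
    have X: "meander_commutes 1 1 X" using less.prems(4) by (simp add: ab)
    have "X 2 1 = 0" by (rule meander_commutes_zero[OF X]) auto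
    moreover have "X 1 1 = X 2 2"
      using meander_commutes_eq[OF X, of 2 1 2 1 1 2] by (simp add: top_reflect_def bottom_reflect_def)
    moreover have "X 1 2 = 0"
      using meander_commutes_eq[OF X, of 1 1 1 2 1 2] by (simp add: top_reflect_def bottom_reflect_def)
    moreover have "{1..a + b} = {1, 2}" by (auto simp: ab)
    ultimately show ?thesis by (intro exI[of _ "X 1 1"]) simp
  qed
qed

section \<open>The spectrum of $W(a,b)$\<close>

lemma mem_W_iff:
  "x \<in> W a b \<longleftrightarrow> x \<in> carrier_mat (a + b) (a + b) \<and>
     (\<forall>i j. a \<le> i \<longrightarrow> i < a + b \<longrightarrow> j < a \<longrightarrow> x $$ (i, j) = 0) \<and> mat_trace x = 0"
proof -
  have trace: "mat_trace (four_block_mat X Z (0\<^sub>m b a) Y) = mat_trace X + mat_trace Y"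
    if "X \<in> carrier_mat a a" "Y \<in> carrier_mat b b" "Z \<in> carrier_mat a b" for X Y Z :: "complex mat"
  proof -
    let ?M = "four_block_mat X Z (0\<^sub>m b a) Y"
    have "sum f {..<a + b} = sum f {..<a} + sum f {a..<a + b}" for f :: "nat \<Rightarrow> complex"
      by (simp add: lessThan_atLeast0 sum.atLeastLessThan_concat)
    moreover have "dim_row ?M = a + b" using that by simp
    ultimately have "mat_trace ?M = (\<Sum>i<a. ?M $$ (i, i)) + (\<Sum>i=a..<a + b. ?M $$ (i, i))"
      unfolding mat_trace_def by metis
    also have "(\<Sum>i<a. ?M $$ (i, i)) = mat_trace X"
      using that by (auto simp: mat_trace_def intro!: sum.cong)
    also have "(\<Sum>i=a..<a + b. ?M $$ (i, i)) = (\<Sum>i=0..<b. ?M $$ (i + a, i + a))"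
      using sum.shift_bounds_nat_ivl[of "\<lambda>i. ?M $$ (i, i)" 0 a b] by (simp add: add.commute)
    also have "\<dots> = mat_trace Y"
      using that by (auto simp: mat_trace_def atLeast0LessThan intro!: sum.cong)
    finally show ?thesis .
  qed
  show ?thesis
  proof
    assume "x \<in> W a b"
    then obtain X Y Z where x: "x = four_block_mat X Z (0\<^sub>m b a) Y"
      "X \<in> carrier_mat a a" "Y \<in> carrier_mat b b" "Z \<in> carrier_mat a b" "mat_trace X + mat_trace Y = 0"
      unfolding W_def by blast
    thus "x \<in> carrier_mat (a + b) (a + b) \<and>
        (\<forall>i j. a \<le> i \<longrightarrow> i < a + b \<longrightarrow> j < a \<longrightarrow> x $$ (i, j) = 0) \<and> mat_trace x = 0"
      using trace[OF x(2-4)] by auto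
  next
    assume x: "x \<in> carrier_mat (a + b) (a + b) \<and>
        (\<forall>i j. a \<le> i \<longrightarrow> i < a + b \<longrightarrow> j < a \<longrightarrow> x $$ (i, j) = 0) \<and> mat_trace x = 0"
    define X where "X = Matrix.mat a a (\<lambda>(i, j). x $$ (i, j))"
    define Y where "Y = Matrix.mat b b (\<lambda>(i, j). x $$ (i + a, j + a))"
    define Z where "Z = Matrix.mat a b (\<lambda>(i, j). x $$ (i, j + a))"
    have c: "X \<in> carrier_mat a a" "Y \<in> carrier_mat b b" "Z \<in> carrier_mat a b"
      by (simp_all add: X_def Y_def Z_def)
    have "x = four_block_mat X Z (0\<^sub>m b a) Y"
      by (rule eq_matI) (use x in \<open>auto simp: X_def Y_def Z_def\<close>)
    moreover from this trace[OF c] x have "mat_trace X + mat_trace Y = 0" by simp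
    ultimately show "x \<in> W a b" unfolding W_def using c by blast
  qed
qed

lemma W_carrier: "x \<in> W a b \<Longrightarrow> x \<in> carrier_mat (a + b) (a + b)"
  and W_lower_left: "x \<in> W a b \<Longrightarrow> a \<le> i \<Longrightarrow> i < a + b \<Longrightarrow> j < a \<Longrightarrow> x $$ (i, j) = 0"
  and W_trace: "x \<in> W a b \<Longrightarrow> mat_trace x = 0"
  by (auto simp: mem_W_iff)

lemma mat_trace_add:
  "A \<in> carrier_mat n n \<Longrightarrow> B \<in> carrier_mat n n \<Longrightarrow> mat_trace (A + B) = mat_trace A + mat_trace (B :: 'a::comm_ring_1 mat)"
  and mat_trace_minus:
  "A \<in> carrier_mat n n \<Longrightarrow> B \<in> carrier_mat n n \<Longrightarrow> mat_trace (A - B) = mat_trace A - mat_trace B"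
  and mat_trace_smult:
  "A \<in> carrier_mat n n \<Longrightarrow> mat_trace (c \<cdot>\<^sub>m A) = c * mat_trace A"
  by (auto simp: mat_trace_def sum.distrib sum_subtractf sum_distrib_left)

lemma W_commutator:
  assumes "x \<in> W a b" "y \<in> W a b"
  shows "commutator x y \<in> W a b"
proof -
  note c = W_carrier[OF assms(1)] W_carrier[OF assms(2)]
  have zero: "(u * w) $$ (i, j) = 0" if uw: "u \<in> W a b" "w \<in> W a b" and ij: "a \<le> i" "i < a + b" "j < a" for u w i j
  proof -
    have "(u * w) $$ (i, j) = (\<Sum>k<a + b. u $$ (i, k) * w $$ (k, j))"
      using W_carrier[OF uw(1)] W_carrier[OF uw(2)] ij by (simp add: scalar_prod_def atLeast0LessThan)
    also have "\<dots> = 0"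
    proof (rule sum.neutral, intro ballI)
      fix k assume "k \<in> {..<a + b}"
      thus "u $$ (i, k) * w $$ (k, j) = 0"
        using W_lower_left[OF uw(1) ij(1,2), of k] W_lower_left[OF uw(2), of k j] ij by (cases "k < a") auto
    qed
    finally show ?thesis .
  qed
  have "mat_trace (commutator x y) = 0"
    unfolding commutator_def using mat_trace_mult_commute[OF c] c
    by (subst mat_trace_minus[OF mult_carrier_mat[OF c] mult_carrier_mat[OF c(2,1)]]) simp
  moreover have "commutator x y $$ (i, j) = 0" if ij: "a \<le> i" "i < a + b" "j < a" for i j
  proof -
    have "commutator x y $$ (i, j) = (x * y) $$ (i, j) - (y * x) $$ (i, j)"
      unfolding commutator_def using c ij by (intro index_minus_mat(1)) auto
    thus ?thesis using zero[OF assms ij] zero[OF assms(2,1) ij] by simp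
  qed
  ultimately show ?thesis unfolding mem_W_iff using commutator_closed_mat[OF c] by blast
qed

text \<open>
  The entries at the listed positions are coordinates on \<open>W a b\<close>: the trace condition determines
  the remaining last diagonal entry. The dual basis therefore corrects the diagonal matrix units there.
\<close>

definition W_positions :: "nat \<Rightarrow> nat \<Rightarrow> (nat \<times> nat) list" where
  "W_positions a b = filter (\<lambda>(i, j). (a \<le> i \<longrightarrow> a \<le> j) \<and> (i, j) \<noteq> (a + b - 1, a + b - 1))
     (List.product [0..<a + b] [0..<a + b])"

definition W_unit :: "nat \<Rightarrow> nat \<Rightarrow> nat \<times> nat \<Rightarrow> complex mat" where
  "W_unit a b p = Matrix.mat (a + b) (a + b)
     (\<lambda>q. of_bool (q = p) - of_bool (fst p = snd p \<and> q = (a + b - 1, a + b - 1)))"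

lemma set_W_positions:
  "(i, j) \<in> set (W_positions a b) \<longleftrightarrow>
     i < a + b \<and> j < a + b \<and> (a \<le> i \<longrightarrow> a \<le> j) \<and> (i, j) \<noteq> (a + b - 1, a + b - 1)"
  by (auto simp: W_positions_def)

lemma distinct_W_positions: "distinct (W_positions a b)"
  by (simp add: W_positions_def distinct_product)

lemma W_unit_carrier: "W_unit a b p \<in> carrier_mat (a + b) (a + b)"
  by (simp add: W_unit_def)

lemma W_unit_index:
  "i < a + b \<Longrightarrow> j < a + b \<Longrightarrow> W_unit a b p $$ (i, j) =
     of_bool ((i, j) = p) - of_bool (fst p = snd p \<and> (i, j) = (a + b - 1, a + b - 1))"
  by (simp add: W_unit_def)

lemma W_unit_mem:
  assumes "p \<in> set (W_positions a b)" "0 < b"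
  shows "W_unit a b p \<in> W a b"
proof -
  obtain i j where p: "p = (i, j)" by (cases p)
  have ij: "i < a + b" "j < a + b" "a \<le> i \<longrightarrow> a \<le> j" "(i, j) \<noteq> (a + b - 1, a + b - 1)"
    using assms(1) unfolding p set_W_positions by auto
  have "mat_trace (W_unit a b p) = (\<Sum>k<a + b. of_bool (k = i \<and> k = j)) -
      (\<Sum>k<a + b. of_bool (i = j \<and> k = a + b - 1))"
    by (simp add: mat_trace_def W_unit_def p sum_subtractf)
  also have "(\<Sum>k<a + b. of_bool (k = i \<and> k = j)) = (of_bool (i = j) :: complex)"
    using ij by (cases "i = j") (auto simp: of_bool_def)
  also have "(\<Sum>k<a + b. of_bool (i = j \<and> k = a + b - 1)) = (of_bool (i = j) :: complex)"
    using assms(2) by (cases "i = j") (auto simp: of_bool_def)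
  finally have "mat_trace (W_unit a b p) = 0" by simp
  moreover have "W_unit a b p $$ (k, l) = 0" if "a \<le> k" "k < a + b" "l < a" for k l
    using that ij assms(2) by (auto simp: W_unit_index p)
  ultimately show ?thesis unfolding mem_W_iff using W_unit_carrier by blast
qed

text \<open>Indices past the end of the list get the zero functional, since \<open>co_linear\<close>
  speaks of all indices.\<close>

lemma W_matrix_lie_algebra:
  assumes "0 < b"
  shows "matrix_lie_algebra (a + b) (length (W_positions a b)) (W a b)
    (\<lambda>k. W_unit a b (W_positions a b ! k))
    (\<lambda>k x. if k < length (W_positions a b) then x $$ (W_positions a b ! k) else 0)"
proof
  let ?ps = "W_positions a b"
  fix x y c assume x: "x \<in> W a b"
  show "x \<in> carrier_mat (a + b) (a + b)" by (rule W_carrier[OF x])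
  show "c \<cdot>\<^sub>m x \<in> W a b"
    using x mat_trace_smult[of x "a + b" c] unfolding mem_W_iff by auto
  assume y: "y \<in> W a b"
  show "x + y \<in> W a b"
    using x y mat_trace_add[of x "a + b" y] unfolding mem_W_iff by auto
  show "commutator x y \<in> W a b" by (rule W_commutator[OF x y])
  assume "\<And>k. k < length ?ps \<Longrightarrow>
      (if k < length ?ps then x $$ (?ps ! k) else 0) = (if k < length ?ps then y $$ (?ps ! k) else 0)"
  hence eq: "x $$ (?ps ! k) = y $$ (?ps ! k)" if "k < length ?ps" for k using that by simp
  let ?v = "a + b - 1"
  have entry: "x $$ (i, j) = y $$ (i, j)" if ij: "i < a + b" "j < a + b" "(i, j) \<noteq> (?v, ?v)" for i j
  proof (cases "a \<le> i \<longrightarrow> a \<le> j")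
    case True
    hence "(i, j) \<in> set ?ps" using ij by (simp add: set_W_positions)
    thus ?thesis using eq by (metis in_set_conv_nth)
  next
    case False
    thus ?thesis using W_lower_left[OF x, of i j] W_lower_left[OF y, of i j] ij by simp
  qed
  have v: "?v < a + b" "{..<a + b} = insert ?v {..<?v}" using assms by auto
  have split: "mat_trace z = z $$ (?v, ?v) + (\<Sum>i<?v. z $$ (i, i))" if "z \<in> W a b" for z
    using W_carrier[OF that] v(2) by (simp add: mat_trace_def)
  have "(\<Sum>i<?v. x $$ (i, i)) = (\<Sum>i<?v. y $$ (i, i))"
    by (rule sum.cong) (use entry in auto)
  moreover have "z $$ (?v, ?v) = - (\<Sum>i<?v. z $$ (i, i))" if "z \<in> W a b" for z
    using split[OF that] W_trace[OF that] by (simp only: eq_neg_iff_add_eq_0)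
  ultimately have last: "x $$ (?v, ?v) = y $$ (?v, ?v)" using x y by (simp only:)
  show "x = y"
  proof (rule eq_matI)
    fix i j assume "i < dim_row y" "j < dim_col y"
    thus "x $$ (i, j) = y $$ (i, j)"
      using entry[of i j] last carrier_matD[OF W_carrier[OF y]] by (cases "(i, j) = (?v, ?v)") simp_all
  qed (use W_carrier[OF x] W_carrier[OF y] in auto)
next
  show "0\<^sub>m (a + b) (a + b) \<in> W a b" by (simp add: mem_W_iff mat_trace_def)
next
  fix k assume k: "k < length (W_positions a b)"
  show "W_unit a b (W_positions a b ! k) \<in> W a b"
    by (rule W_unit_mem[OF nth_mem[OF k] assms])
  fix l assume l: "l < length (W_positions a b)"
  obtain i j where p: "W_positions a b ! k = (i, j)" by (cases "W_positions a b ! k")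
  have ij: "i < a + b" "j < a + b" "(i, j) \<noteq> (a + b - 1, a + b - 1)"
    using nth_mem[OF k] unfolding p set_W_positions by auto
  have "W_unit a b (W_positions a b ! l) $$ (W_positions a b ! k) = of_bool (k = l)"
    unfolding p W_unit_index[OF ij(1,2)] using ij(3) p nth_eq_iff_index_eq[OF distinct_W_positions k l] by auto
  thus "(if k < length (W_positions a b) then W_unit a b (W_positions a b ! l) $$ (W_positions a b ! k) else 0) =
      of_bool (k = l)"
    using k by simp
next
  fix k
  show "linear_functional (W a b)
      (\<lambda>x. if k < length (W_positions a b) then x $$ (W_positions a b ! k) else 0)"
  proof (cases "k < length (W_positions a b)")
    case True
    obtain i j where p: "W_positions a b ! k = (i, j)" by (cases "W_positions a b ! k")
    have "i < a + b" "j < a + b" using nth_mem[OF True] unfolding p set_W_positions by auto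
    thus ?thesis using True carrier_matD[OF W_carrier] unfolding linear_functional_def p by simp
  qed (simp add: linear_functional_def)
qed

section \<open>The meander functional is Frobenius\<close>

definition meander_matrix :: "nat \<Rightarrow> nat \<Rightarrow> complex mat" where
  "meander_matrix a b = Matrix.mat (a + b) (a + b)
     (\<lambda>(i, j). of_bool ((i + 1, j + 1) \<in> top_edges a b \<or> (j + 1, i + 1) \<in> bottom_edges a b))"

text \<open>The sum of the entries of x selected by the edges, written with the trace form. Bottom
  edges enter the matrix transposed, so that the potential rises by one from row to column at every
  nonzero entry.\<close>

definition meander_functional :: "nat \<Rightarrow> nat \<Rightarrow> complex mat \<Rightarrow> complex" where
  "meander_functional a b x = mat_trace (meander_matrix a b * x)"

lemma meander_matrix_carrier: "meander_matrix a b \<in> carrier_mat (a + b) (a + b)"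
  by (simp add: meander_matrix_def)

lemma meander_functional_linear: "linear_functional (W a b) (meander_functional a b)"
proof -
  note F = meander_matrix_carrier[of a b]
  have "meander_functional a b (x + y) = meander_functional a b x + meander_functional a b y"
    if "x \<in> W a b" "y \<in> W a b" for x y
    using W_carrier[OF that(1)] W_carrier[OF that(2)] F
    unfolding meander_functional_def mult_add_distrib_mat[OF F W_carrier[OF that(1)] W_carrier[OF that(2)]]
    by (intro mat_trace_add) auto
  moreover have "meander_functional a b (c \<cdot>\<^sub>m x) = c * meander_functional a b x" if "x \<in> W a b" for x c
    using W_carrier[OF that] F
    unfolding meander_functional_def mult_smult_distrib[OF F W_carrier[OF that]]
    by (intro mat_trace_smult[of _ "a + b"]) auto
  ultimately show ?thesis by (simp add: linear_functional_def)
qed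

text \<open>Invariance of the trace form. It turns a condition on x in the radical into one on the
  commutator of F and x.\<close>

lemma mat_trace_mult_commutator:
  assumes F: "F \<in> carrier_mat n n" and x: "x \<in> carrier_mat n n" and y: "y \<in> carrier_mat n n"
  shows "mat_trace (F * commutator x y) = mat_trace ((F * x - x * F) * y)"
proof -
  note c = mult_carrier_mat[OF x y] mult_carrier_mat[OF y x] mult_carrier_mat[OF F x] mult_carrier_mat[OF x F]
    mult_carrier_mat[OF F y]
  have "mat_trace (F * commutator x y) = mat_trace (F * (x * y)) - mat_trace (F * (y * x))"
    unfolding commutator_def mult_minus_distrib_mat[OF F c(1,2)]
    by (rule mat_trace_minus[OF mult_carrier_mat[OF F c(1)] mult_carrier_mat[OF F c(2)]])
  also have "mat_trace (F * (y * x)) = mat_trace (x * (F * y))"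
    unfolding assoc_mult_mat[OF F y x, symmetric] by (rule mat_trace_mult_commute[OF c(5) x])
  also have "mat_trace (F * (x * y)) - mat_trace (x * (F * y)) = mat_trace ((F * x - x * F) * y)"
    unfolding minus_mult_distrib_mat[OF c(3,4) y] assoc_mult_mat[OF F x y] assoc_mult_mat[OF x F y]
    by (rule mat_trace_minus[symmetric, OF mult_carrier_mat[OF F c(1)] mult_carrier_mat[OF x c(5)]])
  finally show ?thesis .
qed

lemma mat_trace_mult_W_unit:
  assumes G: "G \<in> carrier_mat (a + b) (a + b)" and ij: "i < a + b" "j < a + b" and b: "0 < b"
  shows "mat_trace (G * W_unit a b (i, j)) =
    G $$ (j, i) - of_bool (i = j) * G $$ (a + b - 1, a + b - 1)"
proof -
  let ?v = "a + b - 1"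
  have "mat_trace (G * W_unit a b (i, j)) =
      (\<Sum>k<a + b. \<Sum>l<a + b. G $$ (k, l) * W_unit a b (i, j) $$ (l, k))"
    using G W_unit_carrier[of a b "(i, j)"]
    by (simp add: mat_trace_def scalar_prod_def atLeast0LessThan)
  also have "\<dots> = (\<Sum>k<a + b. \<Sum>l<a + b. G $$ (k, l) * of_bool (l = i \<and> k = j)) -
      (\<Sum>k<a + b. \<Sum>l<a + b. G $$ (k, l) * of_bool (i = j \<and> l = ?v \<and> k = ?v))"
    by (simp add: W_unit_index right_diff_distrib sum_subtractf)
  also have "(\<Sum>k<a + b. \<Sum>l<a + b. G $$ (k, l) * of_bool (l = i \<and> k = j)) =
      (\<Sum>k<a + b. if k = j then \<Sum>l<a + b. if l = i then G $$ (k, l) else 0 else 0)"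
    by (intro sum.cong) auto
  also have "\<dots> = G $$ (j, i)" using ij by simp
  also have "(\<Sum>k<a + b. \<Sum>l<a + b. G $$ (k, l) * of_bool (i = j \<and> l = ?v \<and> k = ?v)) =
      (\<Sum>k<a + b. if k = ?v then \<Sum>l<a + b. if l = ?v then of_bool (i = j) * G $$ (k, l) else 0 else 0)"
    by (intro sum.cong) auto
  also have "\<dots> = of_bool (i = j) * G $$ (?v, ?v)" using b by simp
  finally show ?thesis .
qed

lemma reflect_range:
  assumes "1 \<le> i" "i \<le> a + b"
  shows "1 \<le> top_reflect a b i" "top_reflect a b i \<le> a + b"
    "1 \<le> bottom_reflect a b i" "bottom_reflect a b i \<le> a + b"
  using assms by (auto simp: top_reflect_def bottom_reflect_def)

lemma meander_edges_reflect:
  assumes "1 \<le> i" "i \<le> a + b" "1 \<le> j" "j \<le> a + b"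
  shows "(i, j) \<in> top_edges a b \<longleftrightarrow> j = top_reflect a b i \<and> i < j"
    and "(i, j) \<in> top_edges a b \<longleftrightarrow> i = top_reflect a b j \<and> i < j"
    and "(i, j) \<in> bottom_edges a b \<longleftrightarrow> j = bottom_reflect a b i \<and> i < j"
    and "(i, j) \<in> bottom_edges a b \<longleftrightarrow> i = bottom_reflect a b j \<and> i < j"
  using assms by (auto simp: top_edges_def bottom_edges_def top_reflect_def bottom_reflect_def)

lemma meander_matrix_index:
  assumes "1 \<le> i" "i \<le> a + b" "1 \<le> j" "j \<le> a + b"
  shows "meander_matrix a b $$ (i - 1, j - 1) = of_bool (j = top_reflect a b i \<and> i < top_reflect a b i) +
      of_bool (j = bottom_reflect a b i \<and> bottom_reflect a b i < i)"
    and "meander_matrix a b $$ (i - 1, j - 1) = of_bool (i = top_reflect a b j \<and> top_reflect a b j < j) +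
      of_bool (i = bottom_reflect a b j \<and> j < bottom_reflect a b j)"
proof -
  have "meander_matrix a b $$ (i - 1, j - 1) = of_bool ((i, j) \<in> top_edges a b \<or> (j, i) \<in> bottom_edges a b)"
    using assms by (simp add: meander_matrix_def)
  \<comment> \<open>The disjunction becomes a sum because top edges need i < j and transposed bottom
    edges j < i.\<close>
  also have "\<dots> = of_bool ((i, j) \<in> top_edges a b) + of_bool ((j, i) \<in> bottom_edges a b)"
    by (auto simp: top_edges_def bottom_edges_def)
  finally have *: "meander_matrix a b $$ (i - 1, j - 1) =
      of_bool ((i, j) \<in> top_edges a b) + of_bool ((j, i) \<in> bottom_edges a b)" .
  have "(i, j) \<in> top_edges a b \<longleftrightarrow> j = top_reflect a b i \<and> i < top_reflect a b i"
    "(j, i) \<in> bottom_edges a b \<longleftrightarrow> j = bottom_reflect a b i \<and> bottom_reflect a b i < i"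
    using meander_edges_reflect(1)[OF assms] meander_edges_reflect(4)[OF assms(3,4,1,2)] by auto
  thus "meander_matrix a b $$ (i - 1, j - 1) = of_bool (j = top_reflect a b i \<and> i < top_reflect a b i) +
      of_bool (j = bottom_reflect a b i \<and> bottom_reflect a b i < i)"
    unfolding * by simp
  have "(i, j) \<in> top_edges a b \<longleftrightarrow> i = top_reflect a b j \<and> top_reflect a b j < j"
    "(j, i) \<in> bottom_edges a b \<longleftrightarrow> i = bottom_reflect a b j \<and> j < bottom_reflect a b j"
    using meander_edges_reflect(2)[OF assms] meander_edges_reflect(3)[OF assms(3,4,1,2)] by auto
  thus "meander_matrix a b $$ (i - 1, j - 1) = of_bool (i = top_reflect a b j \<and> top_reflect a b j < j) +
      of_bool (i = bottom_reflect a b j \<and> j < bottom_reflect a b j)"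
    unfolding * by simp
qed

lemma sum_indicator_mult:
  fixes f :: "'b \<Rightarrow> 'a::comm_semiring_1"
  assumes "finite S" "t \<in> S"
  shows "(\<Sum>k\<in>S. of_bool (k = t \<and> P) * f k) = (if P then f t else 0)"
proof -
  have "(\<Sum>k\<in>S. of_bool (k = t \<and> P) * f k) = (\<Sum>k\<in>S. if k = t then (if P then f t else 0) else 0)"
    by (rule sum.cong) auto
  thus ?thesis using assms by simp
qed

lemma meander_matrix_mult_index:
  assumes x: "x \<in> carrier_mat (a + b) (a + b)" and i: "1 \<le> i" "i \<le> a + b" and j: "1 \<le> j" "j \<le> a + b"
  shows "(meander_matrix a b * x) $$ (i - 1, j - 1) =
      (if i < top_reflect a b i then x $$ (top_reflect a b i - 1, j - 1) else 0) +
      (if bottom_reflect a b i < i then x $$ (bottom_reflect a b i - 1, j - 1) else 0)"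
    and "(x * meander_matrix a b) $$ (i - 1, j - 1) =
      (if top_reflect a b j < j then x $$ (i - 1, top_reflect a b j - 1) else 0) +
      (if j < bottom_reflect a b j then x $$ (i - 1, bottom_reflect a b j - 1) else 0)"
proof -
  have prod: "(M * M') $$ (i - 1, j - 1) = (\<Sum>k\<in>{1..a + b}. M $$ (i - 1, k - 1) * M' $$ (k - 1, j - 1))"
    if "M \<in> carrier_mat (a + b) (a + b)" "M' \<in> carrier_mat (a + b) (a + b)" for M M' :: "complex mat"
    using that i j by (simp add: scalar_prod_def atLeast0LessThan sum.atLeast1_atMost_eq)
  have mem: "top_reflect a b i \<in> {1..a + b}" "bottom_reflect a b i \<in> {1..a + b}"
    "top_reflect a b j \<in> {1..a + b}" "bottom_reflect a b j \<in> {1..a + b}"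
    using reflect_range[OF i] reflect_range[OF j] by simp_all
  have "(meander_matrix a b * x) $$ (i - 1, j - 1) =
      (\<Sum>k\<in>{1..a + b}. of_bool (k = top_reflect a b i \<and> i < top_reflect a b i) * x $$ (k - 1, j - 1)) +
      (\<Sum>k\<in>{1..a + b}. of_bool (k = bottom_reflect a b i \<and> bottom_reflect a b i < i) * x $$ (k - 1, j - 1))"
    unfolding prod[OF meander_matrix_carrier x] sum.distrib[symmetric] distrib_right[symmetric]
    by (rule sum.cong[OF refl], rule arg_cong2[where f = "(*)"], rule meander_matrix_index(1)[OF i]) auto
  thus "(meander_matrix a b * x) $$ (i - 1, j - 1) =
      (if i < top_reflect a b i then x $$ (top_reflect a b i - 1, j - 1) else 0) +
      (if bottom_reflect a b i < i then x $$ (bottom_reflect a b i - 1, j - 1) else 0)"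
    unfolding sum_indicator_mult[OF finite_atLeastAtMost mem(1)] sum_indicator_mult[OF finite_atLeastAtMost mem(2)] .
  have "(x * meander_matrix a b) $$ (i - 1, j - 1) =
      (\<Sum>k\<in>{1..a + b}. of_bool (k = top_reflect a b j \<and> top_reflect a b j < j) * x $$ (i - 1, k - 1)) +
      (\<Sum>k\<in>{1..a + b}. of_bool (k = bottom_reflect a b j \<and> j < bottom_reflect a b j) * x $$ (i - 1, k - 1))"
    unfolding prod[OF x meander_matrix_carrier] sum.distrib[symmetric] distrib_right[symmetric]
      mult.commute[of "x $$ _"]
    by (rule sum.cong[OF refl], rule arg_cong2[where f = "(*)"], rule meander_matrix_index(2)[OF _ _ j]) auto
  thus "(x * meander_matrix a b) $$ (i - 1, j - 1) =
      (if top_reflect a b j < j then x $$ (i - 1, top_reflect a b j - 1) else 0) +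
      (if j < bottom_reflect a b j then x $$ (i - 1, bottom_reflect a b j - 1) else 0)"
    unfolding sum_indicator_mult[OF finite_atLeastAtMost mem(3)] sum_indicator_mult[OF finite_atLeastAtMost mem(4)] .
qed

text \<open>G = F x - x F is orthogonal to W(a,b) under the trace form. The trace condition on W
  leaves room for a multiple of the identity in G, and the trace of a commutator excludes
  it.\<close>

lemma meander_radical:
  assumes ab: "0 < b" and x: "x \<in> W a b"
    and rad: "\<And>y. y \<in> W a b \<Longrightarrow> meander_functional a b (commutator x y) = 0"
    and ij: "i < a + b" "j < a + b" "a \<le> i \<longrightarrow> a \<le> j"
  shows "(meander_matrix a b * x) $$ (j, i) = (x * meander_matrix a b) $$ (j, i)"
proof -
  let ?F = "meander_matrix a b" and ?v = "a + b - 1"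
  define G where "G = ?F * x - x * ?F"
  note F = meander_matrix_carrier[of a b] and xc = W_carrier[OF x]
  have Gc: "G \<in> carrier_mat (a + b) (a + b)" using F xc by (auto simp: G_def)
  have unit: "G $$ (l, k) = of_bool (k = l) * G $$ (?v, ?v)"
    if "k < a + b" "l < a + b" "a \<le> k \<longrightarrow> a \<le> l" for k l
  proof (cases "(k, l) = (?v, ?v)")
    case False
    hence "(k, l) \<in> set (W_positions a b)" using that by (simp add: set_W_positions)
    from W_unit_mem[OF this ab] have y: "W_unit a b (k, l) \<in> W a b" .
    have "mat_trace (G * W_unit a b (k, l)) = 0"
      using rad[OF y] unfolding meander_functional_def mat_trace_mult_commutator[OF F xc W_carrier[OF y]] G_def .
    thus ?thesis unfolding mat_trace_mult_W_unit[OF Gc that(1,2) ab] by simp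
  qed simp
  have "mat_trace G = 0"
    unfolding G_def mat_trace_minus[OF mult_carrier_mat[OF F xc] mult_carrier_mat[OF xc F]]
    using mat_trace_mult_commute[OF F xc] by simp
  \<comment> \<open>All diagonal entries of G agree with the last one, whose matrix unit corrects
    the traces of the others.\<close>
  moreover have "mat_trace G = of_nat (a + b) * G $$ (?v, ?v)"
  proof -
    have "mat_trace G = (\<Sum>k<a + b. G $$ (k, k))" using Gc by (simp add: mat_trace_def)
    also have "\<dots> = (\<Sum>k<a + b. G $$ (?v, ?v))"
    proof (rule sum.cong[OF refl])
      fix k assume "k \<in> {..<a + b}"
      thus "G $$ (k, k) = G $$ (?v, ?v)" using unit[of k k] by simp
    qed
    finally show ?thesis by simp
  qed
  moreover have "of_nat (a + b) \<noteq> (0 :: complex)" unfolding of_nat_eq_0_iff using ab by simp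
  ultimately have "G $$ (?v, ?v) = 0" by (metis mult_eq_0_iff)
  hence "G $$ (j, i) = 0" using unit[OF ij] by simp
  moreover have "G $$ (j, i) = (?F * x) $$ (j, i) - (x * ?F) $$ (j, i)"
    unfolding G_def using F xc ij by (intro index_minus_mat(1)) auto
  ultimately show ?thesis by simp
qed

text \<open>An element of the radical is scalar by \<open>meander_commutes_scalar\<close>, and a
  scalar matrix of trace zero vanishes.\<close>

lemma meander_frobenius:
  assumes "coprime a b" "0 < a" "0 < b"
  shows "frobenius_functional (a + b) (W a b) (meander_functional a b)"
  unfolding frobenius_functional_def
proof (intro conjI ballI impI meander_functional_linear)
  fix x assume x: "x \<in> W a b" and rad: "\<forall>y\<in>W a b. meander_functional a b (commutator x y) = 0"
  note xc = W_carrier[OF x]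
  have "meander_commutes a b (\<lambda>i j. x $$ (i - 1, j - 1))"
    unfolding meander_commutes_def
  proof (intro conjI ballI impI)
    fix i j assume "i \<in> {a + 1..a + b}" "j \<in> {1..a}"
    thus "x $$ (i - 1, j - 1) = 0" by (intro W_lower_left[OF x]) auto
  next
    fix i j assume "i \<in> {1..a + b}" "j \<in> {1..a + b}" and block: "i \<le> a \<longrightarrow> j \<le> a"
    hence ij: "1 \<le> i" "i \<le> a + b" "1 \<le> j" "j \<le> a + b" by auto
    hence "j - 1 < a + b" "i - 1 < a + b" "a \<le> j - 1 \<longrightarrow> a \<le> i - 1" using block by auto
    from meander_radical[OF assms(3) x _ this] rad
    show "(if i < top_reflect a b i then x $$ (top_reflect a b i - 1, j - 1) else 0) +
        (if bottom_reflect a b i < i then x $$ (bottom_reflect a b i - 1, j - 1) else 0) =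
        (if top_reflect a b j < j then x $$ (i - 1, top_reflect a b j - 1) else 0) +
        (if j < bottom_reflect a b j then x $$ (i - 1, bottom_reflect a b j - 1) else 0)"
      unfolding meander_matrix_mult_index[OF xc ij, symmetric] by blast
  qed
  from meander_commutes_scalar[OF assms this] obtain c where
    c: "\<forall>i\<in>{1..a + b}. \<forall>j\<in>{1..a + b}. x $$ (i - 1, j - 1) = (if i = j then c else 0)" by blast
  have entry: "x $$ (i, j) = (if i = j then c else 0)" if "i < a + b" "j < a + b" for i j
    using c[rule_format, of "Suc i" "Suc j"] that by simp
  have "mat_trace x = of_nat (a + b) * c" using xc entry by (simp add: mat_trace_def)
  moreover have "of_nat (a + b) \<noteq> (0 :: complex)" unfolding of_nat_eq_0_iff using assms(2) by simp
  ultimately have "c = 0" using W_trace[OF x] by (metis mult_eq_0_iff)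
  show "x = 0\<^sub>m (a + b) (a + b)"
    by (rule eq_matI) (use xc entry \<open>c = 0\<close> in auto)
qed

section \<open>The diagonal principal element and its weights\<close>

definition diagonal :: "nat \<Rightarrow> (nat \<Rightarrow> complex) \<Rightarrow> complex mat" where
  "diagonal n d = Matrix.mat n n (\<lambda>(i, j). if i = j then d i else 0)"

lemma diagonal_carrier: "diagonal n d \<in> carrier_mat n n"
  by (simp add: diagonal_def)

lemma diagonal_mult_index:
  assumes "x \<in> carrier_mat n n" "i < n" "j < n"
  shows "(diagonal n d * x) $$ (i, j) = d i * x $$ (i, j)" "(x * diagonal n d) $$ (i, j) = x $$ (i, j) * d j"
proof -
  have "(diagonal n d * x) $$ (i, j) = (\<Sum>k<n. diagonal n d $$ (i, k) * x $$ (k, j))"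
    "(x * diagonal n d) $$ (i, j) = (\<Sum>k<n. x $$ (i, k) * diagonal n d $$ (k, j))"
    using assms diagonal_carrier[of n d] by (simp_all add: scalar_prod_def atLeast0LessThan)
  moreover have "(\<Sum>k<n. diagonal n d $$ (i, k) * x $$ (k, j)) = (\<Sum>k<n. if k = i then d i * x $$ (i, j) else 0)"
    by (rule sum.cong) (use assms(2,3) in \<open>auto simp: diagonal_def\<close>)
  moreover have "(\<Sum>k<n. x $$ (i, k) * diagonal n d $$ (k, j)) = (\<Sum>k<n. if k = j then x $$ (i, j) * d j else 0)"
    by (rule sum.cong) (use assms(2,3) in \<open>auto simp: diagonal_def\<close>)
  ultimately show "(diagonal n d * x) $$ (i, j) = d i * x $$ (i, j)"
    "(x * diagonal n d) $$ (i, j) = x $$ (i, j) * d j"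
    using assms(2,3) by simp_all
qed

lemma commutator_diagonal_index:
  assumes "x \<in> carrier_mat n n" "i < n" "j < n"
  shows "commutator (diagonal n d) x $$ (i, j) = (d i - d j) * x $$ (i, j)"
proof -
  have "commutator (diagonal n d) x $$ (i, j) = (diagonal n d * x) $$ (i, j) - (x * diagonal n d) $$ (i, j)"
    unfolding commutator_def using assms diagonal_carrier[of n d] by (intro index_minus_mat(1)) auto
  thus ?thesis unfolding diagonal_mult_index[OF assms] by (simp add: algebra_simps)
qed

text \<open>Subtracting the mean makes the trace zero without changing differences; i + 1 passes
  from matrix indices to vertices.\<close>

definition potential_weight :: "nat \<Rightarrow> (nat \<Rightarrow> int) \<Rightarrow> nat \<Rightarrow> complex" where
  "potential_weight n \<psi> i = of_int (\<psi> (i + 1)) - (\<Sum>k<n. of_int (\<psi> (k + 1))) / of_nat n"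

text \<open>Every nonzero entry of F has weight difference one, so F h - h F = F; invariance of the
  trace form then gives the principal equation.\<close>

lemma meander_principal:
  assumes "0 < b" "meander_potential a b \<psi>"
  shows "principal_element (W a b) (meander_functional a b) (diagonal (a + b) (potential_weight (a + b) \<psi>))"
proof -
  let ?n = "a + b" and ?d = "potential_weight (a + b) \<psi>"
  let ?h = "diagonal ?n ?d" and ?F = "meander_matrix a b"
  note F = meander_matrix_carrier[of a b] and h = diagonal_carrier[of ?n ?d]
  have "mat_trace ?h = (\<Sum>i<?n. ?d i)" by (simp add: mat_trace_def diagonal_def)
  also have "\<dots> = 0"
  proof -
    have "of_nat ?n \<noteq> (0 :: complex)" unfolding of_nat_eq_0_iff using assms(1) by simp
    thus ?thesis by (simp add: potential_weight_def sum_subtractf del: of_nat_add)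
  qed
  finally have mem: "?h \<in> W a b" by (auto simp: mem_W_iff diagonal_def)
  have weight: "?d j - ?d i = 1" if "?F $$ (i, j) \<noteq> 0" "i < ?n" "j < ?n" for i j
  proof -
    have "(i + 1, j + 1) \<in> top_edges a b \<or> (j + 1, i + 1) \<in> bottom_edges a b"
      using that by (simp add: meander_matrix_def split: if_splits)
    hence "\<psi> (j + 1) = \<psi> (i + 1) + 1" using assms(2) unfolding meander_potential_def by blast
    thus ?thesis by (simp add: potential_weight_def)
  qed
  have comm: "?F * ?h - ?h * ?F = ?F"
  proof (rule eq_matI)
    fix i j assume "i < dim_row ?F" "j < dim_col ?F"
    hence ij: "i < ?n" "j < ?n" using F by auto
    have "(?F * ?h - ?h * ?F) $$ (i, j) = (?F * ?h) $$ (i, j) - (?h * ?F) $$ (i, j)"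
      using F h ij by (intro index_minus_mat(1)) auto
    also have "\<dots> = ?F $$ (i, j) * (?d j - ?d i)"
      unfolding diagonal_mult_index[OF F ij] by (simp add: algebra_simps)
    also have "\<dots> = ?F $$ (i, j)" using weight[OF _ ij] by (cases "?F $$ (i, j) = 0") simp_all
    finally show "(?F * ?h - ?h * ?F) $$ (i, j) = ?F $$ (i, j)" .
  qed (use F h in auto)
  have "meander_functional a b (commutator ?h x) = meander_functional a b x" if "x \<in> W a b" for x
    unfolding meander_functional_def mat_trace_mult_commutator[OF F h W_carrier[OF that]] comm ..
  thus ?thesis unfolding principal_element_def using mem by blast
qed

lemma count_mset_map_distinct:
  assumes "distinct xs"
  shows "int (count (mset (map f xs)) z) = (\<Sum>x\<in>set xs. of_bool (f x = z))"
  using assms by (induction xs) auto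

lemma diff_count_potential_values:
  "diff_count (potential_values \<psi> X) (potential_values \<psi> Y) k =
     (\<Sum>(i, j)\<in>X \<times> Y. of_bool (\<psi> i - \<psi> j = k))"
  by (simp add: diff_count_def potential_values_def multiset.map_comp o_def sum_unfold_sum_mset[symmetric]
      sum.cartesian_product)

text \<open>The subtracted term at (a + b, a + b) is the zero that \<open>seaweed_count\<close>
  removes.\<close>

lemma sum_W_positions:
  fixes f :: "nat \<Rightarrow> nat \<Rightarrow> 'a::ab_group_add"
  assumes "0 < b"
  shows "(\<Sum>(i, j)\<in>set (W_positions a b). f (Suc i) (Suc j)) =
    (\<Sum>(i, j)\<in>{1..a} \<times> {1..a}. f i j) + (\<Sum>(i, j)\<in>{a + 1..a + b} \<times> {a + 1..a + b}. f i j) +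
    (\<Sum>(i, j)\<in>{1..a} \<times> {a + 1..a + b}. f i j) - f (a + b) (a + b)"
proof -
  let ?A = "{1..a}" and ?B = "{a + 1..a + b}"
  let ?S = "?A \<times> ?A \<union> ?B \<times> ?B \<union> ?A \<times> ?B"
  have image: "(\<lambda>(i, j). (Suc i, Suc j)) ` set (W_positions a b) = ?S - {(a + b, a + b)}"
  proof (rule Set.set_eqI)
    fix p :: "nat \<times> nat"
    obtain i j where p: "p = (i, j)" by (cases p)
    have "p \<in> (\<lambda>(i, j). (Suc i, Suc j)) ` set (W_positions a b) \<longleftrightarrow>
        1 \<le> i \<and> 1 \<le> j \<and> (i - 1, j - 1) \<in> set (W_positions a b)"
      unfolding p by (force simp: image_iff)
    also have "\<dots> \<longleftrightarrow> p \<in> ?S - {(a + b, a + b)}"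
      unfolding p set_W_positions using assms by auto
    finally show "p \<in> (\<lambda>(i, j). (Suc i, Suc j)) ` set (W_positions a b) \<longleftrightarrow> p \<in> ?S - {(a + b, a + b)}" .
  qed
  have "(\<Sum>(i, j)\<in>set (W_positions a b). f (Suc i) (Suc j)) = (\<Sum>(i, j)\<in>?S - {(a + b, a + b)}. f i j)"
    unfolding image[symmetric]
    by (subst sum.reindex) (auto simp: inj_on_def case_prod_unfold)
  also have "\<dots> = (\<Sum>(i, j)\<in>?S. f i j) - f (a + b) (a + b)"
    using assms by (subst sum_diff1) auto
  also have "(\<Sum>(i, j)\<in>?S. f i j) = (\<Sum>(i, j)\<in>?A \<times> ?A \<union> ?B \<times> ?B. f i j) + (\<Sum>(i, j)\<in>?A \<times> ?B. f i j)"
    by (rule sum.union_disjoint) auto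
  also have "(\<Sum>(i, j)\<in>?A \<times> ?A \<union> ?B \<times> ?B. f i j) = (\<Sum>(i, j)\<in>?A \<times> ?A. f i j) + (\<Sum>(i, j)\<in>?B \<times> ?B. f i j)"
    by (rule sum.union_disjoint) auto
  finally show ?thesis .
qed

text \<open>In the basis of matrix units the adjoint action of the diagonal principal element is
  diagonal, with eigenvalues the differences of potentials.\<close>

lemma ooms_spectrum_count:
  assumes "coprime a b" "0 < a" "0 < b" "meander_potential a b \<psi>"
  shows "int (count (ooms_spectrum (a + b) (W a b)) (of_int k)) = potential_count a b \<psi> k"
proof -
  let ?ps = "W_positions a b" and ?d = "potential_weight (a + b) \<psi>"
  let ?h = "diagonal (a + b) ?d"
  define w where "w = (\<lambda>(i, j). of_int (\<psi> (Suc i) - \<psi> (Suc j)) :: complex)"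
  interpret L: matrix_lie_algebra "a + b" "length ?ps" "W a b" "\<lambda>k. W_unit a b (?ps ! k)"
    "\<lambda>k x. if k < length ?ps then x $$ (?ps ! k) else 0"
    by (rule W_matrix_lie_algebra[OF assms(3)])
  \<comment> \<open>The correction at the last diagonal entry lies outside the listed positions, so
    each unit behaves there like a plain matrix unit.\<close>
  have comm: "commutator ?h (W_unit a b p) $$ q = w p * W_unit a b p $$ q"
    if p: "p \<in> set ?ps" and q: "q \<in> set ?ps" for p q
  proof -
    obtain i j k l where pq: "p = (i, j)" "q = (k, l)" by (cases p; cases q)
    have kl: "k < a + b" "l < a + b" "(k, l) \<noteq> (a + b - 1, a + b - 1)"
      using q unfolding pq set_W_positions by auto
    have "W_unit a b p $$ q = of_bool (q = p)"
      unfolding pq(2) W_unit_index[OF kl(1,2)] using kl(3) by auto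
    moreover have "commutator ?h (W_unit a b p) $$ q = (?d k - ?d l) * W_unit a b p $$ q"
      unfolding pq(2) by (rule commutator_diagonal_index[OF W_unit_carrier kl(1,2)])
    ultimately show ?thesis by (auto simp: pq w_def potential_weight_def)
  qed
  have ad: "L.ad ?h $$ (r, s) = (if r = s then w (?ps ! r) else 0)" if "r < length ?ps" "s < length ?ps" for r s
    using that comm[OF nth_mem[OF that(2)] nth_mem[OF that(1)]] L.co_e[OF that] by (simp add: L.ad_index)
  have "upper_triangular (L.ad ?h)" by (rule upper_triangularI) (use ad in auto)
  from char_poly_upper_triangular[OF L.ad_carrier this]
  have "proots (char_poly (L.ad ?h)) = mset (diag_mat (L.ad ?h))" by (simp only: proots_linear_factors)
  also have "diag_mat (L.ad ?h) = map w ?ps"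
    using ad by (intro nth_equalityI) (auto simp: diag_mat_def)
  finally have "ooms_spectrum (a + b) (W a b) = mset (map w ?ps)"
    using L.ooms_spectrum_eq[OF meander_frobenius[OF assms(1-3)] meander_principal[OF assms(3,4)]] by simp
  hence "int (count (ooms_spectrum (a + b) (W a b)) (of_int k)) = (\<Sum>p\<in>set ?ps. of_bool (w p = of_int k))"
    by (simp only: count_mset_map_distinct[OF distinct_W_positions])
  also have "\<dots> = (\<Sum>(i, j)\<in>set ?ps. of_bool (\<psi> (Suc i) - \<psi> (Suc j) = k))"
    by (rule sum.cong) (auto simp: w_def simp flip: of_int_diff)
  also have "\<dots> = potential_count a b \<psi> k"
    unfolding seaweed_count_def diff_count_potential_values sum_W_positions[OF assms(3), of "\<lambda>i j. of_bool (\<psi> i - \<psi> j = k)"]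
    by (simp add: eq_commute[of 0])
  finally show ?thesis .
qed

section \<open>The stable range\<close>

lemma meander_potential_cong:
  assumes "\<And>i. 1 \<le> i \<Longrightarrow> i \<le> a + b \<Longrightarrow> \<psi> i = \<psi>' i"
  shows "meander_potential a b \<psi> \<longleftrightarrow> meander_potential a b \<psi>'"
  unfolding meander_potential_def
  by (intro arg_cong2[where f = conj] ball_cong refl)
     (use assms in \<open>auto simp: top_edges_def bottom_edges_def\<close>)

text \<open>The reduction read backwards. It supplies potentials along the whole family from the one
  at q = 0.\<close>

lemma meander_potential_extend:
  assumes "meander_potential a b \<psi>"
  obtains \<psi>' where "meander_potential (a + b) b \<psi>'"
    "potential_values \<psi>' {1..a + b} = potential_values \<psi> {1..a} + potential_values \<psi> {a + 1..a + b}"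
    "potential_values \<psi>' {a + b + 1..a + b + b} = lower (potential_values \<psi> {a + 1..a + b})"
proof -
  \<comment> \<open>The first a + b vertices are reversed. A vertex i of the last block is joined by
    a bottom edge to a + 2 * b + 1 - i, whose value is \<psi> (i - b), and lies one below
    it.\<close>
  define \<psi>' where "\<psi>' = (\<lambda>i. if i \<le> a + b then \<psi> (a + b + 1 - i) else \<psi> (i - b) - 1)"
  have eq: "\<psi>' (a + b + 1 - i) = \<psi> i" if "1 \<le> i" "i \<le> a + b" for i
  proof -
    have "a + b + 1 - (a + b + 1 - i) = i" "a + b + 1 - i \<le> a + b" using that by auto
    thus ?thesis by (simp add: \<psi>'_def)
  qed
  have mp: "meander_potential (a + b) b \<psi>'"
    unfolding meander_potential_reduce
  proof (intro conjI allI impI)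
    show "meander_potential a b (\<lambda>i. \<psi>' (a + b + 1 - i))"
      using meander_potential_cong[of a b _ \<psi>, OF eq] assms by blast
    fix i assume "1 \<le> i" "i \<le> b"
    moreover from this have "a + 2 * b + 1 - i - b = a + b + 1 - i" "\<not> a + 2 * b + 1 - i \<le> a + b" by auto
    ultimately show "\<psi>' (a + 2 * b + 1 - i) = \<psi>' i - 1" by (simp add: \<psi>'_def)
  qed
  have "potential_values (\<lambda>i. \<psi>' (a + b + 1 - i)) X = potential_values \<psi> X" if "X \<subseteq> {1..a + b}" for X
    by (rule potential_values_cong) (use that eq in auto)
  with potential_values_reduce[OF mp] mp that show thesis by auto
qed

lemma (in potential_family) meander_potential_family:
  assumes "meander_potential s b \<psi>"
    and "potential_values \<psi> {1..s} = \<alpha>" and "potential_values \<psi> {s + 1..s + b} = \<beta>"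
  shows "\<exists>\<psi>'. meander_potential (s + q * b) b \<psi>' \<and> \<alpha>s q = potential_values \<psi>' {1..s + q * b} \<and>
    \<beta>s q = potential_values \<psi>' {s + q * b + 1..s + q * b + b}"
proof (induction q)
  case 0
  show ?case using assms by auto
next
  case (Suc q)
  then obtain \<psi>' where \<psi>': "meander_potential (s + q * b) b \<psi>'"
    "\<alpha>s q = potential_values \<psi>' {1..s + q * b}"
    "\<beta>s q = potential_values \<psi>' {s + q * b + 1..s + q * b + b}" by blast
  have "s + Suc q * b = s + q * b + b" by simp
  with meander_potential_extend[OF \<psi>'(1)] \<psi>'(2,3) show ?case by (metis \<alpha>s.simps(2) \<beta>s.simps(2))
qed

lemma potential_family_of_meander:
  assumes "coprime s b" "0 < s" "0 < b" "meander_potential s b \<psi>"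
  shows "potential_family (potential_values \<psi> {1..s}) (potential_values \<psi> {s + 1..s + b})
    (Min (\<psi> ` {1..s + b})) (potential_range s b \<psi>)"
proof
  fix k show "potential_count s b \<psi> (1 - k) = potential_count s b \<psi> k"
    by (rule potential_count_symmetric[OF assms])
next
  fix x assume "x \<in># potential_values \<psi> {1..s} + potential_values \<psi> {s + 1..s + b}"
  hence "x \<in> \<psi> ` {1..s + b}" by (auto simp: potential_values_def)
  hence "Min (\<psi> ` {1..s + b}) \<le> x" "x \<le> Max (\<psi> ` {1..s + b})" by simp_all
  thus "Min (\<psi> ` {1..s + b}) \<le> x \<and> x \<le> Min (\<psi> ` {1..s + b}) + int (potential_range s b \<psi>)"
    by (simp add: potential_range_def)
next
  show "potential_values \<psi> {s + 1..s + b} \<noteq> {#}"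
    using assms(3) by (simp add: potential_values_def mset_set_empty_iff)
qed

lemma finite_check:
  fixes P :: "nat \<Rightarrow> bool"
  assumes "\<And>q. m \<le> q \<Longrightarrow> P q \<Longrightarrow> P (Suc q)" "m \<le> n"
  shows "(\<forall>q. P q) \<longleftrightarrow> (\<forall>q\<le>n. P q)"
proof (intro iffI allI)
  fix q assume *: "\<forall>q\<le>n. P q"
  show "P q"
  proof (cases "q \<le> m")
    case True
    thus ?thesis using * assms(2) by auto
  next
    case False
    hence "m \<le> q" by simp
    thus ?thesis by (induction q rule: dec_induct) (use * assms in auto)
  qed
qed auto

text \<open>The spectra are translated into \<open>log_concave_fun\<close> from 2 * l + 2 on, where
  \<open>S_antimono\<close> provides the unbroken support; from there log-concavity propagates, and
  the finite check covers the start.\<close>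

lemma W_family:
  assumes "coprime s b" "0 < s" "0 < b" "meander_potential s b \<psi>" "l = potential_range s b \<psi>"
  shows "(\<forall>q. W_log_concave (s + q * b) b) \<longleftrightarrow> (\<forall>q \<le> 2 * l + 4. W_log_concave (s + q * b) b)"
    and "(\<forall>q. W_strictly_internally_log_concave (s + q * b) b) \<longleftrightarrow>
      (\<forall>q \<le> 2 * l + 4. W_strictly_internally_log_concave (s + q * b) b)"
proof -
  interpret potential_family "potential_values \<psi> {1..s}" "potential_values \<psi> {s + 1..s + b}"
    "Min (\<psi> ` {1..s + b})" l
    using potential_family_of_meander[OF assms(1-4)] unfolding assms(5) .
  have count: "int (count (ooms_spectrum (s + q * b + b) (W (s + q * b) b)) (of_int k)) = S q k" for q k
  proof -
    obtain \<psi>' where \<psi>': "meander_potential (s + q * b) b \<psi>'"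
      "\<alpha>s q = potential_values \<psi>' {1..s + q * b}"
      "\<beta>s q = potential_values \<psi>' {s + q * b + 1..s + q * b + b}"
      using meander_potential_family[OF assms(4) refl refl] by blast
    have "coprime (s + q * b) b"
      using assms(1) by (metis add.commute coprime_iff_gcd_eq_1 gcd.commute gcd_add_mult)
    thus ?thesis using ooms_spectrum_count[OF _ _ assms(3) \<psi>'(1)] assms(2) \<psi>'(2,3) by simp
  qed
  have lc: "W_log_concave (s + q * b) b \<longleftrightarrow> log_concave_fun (S q)"
    and slc: "W_strictly_internally_log_concave (s + q * b) b \<longleftrightarrow> strictly_log_concave_fun (S q)"
    if "2 * l + 2 \<le> q" for q
  proof -
    \<comment> \<open>A strict decrease from S q 1 to the nonnegative S q 2.\<close>
    have "0 < S q 1" using S_decrement_pos[of 1 q] S_nonneg[of q 2] that by simp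
    note * = multiplicity_sequence_log_concave[where f = "S q", OF count this S_symmetric S_antimono]
    show "W_log_concave (s + q * b) b \<longleftrightarrow> log_concave_fun (S q)"
      and "W_strictly_internally_log_concave (s + q * b) b \<longleftrightarrow> strictly_log_concave_fun (S q)"
      unfolding W_log_concave_def W_strictly_internally_log_concave_def using * that by simp_all
  qed
  show "(\<forall>q. W_log_concave (s + q * b) b) \<longleftrightarrow> (\<forall>q \<le> 2 * l + 4. W_log_concave (s + q * b) b)"
  proof (rule finite_check)
    fix q assume q: "2 * l + 2 \<le> q" and "W_log_concave (s + q * b) b"
    moreover have "2 * l + 2 \<le> Suc q" using q by simp
    ultimately show "W_log_concave (s + Suc q * b) b"
      using lc log_concave_S_Suc(1)[OF q] by blast
  qed simp
  show "(\<forall>q. W_strictly_internally_log_concave (s + q * b) b) \<longleftrightarrow>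
      (\<forall>q \<le> 2 * l + 4. W_strictly_internally_log_concave (s + q * b) b)"
  proof (rule finite_check)
    fix q assume q: "2 * l + 2 \<le> q" and "W_strictly_internally_log_concave (s + q * b) b"
    moreover have "2 * l + 2 \<le> Suc q" using q by simp
    ultimately show "W_strictly_internally_log_concave (s + Suc q * b) b"
      using slc log_concave_S_Suc(2)[OF q] by blast
  qed simp
qed

theorem theorem1p4:
  shows "(\<forall>(b::nat) (s::nat) (\<psi>::nat \<Rightarrow> int) (l::nat).
            2 \<le> b \<and> 1 \<le> s \<and> s < b \<and> coprime s b \<and>
            meander_potential s b \<psi> \<and> l = potential_range s b \<psi> \<longrightarrow>
            ((\<forall>q. W_log_concave (s + q * b) b) \<longleftrightarrow>
             (\<forall>q \<le> 2 * l + 4. W_log_concave (s + q * b) b)) \<and>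
            ((\<forall>q. W_strictly_internally_log_concave (s + q * b) b) \<longleftrightarrow>
             (\<forall>q \<le> 2 * l + 4. W_strictly_internally_log_concave (s + q * b) b))) \<and>
         (\<forall>(l::nat). l = 1 \<longrightarrow>
            ((\<forall>q. W_log_concave (1 + q) 1) \<longleftrightarrow>
             (\<forall>q \<le> 2 * l + 4. W_log_concave (1 + q) 1)) \<and>
            ((\<forall>q. W_strictly_internally_log_concave (1 + q) 1) \<longleftrightarrow>
             (\<forall>q \<le> 2 * l + 4. W_strictly_internally_log_concave (1 + q) 1)))"
proof -
  \<comment> \<open>The meander of (1, 1) is a single bottom edge, with values 1 and 0, hence l = 1.
    This makes the case b = 1 another instance of \<open>W_family\<close>.\<close>
  define \<psi> :: "nat \<Rightarrow> int" where "\<psi> = (\<lambda>i. 2 - int i)"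
  have \<psi>: "meander_potential 1 1 \<psi>" by (auto simp: meander_potential_iff \<psi>_def)
  have "{1..1 + 1::nat} = {1, 2}" by auto
  hence range: "1 = potential_range 1 1 \<psi>" by (simp add: potential_range_def \<psi>_def)
  show ?thesis
  proof (rule conjI; intro allI impI)
    fix b s \<psi> l
    assume *: "2 \<le> b \<and> 1 \<le> s \<and> s < b \<and> coprime s b \<and>
      meander_potential s b \<psi> \<and> l = potential_range s b \<psi>"
    hence "0 < s" "0 < b" by auto
    with * show "((\<forall>q. W_log_concave (s + q * b) b) \<longleftrightarrow>
        (\<forall>q \<le> 2 * l + 4. W_log_concave (s + q * b) b)) \<and>
      ((\<forall>q. W_strictly_internally_log_concave (s + q * b) b) \<longleftrightarrow>
        (\<forall>q \<le> 2 * l + 4. W_strictly_internally_log_concave (s + q * b) b))"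
      by (intro conjI W_family) auto
  next
    fix l :: nat assume "l = 1"
    thus "((\<forall>q. W_log_concave (1 + q) 1) \<longleftrightarrow>
        (\<forall>q \<le> 2 * l + 4. W_log_concave (1 + q) 1)) \<and>
      ((\<forall>q. W_strictly_internally_log_concave (1 + q) 1) \<longleftrightarrow>
        (\<forall>q \<le> 2 * l + 4. W_strictly_internally_log_concave (1 + q) 1))"
      using W_family[OF coprime_1_left _ _ \<psi> range] unfolding mult_1_right by simp
  qed
qed

end
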